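(* Let $\epsilon,\delta\in(0,1)$ and let $a_1,a_2,\ldots\in\mathbb{R}^d$ be a stream of rows. Run the streaming algorithm described in the context on this input. Then, for every $n$, after receiving row $a_n$ the algorithm returns a weighted set $(Q_n,w_n)$ which, with probability $1-\delta$, is an $\epsilon$-coreset for $A_n$ (the $n\times d$ matrix whose rows are $a_1,\ldots,a_n$). The algorithm uses space $O\!\left(\frac{d}{\epsilon^2}\left(\log^2 d+\log\frac{1}{\delta}\right)\right)$ rows (each row being a vector in $\mathbb{R}^d$), and its worst-case update time is $O(d^2)$ (measured in operations on $d$-dimensional vectors).
   Context: For $x\in\mathbb{R}^d$ and a compact set $S\subset\mathbb{R}^d$, let $\mu(x,S)=\min_{s\in S}\|x-s\|_2^2$, and for a matrix $A\in\mathbb{R}^{n\times d}$ with rows $a_1,\ldots,a_n$ let $\mu(A,S)=\sum_{i=1}^n\mu(a_i,S)$. An $\epsilon$-coreset for $A$ is a weighted set $(Q,w)$ of rows with $w>0$ (each element of $Q$ being a row of $A$, possibly with repetition) such that for every affine $(d-1)$-dimensional subspace $S\subset\mathbb{R}^d$, $\left|\mu(A,S)-\sum_{q\in Q}w(q)\mu(q,S)\right|\le\epsilon\,\mu(A,S)$. The sensitivity of row $a_i$ with respect to $A$ is $s_A(a_i)=\max_{S}\frac{\mu(a_i,S)}{\mu(A,S)}$, the maximum over all $(d-1)$-dimensional linear subspaces $S$ of $\mathbb{R}^d$ (with $\mu(A,S)>0$). The algorithm: set $m=\lceil 3d\epsilon^{-2}(\log_2^2 d+\ln(2/\delta))\rceil$,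 $Y=\{1,\ldots,8m\}$, and $M_y=\emptyset$ for each $y\in Y$. When row $a_n$ arrives: let $A_n$ be the matrix with rows $a_1,\ldots,a_n$, $r_n=\mathrm{rank}(A_n)$, and $s_n(a_i)=s_{A_n}(a_i)$ (computed from $A_n^\top A_n=\sum_{j\le n}a_ja_j^\top$, which is maintained). For each $y\in Y$, draw $u_y(a_n)$ uniformly at random from $[0,1)$, independently of everything else, and add $a_n$ to $M_y$. Then for each $y\in Y$ and each $a_i\in M_y$, delete $a_i$ from $M_y$ if $u_y(a_i)>\frac{s_n(a_i)}{s_n(a_i)+r_n}$. Let $\Gamma_n=\{y\in Y:|M_y|=1\}$, let $Q_n$ be the (multi)set union of the sets $M_y$ for $y\in\Gamma_n$, and for $a_i\in Q_n$ let $w_n(a_i)=\frac{r_n}{|Q_n|\,s_n(a_i)}$. Output $(Q_n,w_n)$.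
   Formalization: Coreset queries are linear, not affine, hyperplanes (affine is false for rows 0, b≠0); space and time bounds hold with probability 1-δ and in expectation, not surely; the update-time constant is C(1+ln(1/δ))/ε²; the space bound omits d=1 with δ>1/2. *)

theory Defs
  imports "HOL-Probability.Probability" "HOL-Library.Monad_Syntax"
begin

section \<open>Coresets and sensitivities\<close>

text \<open>A matrix is the list of its rows, so that the number of rows may vary while the
  dimension \<open>d = CARD('d)\<close> stays fixed. The stream is indexed from 1.\<close>

definition rows_upto :: "(nat \<Rightarrow> real^'d) \<Rightarrow> nat \<Rightarrow> (real^'d) list" where
  "rows_upto a n = map a [1..<Suc n]"

definition row_rank :: "(real^'d) list \<Rightarrow> nat" where
  "row_rank A = dim (set A)"

definition sqdist :: "real^'d \<Rightarrow> (real^'d) set \<Rightarrow> real" where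
  "sqdist x S = (INF s\<in>S. (norm (x - s))\<^sup>2)"

definition total_sqdist :: "(real^'d) list \<Rightarrow> (real^'d) set \<Rightarrow> real" where
  "total_sqdist A S = (\<Sum>x\<leftarrow>A. sqdist x S)"

definition linear_hyperplanes :: "(real^'d) set set" where
  "linear_hyperplanes = {S. subspace S \<and> dim S + 1 = CARD('d)}"

definition affine_hyperplanes :: "(real^'d) set set" where
  "affine_hyperplanes = {S. affine S \<and> aff_dim S = int CARD('d) - 1}"

text \<open>The maximum over an empty set of admissible hyperplanes, i.e. for a zero matrix, is 0.
  Inserting 0 changes nothing otherwise, the quotients being nonnegative.\<close>

definition sensitivity :: "(real^'d) list \<Rightarrow> real^'d \<Rightarrow> real" where
  "sensitivity A x =
     Sup (insert 0 {sqdist x S / total_sqdist A S | S.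
                      S \<in> linear_hyperplanes \<and> total_sqdist A S > 0})"

text \<open>A weighted set is a multiset of pairs (row, weight), since rows may be repeated.\<close>

definition coreset_for ::
    "(real^'d) set set \<Rightarrow> real \<Rightarrow> (real^'d) list \<Rightarrow> ((real^'d) \<times> real) multiset \<Rightarrow> bool" where
  "coreset_for \<S> \<epsilon> A W \<longleftrightarrow>
     (\<forall>(q, w) \<in># W. q \<in> set A \<and> w > 0) \<and>
     (\<forall>S\<in>\<S>. \<bar>total_sqdist A S - (\<Sum>(q, w)\<in>#W. w * sqdist q S)\<bar> \<le> \<epsilon> * total_sqdist A S)"

text \<open>The queries are the hyperplanes through the origin, as in the sensitivities.
  Lemma \<open>not_coreset_affine\<close> below shows that with \<^const>\<open>affine_hyperplanes\<close> instead
  the algorithm, which samples by these sensitivities, would fail almost surely on some streams.\<close>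

abbreviation is_coreset :: "real \<Rightarrow> (real^'d) list \<Rightarrow> ((real^'d) \<times> real) multiset \<Rightarrow> bool" where
  "is_coreset \<equiv> coreset_for linear_hyperplanes"

section \<open>The sampling algorithm\<close>

definition sample_size :: "nat \<Rightarrow> real \<Rightarrow> real \<Rightarrow> nat" where
  "sample_size d \<epsilon> \<delta> = nat \<lceil>3 * real d / \<epsilon>\<^sup>2 * ((log 2 (real d))\<^sup>2 + ln (2 / \<delta>))\<rceil>"

text \<open>The random input \<open>u (y, i)\<close> is the number drawn for \<open>y\<close> when the \<open>i\<close>-th row arrives.\<close>

definition draws :: "(nat \<times> nat \<Rightarrow> real) measure" where
  "draws = (\<Pi>\<^sub>M _\<in>UNIV. uniform_measure lborel {0..<1})"

text \<open>The sets \<open>M_y\<close> hold indices of rows, as equal rows of the stream are sampled separately.\<close>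

fun sampled :: "(nat \<Rightarrow> real^'d) \<Rightarrow> (nat \<times> nat \<Rightarrow> real) \<Rightarrow> nat \<Rightarrow> nat \<Rightarrow> nat set" where
  "sampled a u 0 y = {}"
| "sampled a u (Suc n) y =
     (let A = rows_upto a (Suc n); r = real (row_rank A)
      in {i \<in> insert (Suc n) (sampled a u n y).
            \<not> u (y, i) > sensitivity A (a i) / (sensitivity A (a i) + r)})"

definition singles :: "nat \<Rightarrow> (nat \<Rightarrow> real^'d) \<Rightarrow> (nat \<times> nat \<Rightarrow> real) \<Rightarrow> nat \<Rightarrow> nat set" where
  "singles m a u n = {y\<in>{1..8 * m}. card (sampled a u n y) = 1}"

definition sample ::
    "nat \<Rightarrow> (nat \<Rightarrow> real^'d) \<Rightarrow> (nat \<times> nat \<Rightarrow> real) \<Rightarrow> nat \<Rightarrow> (real^'d) multiset" where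
  "sample m a u n = (\<Sum>y\<in>singles m a u n. image_mset a (mset_set (sampled a u n y)))"

definition weighted_sample ::
    "nat \<Rightarrow> (nat \<Rightarrow> real^'d) \<Rightarrow> (nat \<times> nat \<Rightarrow> real) \<Rightarrow> nat \<Rightarrow> ((real^'d) \<times> real) multiset" where
  "weighted_sample m a u n =
     (let A = rows_upto a n; Q = sample m a u n
      in {# (q, real (row_rank A) / (real (size Q) * sensitivity A q)). q \<in># Q #})"

section \<open>An implementation with operation counts\<close>

text \<open>To give update time and space a meaning, the algorithm is implemented over a small set of
  primitives that carry a cost. Each operation on \<open>d\<close>-dimensional vectors costs one unit, and so
  does each scalar operation.\<close>

datatype 'a costed = Costed (result: 'a) (cost: nat)

definition ret :: "'a \<Rightarrow> 'a costed" where
  "ret x = Costed x 0"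

definition bind_costed :: "'a costed \<Rightarrow> ('a \<Rightarrow> 'b costed) \<Rightarrow> 'b costed" where
  "bind_costed p f = Costed (result (f (result p))) (cost p + cost (f (result p)))"

adhoc_overloading Monad_Syntax.bind \<rightleftharpoons> bind_costed

text \<open>\<open>scalar k x\<close>: the scalar \<open>x\<close> is obtained by \<open>k\<close> scalar operations.\<close>

definition scalar :: "nat \<Rightarrow> 'a \<Rightarrow> 'a costed" where
  "scalar k x = Costed x k"

definition dot :: "real^'d \<Rightarrow> real^'d \<Rightarrow> real costed" where
  "dot x y = Costed (x \<bullet> y) 1"

definition scale :: "real \<Rightarrow> real^'d \<Rightarrow> (real^'d) costed" where
  "scale c x = Costed (c *\<^sub>R x) 1"

definition axpy :: "real \<Rightarrow> real^'d \<Rightarrow> real^'d \<Rightarrow> (real^'d) costed" where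
  "axpy c x y = Costed (c *\<^sub>R x + y) 2"

definition is_zero :: "real^'d \<Rightarrow> bool costed" where
  "is_zero x = Costed (x = 0) 1"

definition each_coord :: "('d::finite \<Rightarrow> 'a costed) \<Rightarrow> ('a^'d) costed" where
  "each_coord f = Costed (\<chi> k. result (f k)) (\<Sum>k\<in>UNIV. cost (f k))"

definition each_in :: "nat set \<Rightarrow> (nat \<Rightarrow> 'a costed) \<Rightarrow> (nat \<Rightarrow> 'a) costed" where
  "each_in Y f = Costed (\<lambda>y\<in>Y. result (f y)) (\<Sum>y\<in>Y. cost (f y))"

primrec map_costed :: "('a \<Rightarrow> 'b costed) \<Rightarrow> 'a list \<Rightarrow> 'b list costed" where
  "map_costed f [] = ret []"
| "map_costed f (x # xs) = do { y \<leftarrow> f x; ys \<leftarrow> map_costed f xs; ret (y # ys) }"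

primrec filter_costed :: "('a \<Rightarrow> bool costed) \<Rightarrow> 'a list \<Rightarrow> 'a list costed" where
  "filter_costed f [] = ret []"
| "filter_costed f (x # xs) =
     do { b \<leftarrow> f x; ys \<leftarrow> filter_costed f xs; ret (if b then x # ys else ys) }"

definition mat_vec :: "real^'d^'d \<Rightarrow> real^'d \<Rightarrow> (real^'d) costed" where
  "mat_vec H x = each_coord (\<lambda>k. dot (H $ k) x)"

text \<open>\<open>add_outer c x y H\<close> is the matrix \<open>H + c x y\<^sup>T\<close>.\<close>

definition add_outer ::
    "real \<Rightarrow> real^'d \<Rightarrow> real^'d \<Rightarrow> real^'d^'d \<Rightarrow> (real^'d^'d) costed" where
  "add_outer c x y H = each_coord (\<lambda>k. do { b \<leftarrow> scalar 1 (c * x $ k); axpy b y (H $ k) })"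

text \<open>A stored row carries its random number and its current sensitivity. Besides
  \<open>gram = A\<^sup>T A\<close> the state holds the Moore-Penrose inverse \<open>pinv\<close> of \<open>gram\<close>; the sensitivity of a
  row \<open>x\<close> is \<open>x\<^sup>T pinv x\<close>.\<close>

datatype ('d::finite) item = Item (row: "real^'d") (rnd: real) (sens: real)

record ('d::finite) state =
  gram :: "real^'d^'d"
  pinv :: "real^'d^'d"
  rk :: nat
  bag :: "nat \<Rightarrow> 'd item list"

definition init_state :: "'d::finite state" where
  "init_state = \<lparr>gram = 0, pinv = 0, rk = 0, bag = (\<lambda>_. [])\<rparr>"

text \<open>Arrival of the row \<open>x\<close>, before the deletions. If \<open>x\<close> lies in the span of the earlier rows,
  \<open>pinv\<close> is updated by the Sherman-Morrison formula. Otherwise its component \<open>c\<close> orthogonal to that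
  span is nonzero, \<open>pinv\<close> is updated by Meyer's formula, the earlier sensitivities do not change
  and that of \<open>x\<close> is 1.\<close>

definition arrive ::
    "nat \<Rightarrow> (nat \<Rightarrow> real) \<Rightarrow> real^'d \<Rightarrow> 'd state \<Rightarrow> ('d state) costed" where
  "arrive m v x st = do {
     g \<leftarrow> mat_vec (pinv st) x;
     h \<leftarrow> mat_vec (gram st) x;
     p \<leftarrow> mat_vec (pinv st) h;
     c \<leftarrow> axpy (- 1) p x;
     b \<leftarrow> dot x g;
     t \<leftarrow> scalar 1 (1 + b);
     H \<leftarrow> add_outer 1 x x (gram st);
     z \<leftarrow> is_zero c;
     if z then do {
       e \<leftarrow> scalar 2 (- 1 / t);
       G \<leftarrow> add_outer e g g (pinv st);
       s \<leftarrow> scalar 1 (b / t);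
       B \<leftarrow> each_in {1..8 * m} (\<lambda>y. do {
         its \<leftarrow> map_costed (\<lambda>it. do {
             q \<leftarrow> dot (row it) g;
             s' \<leftarrow> scalar 3 (sens it - q\<^sup>2 / t);
             ret (Item (row it) (rnd it) s') }) (bag st y);
         w \<leftarrow> scalar 1 (v y);
         scalar 1 (Item x w s # its) });
       ret \<lparr>gram = H, pinv = G, rk = rk st, bag = B\<rparr>
     } else do {
       q \<leftarrow> dot c c;
       e \<leftarrow> scalar 1 (1 / q);
       k \<leftarrow> scale e c;
       G1 \<leftarrow> add_outer (- 1) k g (pinv st);
       G2 \<leftarrow> add_outer (- 1) g k G1;
       G3 \<leftarrow> add_outer t k k G2;
       r \<leftarrow> scalar 1 (rk st + 1);
       B \<leftarrow> each_in {1..8 * m} (\<lambda>y. do {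
         w \<leftarrow> scalar 1 (v y);
         scalar 1 (Item x w 1 # bag st y) });
       ret \<lparr>gram = H, pinv = G3, rk = r, bag = B\<rparr>
     } }"

definition prune :: "nat \<Rightarrow> 'd::finite state \<Rightarrow> ('d state) costed" where
  "prune m st = do {
     B \<leftarrow> each_in {1..8 * m} (\<lambda>y.
       filter_costed (\<lambda>it. scalar 3 (\<not> rnd it > sens it / (sens it + real (rk st)))) (bag st y));
     ret (st\<lparr>bag := B\<rparr>) }"

definition report :: "nat \<Rightarrow> 'd::finite state \<Rightarrow> (((real^'d) \<times> real) multiset) costed" where
  "report m st = do {
     f \<leftarrow> each_in {1..8 * m} (\<lambda>y. scalar 1 (length (bag st y) = 1));
     N \<leftarrow> scalar (8 * m) (card {y\<in>{1..8 * m}. f y});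
     W \<leftarrow> each_in {y\<in>{1..8 * m}. f y} (\<lambda>y.
       let it = hd (bag st y) in scalar 2 (row it, real (rk st) / (real N * sens it)));
     ret (image_mset W (mset_set {y\<in>{1..8 * m}. f y})) }"

definition update ::
    "nat \<Rightarrow> (nat \<Rightarrow> real) \<Rightarrow> real^'d \<Rightarrow> 'd state \<Rightarrow> ('d state \<times> ((real^'d) \<times> real) multiset) costed" where
  "update m v x st = do {
     st1 \<leftarrow> arrive m v x st;
     st2 \<leftarrow> prune m st1;
     W \<leftarrow> report m st2;
     ret (st2, W) }"

fun run ::
    "nat \<Rightarrow> (nat \<Rightarrow> real^'d) \<Rightarrow> (nat \<times> nat \<Rightarrow> real) \<Rightarrow> nat \<Rightarrow> 'd state" where
  "run m a u 0 = init_state"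
| "run m a u (Suc n) =
     fst (result (update m (\<lambda>y. u (y, Suc n)) (a (Suc n)) (run m a u n)))"

text \<open>The output, the time and the space of the \<open>n\<close>-th update, for \<open>n \<ge> 1\<close>.\<close>

definition output_at ::
    "nat \<Rightarrow> (nat \<Rightarrow> real^'d) \<Rightarrow> (nat \<times> nat \<Rightarrow> real) \<Rightarrow> nat \<Rightarrow> ((real^'d) \<times> real) multiset" where
  "output_at m a u n = snd (result (update m (\<lambda>y. u (y, n)) (a n) (run m a u (n - 1))))"

definition time_at ::
    "nat \<Rightarrow> (nat \<Rightarrow> real^'d) \<Rightarrow> (nat \<times> nat \<Rightarrow> real) \<Rightarrow> nat \<Rightarrow> nat" where
  "time_at m a u n = cost (update m (\<lambda>y. u (y, n)) (a n) (run m a u (n - 1)))"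

text \<open>Space is counted in rows and at its peak, i.e. with the new row in all the sets and before the
  deletions: three units for a stored row with its two scalars, the old and the new versions of the
  two matrices, two units per output pair, and ten units for the vectors \<open>x, g, h, p, c, k\<close> and
  the scalars of \<^const>\<open>arrive\<close>.\<close>

definition space_at ::
    "nat \<Rightarrow> (nat \<Rightarrow> real^'d) \<Rightarrow> (nat \<times> nat \<Rightarrow> real) \<Rightarrow> nat \<Rightarrow> nat" where
  "space_at m a u n =
     (let st1 = result (arrive m (\<lambda>y. u (y, n)) (a n) (run m a u (n - 1)))
      in (\<Sum>y\<in>{1..8 * m}. 3 * length (bag st1 y)) + 4 * CARD('d)
         + 2 * size (output_at m a u n) + 10)"
  for a :: "nat \<Rightarrow> real^'d"

section \<open>Affine queries\<close>

lemma sqdist_self: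
  assumes "x \<in> S"
  shows "sqdist x S = 0"
proof (rule antisym)
  show "sqdist x S \<le> 0"
    unfolding sqdist_def using assms by (intro cINF_lower2[where x = x]) (auto intro!: bdd_belowI[of _ 0])
  show "0 \<le> sqdist x S"
    unfolding sqdist_def using assms by (intro cINF_greatest) auto
qed

lemma sensitivity_zero: "sensitivity A 0 = 0"
proof -
  have eq: "insert 0 {sqdist 0 S / total_sqdist A S | S.
          S \<in> linear_hyperplanes \<and> total_sqdist A S > 0} = {0::real}"
    by (auto simp: linear_hyperplanes_def subspace_0 sqdist_self)
  show ?thesis unfolding sensitivity_def eq by simp
qed

lemma not_coreset_affine:
  fixes a :: "nat \<Rightarrow> real^'d"
  assumes a: "a 1 = 0" "a 2 \<noteq> 0" and \<epsilon>: "\<epsilon> < 1" and u: "\<And>y. u (y, 1) > 0"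
  shows "\<not> coreset_for affine_hyperplanes \<epsilon> (rows_upto a 2) (weighted_sample m a u 2)"
proof
  define S where "S = {x. a 2 \<bullet> x = a 2 \<bullet> a 2}"
  have S: "S \<in> affine_hyperplanes"
    using a(2) by (simp add: S_def affine_hyperplanes_def affine_hyperplane)
  have s2: "sqdist (a 2) S = 0" by (simp add: S_def sqdist_self)
  have "norm (a 2) \<le> norm x" if "x \<in> S" for x
    using that norm_cauchy_schwarz[of "a 2" x] a(2)
    by (simp add: S_def dot_square_norm power2_eq_square)
  then have "(norm (a 2))\<^sup>2 \<le> sqdist 0 S"
    unfolding sqdist_def
    by (intro cINF_greatest) (auto simp: S_def intro: power_mono exI[of _ "a 2"])
  then have s1: "sqdist 0 S > 0" using a(2) by (smt (verit) zero_less_norm_iff zero_less_power)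
  have rows: "rows_upto a 2 = [0, a 2]" using a by (simp add: rows_upto_def upt_rec numeral_2_eq_2)
  have "sampled a u 2 y \<subseteq> {2}" for y
    using u[of y] a by (auto simp: numeral_2_eq_2 Let_def sensitivity_zero)
  then have "q = a 2" if "q \<in># sample m a u 2" for q
    using that finite_subset[of _ "{2::nat}"] by (auto simp: sample_def singles_def set_mset_sum)
  then have "(\<Sum>(q, w)\<in>#weighted_sample m a u 2. w * sqdist q S) = 0"
    by (fastforce simp: weighted_sample_def Let_def s2 simp del: sum_mset_0_iff
        intro!: sum_mset.neutral)
  moreover assume "coreset_for affine_hyperplanes \<epsilon> (rows_upto a 2) (weighted_sample m a u 2)"
  ultimately have "\<bar>sqdist 0 S\<bar> \<le> \<epsilon> * sqdist 0 S"
    using S by (fastforce simp: coreset_for_def rows total_sqdist_def s2)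
  then show False using s1 \<epsilon> by (simp add: mult_less_cancel_right1)
qed

end

theory Submission
  imports Defs
begin

text \<open>Let \<open>G = A\<^sup>T A\<close>, \<open>H\<close> its pseudoinverse, \<open>s\<^sub>i = a\<^sub>i\<^sup>T H a\<^sub>i\<close> the sensitivities and \<open>r\<close>
  their sum, the rank. Sensitivities only decrease and ranks only increase, so row \<open>i\<close> is in \<open>M\<^sub>y\<close>
  iff \<open>u\<^sub>y(a\<^sub>i) \<le> p\<^sub>i = s\<^sub>i / (s\<^sub>i + r)\<close>. As \<open>p\<^sub>i / (1 - p\<^sub>i) = s\<^sub>i / r\<close>, each \<open>M\<^sub>y\<close> is a singleton with
  probability \<open>\<Prod>(1 - p\<^sub>i) \<ge> 1 / e\<close>, and then it is \<open>{a\<^sub>i}\<close> with probability \<open>s\<^sub>i / r\<close>. In the inner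
  product \<open>x\<^sup>T G y\<close> the vectors \<open>H a\<^sub>i / \<surd>s\<^sub>i\<close> are unit vectors, so the coreset property says that
  the sum \<open>M\<close> of the rank-one projections drawn lies within \<open>(1 \<plusminus> \<epsilon>) N / r\<close>, where \<open>N\<close> is their
  number: a matrix Chernoff bound.

  That bound needs neither the spectral theorem nor Golden-Thompson. For a rank-one projection \<open>X\<close>
  onto a unit vector \<open>v\<close>, the trace of \<open>(K \<plusminus> X)\<^sup>p\<close> is at most
  \<open>tr K\<^sup>p + \<langle>v, ((K \<plusminus> 1)\<^sup>p - K\<^sup>p) v\<rangle>\<close>, by log-convexity of the moments \<open>\<langle>v, K\<^sup>p v\<rangle>\<close>. Averaging
  over \<open>v\<close> gives a recursion that bounds the expected trace moments by those of a binomial variable,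
  and the exponential series turns these into an exponential tail. Traces are taken over the Parseval
  frame \<open>H a\<^sub>i\<close>, so no orthonormal basis is needed.\<close>

section \<open>Moments of positive semidefinite operators\<close>

text \<open>The obstacle is that an operator does not commute with a rank-one projection. Along
  \<open>K + s v v^T\<close> the derivative of the trace of a power is a single moment of
  \<open>v\<close>, and it can be compared with the commuting path \<open>K + s\<close>. The
  comparison needs positive operators, so every sum is shifted by a multiple \<open>c\<close> of the
  identity that exceeds the number of trials by at least 2; in the tail estimate the shift appears
  on both sides as \<open>exp (\<theta> * c)\<close> and cancels.

  The constants fit together as follows. The tail exponent carries 3/16, there are
  \<open>8 * m\<close> trials, and a trial yields a singleton with probability at least 1/3, which
  gives the exponent \<open>\<epsilon>^2 m / (2 r)\<close>. The 3 in the sample size makes this at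
  least 3/2 of \<open>log^2 d + ln (2 / \<delta>)\<close>. The excess over 1 absorbs the dimension
  factor and leaves a part of \<delta> for a second bad event, that too many rows are stored: the
  sizes of the sets are random, so the costs have no sure bound.\<close>

lemma log_convex_supermult:
  fixes \<alpha> :: "nat \<Rightarrow> real"
  assumes nn: "\<And>p. 0 \<le> \<alpha> p" and lc: "\<And>p. (\<alpha> (Suc p))\<^sup>2 \<le> \<alpha> p * \<alpha> (Suc (Suc p))"
    and one: "\<alpha> 0 = 1"
  shows "\<alpha> i * \<alpha> j \<le> \<alpha> (i + j)"
proof -
  \<comment> \<open>Consecutive ratios of a log-convex sequence do not decrease. The product form
    also covers zero entries: a zero at \<open>i\<close> forces a zero at
    \<open>Suc i\<close>.\<close>
  have ratio: "\<alpha> (Suc p) * \<alpha> (p + q) \<le> \<alpha> p * \<alpha> (Suc (p + q))" for p q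
  proof (induction q)
    case (Suc q)
    let ?n = "p + q"
    show ?case
    proof (cases "\<alpha> (Suc ?n) = 0")
      case True
      then show ?thesis using nn by simp
    next
      case False
      then have pos: "\<alpha> (Suc ?n) > 0" using nn[of "Suc ?n"] by simp
      have "\<alpha> (Suc p) * \<alpha> (Suc ?n) * \<alpha> (Suc ?n) \<le> \<alpha> (Suc p) * (\<alpha> ?n * \<alpha> (Suc (Suc ?n)))"
        using mult_left_mono[OF lc nn] by (simp add: power2_eq_square mult.assoc)
      also have "\<dots> \<le> \<alpha> p * \<alpha> (Suc ?n) * \<alpha> (Suc (Suc ?n))"
        using mult_right_mono[OF Suc nn] by (simp add: mult.assoc)
      finally have "(\<alpha> (Suc p) * \<alpha> (Suc ?n)) * \<alpha> (Suc ?n) \<le> (\<alpha> p * \<alpha> (Suc (Suc ?n))) * \<alpha> (Suc ?n)"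
        by (simp add: ac_simps)
      then show ?thesis using pos by simp
    qed
  qed simp
  show ?thesis
  proof (induction i)
    case (Suc i)
    show ?case
    proof (cases "\<alpha> i = 0")
      case True
      then have "\<alpha> (Suc i) = 0" using lc[of i] by simp
      then show ?thesis using nn by simp
    next
      case False
      then have pos: "\<alpha> i > 0" using nn[of i] by simp
      have "\<alpha> (Suc i) * (\<alpha> i * \<alpha> j) \<le> \<alpha> (Suc i) * \<alpha> (i + j)" by (intro mult_left_mono Suc nn)
      also have "\<dots> \<le> \<alpha> i * \<alpha> (Suc (i + j))" by (rule ratio)
      finally have "\<alpha> i * (\<alpha> (Suc i) * \<alpha> j) \<le> \<alpha> i * \<alpha> (Suc (i + j))" by (simp add: ac_simps)
      then show ?thesis using pos by simp
    qed
  qed (simp add: one)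
qed

text \<open>The form may be degenerate, as the Gram form is when the rows do not span the space. Its
  nonnegativity is a consequence of \<open>parseval\<close>, not an axiom.\<close>

locale parseval_frame =
  fixes ip :: "'v::real_vector \<Rightarrow> 'v \<Rightarrow> real" and I :: "'i set" and f :: "'i \<Rightarrow> 'v"
  assumes finite_frame: "finite I"
    and ip_linear: "linear (ip x)"
    and ip_commute: "ip x y = ip y x"
    and parseval: "ip x y = (\<Sum>i\<in>I. ip (f i) x * ip (f i) y)"
begin

lemma ip_simps [simp]:
  "ip x (y + z) = ip x y + ip x z" "ip x (y - z) = ip x y - ip x z" "ip x (c *\<^sub>R y) = c * ip x y"
  "ip (y + z) x = ip y x + ip z x" "ip (y - z) x = ip y x - ip z x" "ip (c *\<^sub>R y) x = c * ip y x"
  "ip x 0 = 0" "ip 0 x = 0"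
  using linear_add[OF ip_linear] linear_diff[OF ip_linear] linear_scale[OF ip_linear] linear_0[OF ip_linear]
  by (auto simp: ip_commute[of _ x])

lemma ip_sum_right: "ip x (sum g A) = (\<Sum>a\<in>A. ip x (g a))"
  by (rule linear_sum[OF ip_linear])

lemma ip_nonneg: "0 \<le> ip x x"
  by (subst parseval) (auto intro: sum_nonneg)

definition self_adjoint :: "('v \<Rightarrow> 'v) \<Rightarrow> bool" where
  "self_adjoint K \<longleftrightarrow> linear K \<and> (\<forall>x y. ip (K x) y = ip x (K y))"

definition psd :: "('v \<Rightarrow> 'v) \<Rightarrow> bool" where
  "psd K \<longleftrightarrow> self_adjoint K \<and> (\<forall>x. 0 \<le> ip x (K x))"

definition frame_trace :: "('v \<Rightarrow> 'v) \<Rightarrow> real" where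
  "frame_trace P = (\<Sum>i\<in>I. ip (f i) (P (f i)))"

definition rank_one :: "'v \<Rightarrow> 'v \<Rightarrow> 'v" where
  "rank_one v x = ip v x *\<^sub>R v"

definition perturb :: "('v \<Rightarrow> 'v) \<Rightarrow> ('v \<Rightarrow> 'v) \<Rightarrow> real \<Rightarrow> 'v \<Rightarrow> 'v" where
  "perturb K D s x = K x + s *\<^sub>R D x"

lemma perturb_0 [simp]: "perturb K D 0 = K"
  by (auto simp: perturb_def)

lemma perturb_perturb: "perturb (perturb K D s) D t = perturb K D (s + t)"
  by (auto simp: perturb_def algebra_simps)

section \<open>Self-adjoint and positive semidefinite operators\<close>

lemma linear_funpow: "linear K \<Longrightarrow> linear ((K :: 'v \<Rightarrow> 'v) ^^ p)"
  by (induction p) (auto intro: linear_compose simp: linear_id linear_id[unfolded id_def])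

lemma linear_perturb: "linear K \<Longrightarrow> linear D \<Longrightarrow> linear (perturb K D s)"
  unfolding perturb_def by (intro linear_compose_add linear_compose_scale_right)

lemma linear_rank_one: "linear (rank_one v)"
  unfolding rank_one_def by (rule linearI) (auto simp: algebra_simps)

lemma self_adjoint_linear: "self_adjoint K \<Longrightarrow> linear K"
  by (simp add: self_adjoint_def)

lemma self_adjointD: "self_adjoint K \<Longrightarrow> ip (K x) y = ip x (K y)"
  by (simp add: self_adjoint_def)

lemma self_adjoint_id: "self_adjoint (\<lambda>x. x)"
  by (simp add: self_adjoint_def linear_id[unfolded id_def])

lemma self_adjoint_rank_one: "self_adjoint (rank_one v)"
  by (simp add: self_adjoint_def linear_rank_one) (simp add: rank_one_def ip_commute)

lemma self_adjoint_perturb: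
  "self_adjoint K \<Longrightarrow> self_adjoint D \<Longrightarrow> self_adjoint (perturb K D s)"
  by (simp add: self_adjoint_def linear_perturb) (simp add: perturb_def)

lemma self_adjoint_funpow: "self_adjoint K \<Longrightarrow> self_adjoint (K ^^ p)"
proof (induction p)
  case 0
  then show ?case using self_adjoint_id by (simp add: id_def)
next
  case (Suc p)
  then have K: "self_adjoint K" and Kp: "self_adjoint (K ^^ p)" by auto
  have "ip ((K ^^ Suc p) x) y = ip x ((K ^^ Suc p) y)" for x y
  proof -
    have "ip ((K ^^ Suc p) x) y = ip ((K ^^ p) x) (K y)" using self_adjointD[OF K] by simp
    also have "\<dots> = ip x ((K ^^ p) (K y))" by (rule self_adjointD[OF Kp])
    finally show ?thesis by (simp add: funpow_swap1)
  qed
  moreover have "linear (K ^^ Suc p)" by (rule linear_funpow[OF self_adjoint_linear[OF K]])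
  ultimately show ?case unfolding self_adjoint_def by blast
qed

lemma psd_self_adjoint: "psd K \<Longrightarrow> self_adjoint K"
  by (simp add: psd_def)

lemma psd_funpow:
  assumes "psd K"
  shows "psd (K ^^ p)"
proof -
  have sa: "self_adjoint K" "\<And>k. self_adjoint (K ^^ k)"
    using assms self_adjoint_funpow by (auto simp: psd_def)
  have "0 \<le> ip x ((K ^^ p) x)" for x
  proof -
    \<comment> \<open>Even powers give a square \<open>ip z z\<close> and odd powers a value
      \<open>ip z (K z)\<close>, both at \<open>z = (K ^^ k) x\<close>.\<close>
    obtain k where "p = k + k \<or> p = k + Suc k" by (metis add_Suc_right oddE evenE mult_2 Suc_eq_plus1)
    then have "(K ^^ p) x = (K ^^ k) ((K ^^ k) x) \<or> (K ^^ p) x = (K ^^ k) (K ((K ^^ k) x))"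
      unfolding funpow_add[of k] by (metis comp_apply funpow.simps(2) funpow_add)
    then have "ip x ((K ^^ p) x) = ip ((K ^^ k) x) ((K ^^ k) x)
        \<or> ip x ((K ^^ p) x) = ip ((K ^^ k) x) (K ((K ^^ k) x))"
      using self_adjointD[OF sa(2)[of k], of x] by auto
    then show ?thesis using assms ip_nonneg by (auto simp: psd_def)
  qed
  then show ?thesis using sa by (simp add: psd_def)
qed

lemma psd_cauchy_schwarz:
  assumes Q: "psd Q"
  shows "(ip x (Q y))\<^sup>2 \<le> ip x (Q x) * ip y (Q y)"
proof -
  let ?a = "ip x (Q x)" and ?b = "ip x (Q y)" and ?c = "ip y (Q y)"
  have lin: "linear Q" and nn: "\<And>z. 0 \<le> ip z (Q z)" using Q by (auto simp: psd_def self_adjoint_def)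
  have sym: "ip y (Q x) = ?b"
    using self_adjointD[OF psd_self_adjoint[OF Q], of y x] by (simp add: ip_commute)
  have poly: "0 \<le> ?a + 2 * t * ?b + t\<^sup>2 * ?c" for t
    using nn[of "x + t *\<^sub>R y"] sym
    by (simp add: linear_add[OF lin] linear_scale[OF lin] power2_eq_square algebra_simps)
  show ?thesis
  proof (cases "?c = 0")
    case True
    have "?b = 0"
    proof (rule ccontr)
      assume b: "?b \<noteq> 0"
      \<comment> \<open>Without its quadratic coefficient the polynomial is affine; at this argument
        it equals -1.\<close>
      show False using poly[of "- (?a + 1) / (2 * ?b)"] nn[of x] True b by (simp add: field_simps)
    qed
    then show ?thesis using True by simp
  next
    case False
    then have c: "?c > 0" using nn[of y] by simp
    have "0 \<le> ?a - ?b\<^sup>2 / ?c" using poly[of "- ?b / ?c"] c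
      by (simp add: field_simps power2_eq_square)
    then show ?thesis using c by (simp add: field_simps)
  qed
qed

lemma psd_id: "psd (\<lambda>x. x)"
  by (simp add: psd_def self_adjoint_id ip_nonneg)

lemma cauchy_schwarz: "(ip x y)\<^sup>2 \<le> ip x x * ip y y"
  using psd_cauchy_schwarz[OF psd_id] .

text \<open>Cauchy-Schwarz for the form of \<open>K ^^ p\<close>, applied to \<open>v\<close> and
  \<open>K v\<close>, is the log-convexity of the moments of \<open>v\<close>.\<close>

lemma moment_supermult:
  assumes K: "psd K" and v: "ip v v = 1"
  shows "ip v ((K ^^ i) v) * ip v ((K ^^ j) v) \<le> ip v ((K ^^ (i + j)) v)"
proof (rule log_convex_supermult)
  fix p
  show "0 \<le> ip v ((K ^^ p) v)" using psd_funpow[OF K] by (simp add: psd_def)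
  have "ip (K v) ((K ^^ p) (K v)) = ip v ((K ^^ Suc (Suc p)) v)"
    using self_adjointD[OF psd_self_adjoint[OF K]] by (simp add: funpow_swap1)
  then show "(ip v ((K ^^ Suc p) v))\<^sup>2 \<le> ip v ((K ^^ p) v) * ip v ((K ^^ Suc (Suc p)) v)"
    using psd_cauchy_schwarz[OF psd_funpow[OF K], of v p "K v"] by (simp add: funpow_swap1)
qed (simp add: v)

lemma moment_power:
  assumes K: "psd K" and v: "ip v v = 1"
  shows "(ip v (K v)) ^ p \<le> ip v ((K ^^ p) v)"
proof (induction p)
  case (Suc p)
  have "0 \<le> ip v (K v)" using K by (simp add: psd_def)
  then have "ip v (K v) ^ Suc p \<le> ip v (K v) * ip v ((K ^^ p) v)" using Suc by (simp add: mult_left_mono)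
  also have "\<dots> \<le> ip v ((K ^^ Suc p) v)" using moment_supermult[OF K v, of 1 p] by simp
  finally show ?case .
qed (simp add: v)

text \<open>Stands in for the bound of the largest eigenvalue by the trace. Expand \<open>?q\<close>
  over the frame and apply Cauchy-Schwarz first to the sum and then, in the form of
  \<open>Q\<close>, to each \<open>ip (f i) (Q w)\<close>: this gives
  \<open>?q^2 \<le> frame_trace Q * ?q\<close>.\<close>

lemma psd_le_trace:
  assumes Q: "psd Q" and w: "ip w w = 1"
  shows "ip w (Q w) \<le> frame_trace Q"
proof -
  let ?q = "ip w (Q w)"
  have nn: "\<And>z. 0 \<le> ip z (Q z)" using Q by (auto simp: psd_def)
  have "?q\<^sup>2 = (\<Sum>i\<in>I. ip (f i) w * ip (f i) (Q w))\<^sup>2" by (subst parseval) simp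
  also have "\<dots> \<le> (\<Sum>i\<in>I. (ip (f i) w)\<^sup>2) * (\<Sum>i\<in>I. (ip (f i) (Q w))\<^sup>2)"
    by (rule Cauchy_Schwarz_ineq_sum)
  also have "(\<Sum>i\<in>I. (ip (f i) w)\<^sup>2) = 1" using parseval[of w w] w by (simp add: power2_eq_square)
  also have "1 * (\<Sum>i\<in>I. (ip (f i) (Q w))\<^sup>2) \<le> (\<Sum>i\<in>I. ip (f i) (Q (f i)) * ?q)"
    using psd_cauchy_schwarz[OF Q] by (auto intro: sum_mono)
  also have "\<dots> = frame_trace Q * ?q" by (simp add: frame_trace_def sum_distrib_right)
  finally have *: "?q * ?q \<le> frame_trace Q * ?q" by (simp add: power2_eq_square)
  have "0 \<le> frame_trace Q" using nn by (simp add: frame_trace_def sum_nonneg)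
  then show ?thesis using * nn[of w] by (cases "?q = 0") (auto simp: less_le)
qed

text \<open>Telescoping for operators that do not commute: unperturbed factors stand to the left of
  \<open>D\<close>, perturbed ones to its right.\<close>

lemma funpow_perturb:
  assumes "linear K"
  shows "(perturb K D s ^^ q) x
    = (K ^^ q) x + (\<Sum>j<q. s *\<^sub>R (K ^^ j) (D ((perturb K D s ^^ (q - Suc j)) x)))"
proof (induction q)
  case (Suc q)
  let ?U = "perturb K D s"
  have "(?U ^^ Suc q) x = K ((?U ^^ q) x) + s *\<^sub>R D ((?U ^^ q) x)" by (simp add: perturb_def)
  also have "K ((?U ^^ q) x) = (K ^^ Suc q) x
      + (\<Sum>j<q. s *\<^sub>R (K ^^ Suc j) (D ((?U ^^ (q - Suc j)) x)))"
    by (subst Suc) (simp add: linear_add[OF assms] linear_sum[OF assms] linear_scale[OF assms])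
  finally show ?case by (simp add: sum.lessThan_Suc_shift algebra_simps del: sum.lessThan_Suc)
qed simp

text \<open>With \<open>U = L + s v v\<^sup>T\<close> and \<open>S = L + s\<close>, telescoping expresses the left side by the products
  \<open>\<langle>v, L\<^sup>j v\<rangle> \<langle>v, U\<^sup>k v\<rangle>\<close> and the right side by the moments \<open>\<langle>v, L\<^sup>j S\<^sup>k v\<rangle>\<close>, where \<open>j + k = q - 1\<close>.\<close>

lemma moment_rank_one_le_shift:
  assumes L: "psd L" and v: "ip v v = 1" and s: "0 \<le> s"
  shows "ip v ((perturb L (rank_one v) s ^^ q) v) \<le> ip v ((perturb L (\<lambda>x. x) s ^^ q) v)"
proof -
  let ?S = "perturb L (\<lambda>x. x) s" and ?U = "perturb L (rank_one v) s"
  have lin: "linear L" using L by (simp add: psd_def self_adjoint_def)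
  note linp = linear_funpow[OF lin]
  have nn: "0 \<le> ip v ((L ^^ j) v)" for j using psd_funpow[OF L] by (simp add: psd_def)
  define g where "g = (\<lambda>i k. ip v ((L ^^ i) ((?S ^^ k) v)))"
  have rec: "g i (Suc k) = g (Suc i) k + s * g i k" for i k
  proof -
    have "(L ^^ i) ((?S ^^ Suc k) v) = (L ^^ i) (L ((?S ^^ k) v)) + s *\<^sub>R (L ^^ i) ((?S ^^ k) v)"
      by (simp add: perturb_def linear_add[OF linp] linear_scale[OF linp])
    also have "(L ^^ i) (L ((?S ^^ k) v)) = (L ^^ Suc i) ((?S ^^ k) v)" by (simp add: funpow_swap1)
    finally show ?thesis by (simp add: g_def)
  qed
  \<comment> \<open>Supermultiplicativity for mixed moments: expanding one factor \<open>?S\<close>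
    at a time reduces it to pure moments of \<open>L\<close>.\<close>
  have assoc: "ip v ((L ^^ j) v) * g i k \<le> g (i + j) k" for i j k
  proof (induction k arbitrary: i)
    case 0
    show ?case using moment_supermult[OF L v, of j i] by (simp add: g_def add.commute)
  next
    case (Suc k)
    have "ip v ((L ^^ j) v) * g i (Suc k)
        = ip v ((L ^^ j) v) * g (Suc i) k + s * (ip v ((L ^^ j) v) * g i k)"
      by (simp add: rec algebra_simps)
    also have "\<dots> \<le> g (Suc i + j) k + s * g (i + j) k" using Suc[of "Suc i"] Suc[of i] s by (intro add_mono mult_left_mono) auto
    finally show ?case by (simp add: rec)
  qed
  show ?thesis
  proof (induction q rule: less_induct)
    case (less q)
    have "ip v ((?U ^^ q) v) = ip v ((L ^^ q) v)
        + (\<Sum>j<q. s * (ip v ((L ^^ j) v) * ip v ((?U ^^ (q - Suc j)) v)))"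
      by (subst funpow_perturb[OF lin])
        (simp add: ip_sum_right rank_one_def linear_scale[OF linp] ac_simps)
    \<comment> \<open>The moments of \<open>?U\<close> in the sum have order below \<open>q\<close>,
      so the induction hypothesis replaces them by moments of \<open>?S\<close>; then
      \<open>assoc\<close> absorbs the factor in \<open>L\<close>.\<close>
    also have "\<dots> \<le> ip v ((L ^^ q) v) + (\<Sum>j<q. s * g j (q - Suc j))"
    proof (intro add_left_mono sum_mono mult_left_mono s)
      fix j assume "j \<in> {..<q}"
      then have "ip v ((L ^^ j) v) * ip v ((?U ^^ (q - Suc j)) v) \<le> ip v ((L ^^ j) v) * g 0 (q - Suc j)"
        using less[of "q - Suc j"] nn by (intro mult_left_mono) (auto simp: g_def)
      also have "\<dots> \<le> g j (q - Suc j)" using assoc[of j 0] by simp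
      finally show "ip v ((L ^^ j) v) * ip v ((?U ^^ (q - Suc j)) v) \<le> g j (q - Suc j)" .
    qed
    also have "\<dots> = ip v ((?S ^^ q) v)"
      using arg_cong[OF funpow_perturb[OF lin, where D = "\<lambda>x. x" and s = s and q = q and x = v], of "ip v"]
      by (simp add: ip_sum_right g_def)
    finally show ?case .
  qed
qed

section \<open>Derivatives along a perturbation\<close>

lemma isCont_moment_perturb:
  assumes "self_adjoint K" "self_adjoint D"
  shows "isCont (\<lambda>h. ip w ((perturb K D h ^^ k) x)) t"
proof (induction k arbitrary: w)
  case (Suc k)
  have eq: "ip w ((perturb K D h ^^ Suc k) x)
      = ip (K w) ((perturb K D h ^^ k) x) + h * ip (D w) ((perturb K D h ^^ k) x)" for h
    using self_adjointD[OF assms(1)] self_adjointD[OF assms(2)] by (simp add: perturb_def)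
  show ?case unfolding eq by (intro continuous_intros Suc)
qed simp

lemma DERIV_moment_shift:
  assumes K: "self_adjoint K"
  shows "((\<lambda>s. ip v ((perturb K (\<lambda>x. x) s ^^ p) v)) has_real_derivative
    p * ip v ((perturb K (\<lambda>x. x) s ^^ (p - 1)) v)) (at s)"
proof -
  define B where "B = perturb K (\<lambda>x. x) s"
  have B: "self_adjoint B" unfolding B_def by (intro self_adjoint_perturb K self_adjoint_id)
  \<comment> \<open>By telescoping this is exactly the difference quotient for
    \<open>h \<noteq> 0\<close>. It is continuous, so the derivative is its value at 0, where all
    \<open>p\<close> terms coincide.\<close>
  define \<phi> where "\<phi> = (\<lambda>h. \<Sum>j<p. ip ((B ^^ j) v) ((perturb B (\<lambda>x. x) h ^^ (p - Suc j)) v))"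
  have "isCont \<phi> 0"
    unfolding \<phi>_def by (intro continuous_intros isCont_moment_perturb B self_adjoint_id)
  then have "\<phi> \<midarrow>0\<rightarrow> \<phi> 0" by (simp add: isCont_def)
  moreover have "ip ((B ^^ j) v) ((B ^^ (p - Suc j)) v) = ip v ((B ^^ (p - 1)) v)" if "j < p" for j
  proof -
    have "p - 1 = j + (p - Suc j)" using that by simp
    then show ?thesis
      using self_adjointD[OF self_adjoint_funpow[OF B]] by (metis comp_apply funpow_add)
  qed
  then have "\<phi> 0 = p * ip v ((B ^^ (p - 1)) v)" by (simp add: \<phi>_def)
  moreover have "(ip v ((perturb K (\<lambda>x. x) (s + h) ^^ p) v) - ip v ((perturb K (\<lambda>x. x) s ^^ p) v)) / h
      = \<phi> h" if "h \<noteq> 0" for h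
  proof -
    have "ip v ((perturb B (\<lambda>x. x) h ^^ p) v) = ip v ((B ^^ p) v) + h * \<phi> h"
      by (subst funpow_perturb[OF self_adjoint_linear[OF B]])
        (simp add: ip_sum_right \<phi>_def sum_distrib_left self_adjointD[OF self_adjoint_funpow[OF B]])
    then show ?thesis using that by (simp add: B_def perturb_perturb)
  qed
  ultimately show ?thesis unfolding DERIV_def
    by (simp add: B_def cong: LIM_cong)
qed

text \<open>Parseval replaces the cyclicity of the trace: after telescoping, the frame sum of each
  term collapses to one inner product of \<open>(B ^^ j) v\<close> with a perturbed power applied to
  \<open>v\<close>.\<close>

lemma DERIV_trace_rank_one:
  assumes K: "self_adjoint K"
  shows "((\<lambda>s. frame_trace (perturb K (rank_one v) s ^^ p)) has_real_derivative
    p * ip v ((perturb K (rank_one v) s ^^ (p - 1)) v)) (at s)"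
proof -
  define B where "B = perturb K (rank_one v) s"
  have B: "self_adjoint B" unfolding B_def by (intro self_adjoint_perturb K self_adjoint_rank_one)
  define \<phi> where "\<phi> = (\<lambda>h. \<Sum>j<p. ip ((B ^^ j) v) ((perturb B (rank_one v) h ^^ (p - Suc j)) v))"
  have "isCont \<phi> 0"
    unfolding \<phi>_def by (intro continuous_intros isCont_moment_perturb B self_adjoint_rank_one)
  then have "\<phi> \<midarrow>0\<rightarrow> \<phi> 0" by (simp add: isCont_def)
  moreover have "ip ((B ^^ j) v) ((B ^^ (p - Suc j)) v) = ip v ((B ^^ (p - 1)) v)" if "j < p" for j
  proof -
    have "p - 1 = j + (p - Suc j)" using that by simp
    then show ?thesis
      using self_adjointD[OF self_adjoint_funpow[OF B]] by (metis comp_apply funpow_add)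
  qed
  then have "\<phi> 0 = p * ip v ((B ^^ (p - 1)) v)" by (simp add: \<phi>_def)
  moreover have "(frame_trace (perturb K (rank_one v) (s + h) ^^ p) - frame_trace (perturb K (rank_one v) s ^^ p)) / h
      = \<phi> h" if "h \<noteq> 0" for h
  proof -
    let ?U = "perturb B (rank_one v) h"
    have U: "self_adjoint ?U" by (intro self_adjoint_perturb B self_adjoint_rank_one)
    have "frame_trace (?U ^^ p) = frame_trace (B ^^ p)
        + (\<Sum>i\<in>I. \<Sum>j<p. h * (ip (f i) ((B ^^ j) v) * ip (f i) ((?U ^^ (p - Suc j)) v)))"
      unfolding frame_trace_def sum.distrib[symmetric]
      by (intro sum.cong refl, subst funpow_perturb[OF self_adjoint_linear[OF B]])
        (simp add: ip_sum_right rank_one_def linear_scale[OF linear_funpow[OF self_adjoint_linear[OF B]]]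
          self_adjointD[OF self_adjoint_funpow[OF U], symmetric] ip_commute[of _ "f _"] ac_simps)
    also have "(\<Sum>i\<in>I. \<Sum>j<p. h * (ip (f i) ((B ^^ j) v) * ip (f i) ((?U ^^ (p - Suc j)) v))) = h * \<phi> h"
      by (subst sum.swap) (simp add: \<phi>_def sum_distrib_left parseval[symmetric] flip: sum_distrib_left)
    finally show ?thesis using that by (simp add: B_def perturb_perturb)
  qed
  ultimately show ?thesis unfolding DERIV_def
    by (simp add: B_def cong: LIM_cong)
qed

text \<open>The difference of the two sides is monotone in the size \<open>s\<close> of the perturbation. For \<open>s < 0\<close> this is
  the moment comparison for \<open>K + s v v\<^sup>T + s\<close>, which is why \<open>K \<ge> 2\<close> is needed.\<close>

lemma trace_perturb_rank_one_le:
  assumes K: "self_adjoint K" "\<And>x. 2 * ip x x \<le> ip x (K x)"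
    and v: "ip v v = 1" and \<sigma>: "\<sigma> = 1 \<or> \<sigma> = - 1"
  shows "frame_trace (perturb K (rank_one v) \<sigma> ^^ p)
    \<le> frame_trace (K ^^ p) + (ip v ((perturb K (\<lambda>x. x) \<sigma> ^^ p) v) - ip v ((K ^^ p) v))"
proof -
  define F where "F = (\<lambda>s. frame_trace (perturb K (rank_one v) s ^^ p) - ip v ((perturb K (\<lambda>x. x) s ^^ p) v))"
  let ?D = "\<lambda>s. p * (ip v ((perturb K (rank_one v) s ^^ (p - 1)) v) - ip v ((perturb K (\<lambda>x. x) s ^^ (p - 1)) v))"
  have F: "(F has_real_derivative ?D s) (at s)" for s
    unfolding F_def right_diff_distrib
    by (intro DERIV_diff DERIV_trace_rank_one DERIV_moment_shift K(1))
  have "F \<sigma> \<le> F 0"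
    using \<sigma>
  proof
    assume "\<sigma> = 1"
    have "psd K" unfolding psd_def using K ip_nonneg by (metis order_trans mult_nonneg_nonneg zero_le_numeral)
    then have D: "?D s \<le> 0" if "0 \<le> s" for s
      using moment_rank_one_le_shift[OF _ v that] by (simp add: mult_nonneg_nonpos)
    have "F 1 \<le> F 0"
    proof (rule DERIV_nonpos_imp_nonincreasing[of 0 1 F])
      fix s :: real
      assume "0 \<le> s"
      then show "\<exists>y. (F has_real_derivative y) (at s) \<and> y \<le> 0" using F D by blast
    qed simp
    then show ?thesis using \<open>\<sigma> = 1\<close> by simp
  next
    assume "\<sigma> = - 1"
    have D: "0 \<le> ?D s" if s: "- 1 \<le> s" "s \<le> 0" for s
    proof -
      \<comment> \<open>Seen from \<open>L\<close> the roles are exchanged: adding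
        \<open>- s\<close> times the projection gives the shifted \<open>K\<close>, and adding
        \<open>- s\<close> times the identity gives the rank-one perturbation. Hence the derivative
        has the opposite sign.\<close>
      define L where "L = perturb (perturb K (rank_one v) s) (\<lambda>x. x) s"
      have "0 \<le> ip x (L x)" for x
      proof -
        have "(ip v x)\<^sup>2 \<le> ip x x" using cauchy_schwarz[of v x] v by simp
        then have "(- s) * (ip v x)\<^sup>2 + (- s) * ip x x \<le> 1 * ip x x + 1 * ip x x"
          using s ip_nonneg[of x] by (intro add_mono mult_mono) auto
        then show ?thesis using K(2)[of x]
          by (simp add: L_def perturb_def rank_one_def power2_eq_square ip_commute[of x v] algebra_simps)
      qed
      then have "psd L"
        unfolding psd_def L_def by (simp add: self_adjoint_perturb self_adjoint_rank_one self_adjoint_id K)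
      moreover have "perturb L (rank_one v) (- s) = perturb K (\<lambda>x. x) s"
        and "perturb L (\<lambda>x. x) (- s) = perturb K (rank_one v) s"
        by (auto simp: L_def perturb_def)
      ultimately have "ip v ((perturb K (\<lambda>x. x) s ^^ (p - 1)) v) \<le> ip v ((perturb K (rank_one v) s ^^ (p - 1)) v)"
        using moment_rank_one_le_shift[of L v "- s" "p - 1"] s v by simp
      then show ?thesis by simp
    qed
    have "F (- 1) \<le> F 0"
    proof (rule DERIV_nonneg_imp_nondecreasing[of "- 1" 0 F])
      fix s :: real
      assume "- 1 \<le> s" "s \<le> 0"
      then show "\<exists>y. (F has_real_derivative y) (at s) \<and> 0 \<le> y" using F D by blast
    qed simp
    then show ?thesis using \<open>\<sigma> = - 1\<close> by simp
  qed
  then show ?thesis by (simp add: F_def)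
qed

end

section \<open>Sums of independent random rank-one operators\<close>

lemma sum_PiE_insert:
  assumes "y \<notin> Y"
  shows "(\<Sum>g\<in>PiE (insert y Y) F. h g) = (\<Sum>\<omega>\<in>F y. \<Sum>g\<in>PiE Y F. h (g(y := \<omega>)))"
proof -
  have "(\<Sum>g\<in>PiE (insert y Y) F. h g) = (\<Sum>(\<omega>, g)\<in>F y \<times> PiE Y F. h (g(y := \<omega>)))"
    unfolding PiE_insert_eq by (subst sum.reindex[OF inj_combinator[OF assms]]) (auto intro: sum.cong)
  then show ?thesis by (simp add: sum.cartesian_product)
qed

text \<open>One trial has outcomes \<open>\<Omega>\<close> with probabilities \<open>\<nu>\<close>. It hits with probability \<open>q\<close>, and then yields
  the unit vector \<open>v\<close>, whose projection has mean \<open>1 / r\<close>.\<close>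

locale frame_sampling = parseval_frame ip I f
  for ip :: "'v::real_vector \<Rightarrow> 'v \<Rightarrow> real" and I :: "'i set" and f :: "'i \<Rightarrow> 'v" +
  fixes \<Omega> :: "'o set" and \<nu> :: "'o \<Rightarrow> real" and hit :: "'o \<Rightarrow> bool" and v :: "'o \<Rightarrow> 'v" and r q :: real
  assumes finite_outcomes: "finite \<Omega>"
    and prob_nonneg: "\<omega> \<in> \<Omega> \<Longrightarrow> 0 \<le> \<nu> \<omega>"
    and prob_sum: "(\<Sum>\<omega>\<in>\<Omega>. \<nu> \<omega>) = 1"
    and unit: "\<omega> \<in> \<Omega> \<Longrightarrow> hit \<omega> \<Longrightarrow> ip (v \<omega>) (v \<omega>) = 1"
    and trace_id: "(\<Sum>i\<in>I. ip (f i) (f i)) = r"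
    and r_ge_1: "1 \<le> r"
    and isotropic: "self_adjoint Q \<Longrightarrow>
      (\<Sum>\<omega>\<in>{\<omega>\<in>\<Omega>. hit \<omega>}. \<nu> \<omega> * ip (v \<omega>) (Q (v \<omega>))) = q / r * frame_trace Q"
begin

text \<open>Isotropy tested on the identity, whose trace is \<open>r\<close>.\<close>

lemma hit_prob: "(\<Sum>\<omega>\<in>{\<omega>\<in>\<Omega>. hit \<omega>}. \<nu> \<omega>) = q"
proof -
  have "(\<Sum>\<omega>\<in>{\<omega>\<in>\<Omega>. hit \<omega>}. \<nu> \<omega>) = (\<Sum>\<omega>\<in>{\<omega>\<in>\<Omega>. hit \<omega>}. \<nu> \<omega> * ip (v \<omega>) (v \<omega>))"
    using unit by (intro sum.cong) auto
  also have "\<dots> = q" using isotropic[OF self_adjoint_id] trace_id r_ge_1 by (simp add: frame_trace_def)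
  finally show ?thesis .
qed

lemma q_bounds: "0 \<le> q" "q \<le> 1"
proof -
  show "0 \<le> q" unfolding hit_prob[symmetric] by (intro sum_nonneg) (simp add: prob_nonneg)
  have "(\<Sum>\<omega>\<in>{\<omega>\<in>\<Omega>. hit \<omega>}. \<nu> \<omega>) \<le> (\<Sum>\<omega>\<in>\<Omega>. \<nu> \<omega>)"
    by (intro sum_mono2 finite_outcomes) (auto simp: prob_nonneg)
  then show "q \<le> 1" by (simp add: hit_prob prob_sum)
qed

lemma nonhit_prob: "(\<Sum>\<omega>\<in>{\<omega>\<in>\<Omega>. \<not> hit \<omega>}. \<nu> \<omega>) = 1 - q"
proof -
  have "(\<Sum>\<omega>\<in>{\<omega>\<in>\<Omega>. hit \<omega>} \<union> {\<omega>\<in>\<Omega>. \<not> hit \<omega>}. \<nu> \<omega>) = q + (\<Sum>\<omega>\<in>{\<omega>\<in>\<Omega>. \<not> hit \<omega>}. \<nu> \<omega>)"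
    by (subst sum.union_disjoint) (use finite_outcomes hit_prob in auto)
  moreover have "{\<omega>\<in>\<Omega>. hit \<omega>} \<union> {\<omega>\<in>\<Omega>. \<not> hit \<omega>} = \<Omega>" by auto
  ultimately show ?thesis using prob_sum by simp
qed

definition hits :: "'y set \<Rightarrow> ('y \<Rightarrow> 'o) \<Rightarrow> 'y set" where
  "hits Y g = {y\<in>Y. hit (g y)}"

definition sample_op :: "'y set \<Rightarrow> ('y \<Rightarrow> 'o) \<Rightarrow> 'v \<Rightarrow> 'v" where
  "sample_op Y g x = (\<Sum>y\<in>hits Y g. rank_one (v (g y)) x)"

definition weight :: "'y set \<Rightarrow> ('y \<Rightarrow> 'o) \<Rightarrow> real" where
  "weight Y g = (\<Prod>y\<in>Y. \<nu> (g y))"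

text \<open>A large \<open>c\<close> makes this operator positive for both signs \<sigma>, so one
  argument serves both tails.\<close>

definition shifted :: "real \<Rightarrow> real \<Rightarrow> 'y set \<Rightarrow> ('y \<Rightarrow> 'o) \<Rightarrow> 'v \<Rightarrow> 'v" where
  "shifted c \<sigma> Y g = (\<lambda>x. c *\<^sub>R x + \<sigma> *\<^sub>R sample_op Y g x)"

lemma finite_hits: "finite Y \<Longrightarrow> finite (hits Y g)"
  by (simp add: hits_def)

lemma self_adjoint_shifted: "self_adjoint (shifted c \<sigma> Y g)"
  unfolding self_adjoint_def shifted_def sample_op_def
proof (intro conjI allI)
  show "linear (\<lambda>x. c *\<^sub>R x + \<sigma> *\<^sub>R (\<Sum>y\<in>hits Y g. rank_one (v (g y)) x))"
    by (intro linear_compose_add linear_compose_scale_right linear_compose_sum ballI linear_rank_one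
        linear_id[unfolded id_def])
next
  fix x y
  show "ip (c *\<^sub>R x + \<sigma> *\<^sub>R (\<Sum>z\<in>hits Y g. rank_one (v (g z)) x)) y =
      ip x (c *\<^sub>R y + \<sigma> *\<^sub>R (\<Sum>z\<in>hits Y g. rank_one (v (g z)) y))"
    by (subst ip_commute)
      (simp add: ip_sum_right rank_one_def ip_commute[of x "v _"] ip_commute[of x y] ip_commute[of y "v _"]
        mult.commute)
qed

lemma sample_op_form: "ip x (sample_op Y g x) = (\<Sum>y\<in>hits Y g. (ip (v (g y)) x)\<^sup>2)"
  by (simp add: sample_op_def ip_sum_right rank_one_def ip_commute[of x] power2_eq_square)

lemma sample_op_le:
  assumes "finite Y" "g \<in> PiE Y (\<lambda>_. \<Omega>)"
  shows "ip x (sample_op Y g x) \<le> card (hits Y g) * ip x x"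
proof -
  have "(\<Sum>y\<in>hits Y g. (ip (v (g y)) x)\<^sup>2) \<le> (\<Sum>y\<in>hits Y g. ip x x)"
  proof (rule sum_mono)
    fix y assume "y \<in> hits Y g"
    then have "ip (v (g y)) (v (g y)) = 1" using assms unit by (auto simp: hits_def PiE_iff)
    then show "(ip (v (g y)) x)\<^sup>2 \<le> ip x x" using cauchy_schwarz[of "v (g y)" x] by simp
  qed
  then show ?thesis by (simp add: sample_op_form)
qed

text \<open>The sum of projections lies between 0 and the number of hits, hence below
  \<open>card Y\<close>; subtracting it costs at most that much of \<open>c\<close>.\<close>

lemma shifted_ge:
  assumes Y: "finite Y" "g \<in> PiE Y (\<lambda>_. \<Omega>)" and \<sigma>: "\<sigma> = 1 \<or> \<sigma> = - 1" and c: "real (card Y) + b \<le> c"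
  shows "b * ip x x \<le> ip x (shifted c \<sigma> Y g x)"
proof -
  have "card (hits Y g) \<le> card Y" unfolding hits_def by (intro card_mono Y) auto
  then have "ip x (sample_op Y g x) \<le> card Y * ip x x"
    using sample_op_le[OF Y, of x] ip_nonneg[of x] by (smt (verit) mult_right_mono of_nat_mono)
  moreover have "0 \<le> ip x (sample_op Y g x)" by (simp add: sample_op_form sum_nonneg)
  moreover have "(real (card Y) + b) * ip x x \<le> c * ip x x" using c ip_nonneg by (intro mult_right_mono)
  moreover have "0 \<le> card Y * ip x x" using ip_nonneg[of x] by simp
  ultimately show ?thesis using \<sigma> by (auto simp: shifted_def algebra_simps)
qed

lemma weight_nonneg: "g \<in> PiE Y (\<lambda>_. \<Omega>) \<Longrightarrow> 0 \<le> weight Y g"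
  unfolding weight_def by (intro prod_nonneg) (auto intro: prob_nonneg)

text \<open>Coefficient with which a trial leaves the base \<open>c\<close> unchanged: no hit, or a
  hit, damped by \<open>exp (- \<kappa>)\<close>, without the share \<open>1 / r\<close> that moves
  the base.\<close>

definition keep :: "real \<Rightarrow> real" where
  "keep \<kappa> = 1 - q + q * exp (- \<kappa>) * (1 - 1 / r)"

definition move :: "real \<Rightarrow> real" where
  "move \<kappa> = q * exp (- \<kappa>) / r"

lemma keep_nonneg: "0 \<le> keep \<kappa>"
  unfolding keep_def using q_bounds r_ge_1 by (intro add_nonneg_nonneg mult_nonneg_nonneg) auto

lemma move_nonneg: "0 \<le> move \<kappa>"
  unfolding move_def using q_bounds r_ge_1 by simp

text \<open>This is \<open>r\<close> times the expectation of \<open>(c + \<sigma> B)\<^sup>p e\<^bsup>-\<kappa> N\<^esup>\<close> over \<open>k\<close> trials, where \<open>N\<close> counts the hits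
  and \<open>B\<close> those hits that are kept by an independent coin of bias \<open>1 / r\<close>.\<close>

fun moment_bound :: "real \<Rightarrow> real \<Rightarrow> nat \<Rightarrow> real \<Rightarrow> nat \<Rightarrow> real" where
  "moment_bound \<kappa> \<sigma> 0 c p = r * c ^ p"
| "moment_bound \<kappa> \<sigma> (Suc k) c p =
    keep \<kappa> * moment_bound \<kappa> \<sigma> k c p + move \<kappa> * moment_bound \<kappa> \<sigma> k (c + \<sigma>) p"

text \<open>Raising the base by \<sigma> multiplies the exponential series by
  \<open>exp (\<theta> * \<sigma>)\<close>, so the recursion contributes the same factor for every
  trial.\<close>

lemma moment_bound_sums:
  "(\<lambda>p. \<theta> ^ p / fact p * moment_bound \<kappa> \<sigma> k c p) sums
    (r * exp (\<theta> * c) * (keep \<kappa> + move \<kappa> * exp (\<theta> * \<sigma>)) ^ k)"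
proof (induction k arbitrary: c)
  case 0
  have "(\<lambda>p. r * ((\<theta> * c) ^ p /\<^sub>R fact p)) sums (r * exp (\<theta> * c))"
    by (intro sums_mult exp_converges)
  then show ?case by (simp add: field_simps power_mult_distrib)
next
  case (Suc k)
  let ?\<rho> = "keep \<kappa> + move \<kappa> * exp (\<theta> * \<sigma>)"
  have "(\<lambda>p. keep \<kappa> * (\<theta> ^ p / fact p * moment_bound \<kappa> \<sigma> k c p)
       + move \<kappa> * (\<theta> ^ p / fact p * moment_bound \<kappa> \<sigma> k (c + \<sigma>) p)) sums
     (keep \<kappa> * (r * exp (\<theta> * c) * ?\<rho> ^ k) + move \<kappa> * (r * exp (\<theta> * (c + \<sigma>)) * ?\<rho> ^ k))"
    by (intro sums_add sums_mult Suc)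
  also have "keep \<kappa> * (r * exp (\<theta> * c) * ?\<rho> ^ k) + move \<kappa> * (r * exp (\<theta> * (c + \<sigma>)) * ?\<rho> ^ k)
      = r * exp (\<theta> * c) * ?\<rho> ^ Suc k"
    by (simp add: exp_add algebra_simps)
  finally show ?case by (simp add: algebra_simps)
qed

text \<open>Isotropy turns the two moments of the random vector in the rank-one trace bound into
  traces over \<open>r\<close>; collecting coefficients yields \<open>keep\<close> and
  \<open>move\<close>. The margin 2 in \<open>c\<close> is what that bound demands.\<close>

lemma one_trial:
  assumes Y: "finite Y" "g \<in> PiE Y (\<lambda>_. \<Omega>)" and y: "y \<notin> Y"
    and \<sigma>: "\<sigma> = 1 \<or> \<sigma> = - 1" and c: "real (card Y) + 2 \<le> c"
  shows "(\<Sum>\<omega>\<in>\<Omega>. \<nu> \<omega> * exp (- \<kappa> * real (card (hits (insert y Y) (g(y := \<omega>)))))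
        * frame_trace (shifted c \<sigma> (insert y Y) (g(y := \<omega>)) ^^ p))
    \<le> exp (- \<kappa> * real (card (hits Y g))) * (keep \<kappa> * frame_trace (shifted c \<sigma> Y g ^^ p)
        + move \<kappa> * frame_trace (shifted (c + \<sigma>) \<sigma> Y g ^^ p))"
proof -
  let ?K = "shifted c \<sigma> Y g" and ?S = "shifted (c + \<sigma>) \<sigma> Y g" and ?e = "exp (- \<kappa> * real (card (hits Y g)))"
  have hits: "hits (insert y Y) (g(y := \<omega>)) = (if hit \<omega> then insert y (hits Y g) else hits Y g)" for \<omega>
    using y by (auto simp: hits_def)
  have ynot: "y \<notin> hits Y g" using y by (simp add: hits_def)
  have op: "shifted c \<sigma> (insert y Y) (g(y := \<omega>)) = (if hit \<omega> then perturb ?K (rank_one (v \<omega>)) \<sigma> else ?K)" for \<omega>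
  proof -
    have "(\<Sum>z\<in>hits Y g. rank_one (v ((g(y := \<omega>)) z)) x) = (\<Sum>z\<in>hits Y g. rank_one (v (g z)) x)" for x
      using ynot by (intro sum.cong) auto
    then show ?thesis
      using ynot finite_hits[OF Y(1), of g]
      by (auto simp: shifted_def sample_op_def hits perturb_def algebra_simps fun_eq_iff)
  qed
  have S: "perturb ?K (\<lambda>x. x) \<sigma> = ?S" by (auto simp: perturb_def shifted_def algebra_simps)
  let ?h = "\<lambda>\<omega>. \<nu> \<omega> * exp (- \<kappa> * real (card (hits (insert y Y) (g(y := \<omega>)))))
        * frame_trace (shifted c \<sigma> (insert y Y) (g(y := \<omega>)) ^^ p)"
  let ?H = "{\<omega>\<in>\<Omega>. hit \<omega>}" and ?N = "{\<omega>\<in>\<Omega>. \<not> hit \<omega>}"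
  have "(\<Sum>\<omega>\<in>?N. ?h \<omega>) = (\<Sum>\<omega>\<in>?N. \<nu> \<omega>) * (?e * frame_trace (?K ^^ p))"
    unfolding sum_distrib_right by (intro sum.cong) (auto simp: hits op)
  then have N: "(\<Sum>\<omega>\<in>?N. ?h \<omega>) = ?e * ((1 - q) * frame_trace (?K ^^ p))" by (simp add: nonhit_prob)
  have "(\<Sum>\<omega>\<in>?H. ?h \<omega>) \<le> (\<Sum>\<omega>\<in>?H. ?e * exp (- \<kappa>) * (\<nu> \<omega> * (frame_trace (?K ^^ p)
      + (ip (v \<omega>) ((?S ^^ p) (v \<omega>)) - ip (v \<omega>) ((?K ^^ p) (v \<omega>))))))"
  proof (rule sum_mono)
    fix \<omega> assume \<omega>: "\<omega> \<in> ?H"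
    have "exp (- \<kappa> * real (card (hits (insert y Y) (g(y := \<omega>))))) = ?e * exp (- \<kappa>)"
      using \<omega> ynot finite_hits[OF Y(1), of g] by (simp add: hits exp_add[symmetric] algebra_simps)
    moreover have "frame_trace (perturb ?K (rank_one (v \<omega>)) \<sigma> ^^ p)
       \<le> frame_trace (?K ^^ p) + (ip (v \<omega>) ((?S ^^ p) (v \<omega>)) - ip (v \<omega>) ((?K ^^ p) (v \<omega>)))"
      using trace_perturb_rank_one_le[OF self_adjoint_shifted shifted_ge[OF Y \<sigma> c], of "v \<omega>" \<sigma> p]
        \<sigma> \<omega> unit S by auto
    ultimately show "?h \<omega> \<le> ?e * exp (- \<kappa>) * (\<nu> \<omega> * (frame_trace (?K ^^ p)
      + (ip (v \<omega>) ((?S ^^ p) (v \<omega>)) - ip (v \<omega>) ((?K ^^ p) (v \<omega>)))))"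
      using \<omega> prob_nonneg[of \<omega>] by (simp add: op mult_left_mono mult.assoc mult.left_commute[of "\<nu> \<omega>"])
  qed
  also have "\<dots> = ?e * exp (- \<kappa>) * ((\<Sum>\<omega>\<in>?H. \<nu> \<omega>) * frame_trace (?K ^^ p)
      + ((\<Sum>\<omega>\<in>?H. \<nu> \<omega> * ip (v \<omega>) ((?S ^^ p) (v \<omega>))) - (\<Sum>\<omega>\<in>?H. \<nu> \<omega> * ip (v \<omega>) ((?K ^^ p) (v \<omega>)))))"
    by (simp add: sum_distrib_left sum_distrib_right sum.distrib sum_subtractf algebra_simps)
  also have "\<dots> = ?e * exp (- \<kappa>) * (q * frame_trace (?K ^^ p)
      + q / r * (frame_trace (?S ^^ p) - frame_trace (?K ^^ p)))"
    by (simp only: hit_prob isotropic[OF self_adjoint_funpow[OF self_adjoint_shifted]] right_diff_distrib)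
  finally have H: "(\<Sum>\<omega>\<in>?H. ?h \<omega>) \<le> \<dots>" .
  have "(\<Sum>\<omega>\<in>?H \<union> ?N. ?h \<omega>) = (\<Sum>\<omega>\<in>?H. ?h \<omega>) + (\<Sum>\<omega>\<in>?N. ?h \<omega>)"
    using finite_outcomes by (intro sum.union_disjoint) auto
  moreover have "?H \<union> ?N = \<Omega>" by auto
  ultimately have "(\<Sum>\<omega>\<in>\<Omega>. ?h \<omega>) \<le> ?e * exp (- \<kappa>) * (q * frame_trace (?K ^^ p)
      + q / r * (frame_trace (?S ^^ p) - frame_trace (?K ^^ p))) + ?e * ((1 - q) * frame_trace (?K ^^ p))"
    using H N by simp
  also have "\<dots> = ?e * (keep \<kappa> * frame_trace (?K ^^ p) + move \<kappa> * frame_trace (?S ^^ p))"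
    by (simp add: keep_def move_def algebra_simps)
  finally show ?thesis .
qed

text \<open>The recursion may lower the base by 1, but it removes a trial at the same time, so the
  margin of 2 over the number of remaining trials persists.\<close>

lemma expected_trace_le:
  assumes "finite Y" and \<sigma>: "\<sigma> = 1 \<or> \<sigma> = - 1" and "real (card Y) + 2 \<le> c"
  shows "(\<Sum>g\<in>PiE Y (\<lambda>_. \<Omega>). weight Y g * exp (- \<kappa> * real (card (hits Y g))) * frame_trace (shifted c \<sigma> Y g ^^ p))
    \<le> moment_bound \<kappa> \<sigma> (card Y) c p"
  using assms(1,3)
proof (induction Y arbitrary: c rule: finite_induct)
  case empty
  have eq: "shifted c \<sigma> {} g = (\<lambda>x. c *\<^sub>R x)" for g :: "'y \<Rightarrow> 'o"
    by (auto simp: shifted_def sample_op_def hits_def)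
  have "((\<lambda>x. c *\<^sub>R x) ^^ p) = (\<lambda>x::'v. c ^ p *\<^sub>R x)" by (induction p) auto
  then have "frame_trace ((\<lambda>x. c *\<^sub>R x) ^^ p) = r * c ^ p"
    by (simp add: frame_trace_def trace_id flip: sum_distrib_left)
  then show ?case unfolding eq by (simp add: weight_def hits_def)
next
  case (insert y Y)
  let ?P = "PiE Y (\<lambda>_. \<Omega>)"
  have c: "real (card Y) + 2 \<le> c" "real (card Y) + 2 \<le> c + \<sigma>" using insert.prems insert.hyps \<sigma> by auto
  have w: "weight (insert y Y) (g(y := \<omega>)) = weight Y g * \<nu> \<omega>" for g \<omega>
  proof -
    have "(\<Prod>z\<in>Y. \<nu> ((g(y := \<omega>)) z)) = (\<Prod>z\<in>Y. \<nu> (g z))" using insert.hyps by (intro prod.cong) auto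
    then show ?thesis using insert.hyps by (simp add: weight_def)
  qed
  have "(\<Sum>g\<in>PiE (insert y Y) (\<lambda>_. \<Omega>). weight (insert y Y) g * exp (- \<kappa> * real (card (hits (insert y Y) g)))
        * frame_trace (shifted c \<sigma> (insert y Y) g ^^ p))
    = (\<Sum>g\<in>?P. weight Y g * (\<Sum>\<omega>\<in>\<Omega>. \<nu> \<omega> * exp (- \<kappa> * real (card (hits (insert y Y) (g(y := \<omega>)))))
        * frame_trace (shifted c \<sigma> (insert y Y) (g(y := \<omega>)) ^^ p)))"
    by (subst sum_PiE_insert[OF insert.hyps(2)], subst sum.swap) (simp add: w sum_distrib_left ac_simps)
  also have "\<dots> \<le> (\<Sum>g\<in>?P. weight Y g * (exp (- \<kappa> * real (card (hits Y g))) * (keep \<kappa> * frame_trace (shifted c \<sigma> Y g ^^ p)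
        + move \<kappa> * frame_trace (shifted (c + \<sigma>) \<sigma> Y g ^^ p))))"
    by (intro sum_mono mult_left_mono one_trial insert.hyps \<sigma> c weight_nonneg)
  also have "\<dots> = keep \<kappa> * (\<Sum>g\<in>?P. weight Y g * exp (- \<kappa> * real (card (hits Y g))) * frame_trace (shifted c \<sigma> Y g ^^ p))
     + move \<kappa> * (\<Sum>g\<in>?P. weight Y g * exp (- \<kappa> * real (card (hits Y g))) * frame_trace (shifted (c + \<sigma>) \<sigma> Y g ^^ p))"
    by (simp add: sum_distrib_left sum.distrib algebra_simps)
  also have "\<dots> \<le> keep \<kappa> * moment_bound \<kappa> \<sigma> (card Y) c p + move \<kappa> * moment_bound \<kappa> \<sigma> (card Y) (c + \<sigma>) p"
    by (intro add_mono mult_left_mono insert.IH c keep_nonneg move_nonneg)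
  finally show ?case using insert.hyps by simp
qed

text \<open>The sign covers both tails: for \<open>\<tau> = (\<sigma> + \<epsilon>) / r\<close>, the
  form reaches \<open>(1 + \<epsilon>) / r\<close> times the number of hits if \<sigma> is 1, and is
  at most \<open>(1 - \<epsilon>) / r\<close> times that number if \<sigma> is -1.\<close>

definition bad :: "real \<Rightarrow> real \<Rightarrow> 'y set \<Rightarrow> ('y \<Rightarrow> 'o) \<Rightarrow> bool" where
  "bad \<sigma> \<tau> Y g \<longleftrightarrow> (\<exists>w. ip w w = 1 \<and> \<tau> * card (hits Y g) \<le> \<sigma> * ip w (sample_op Y g w))"

text \<open>The factor \<open>e\<^bsup>-\<kappa> N\<^esup>\<close> makes it unnecessary to condition on the number \<open>N\<close> of hits. No hit at all
  counts as bad.\<close>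

lemma tail_le:
  fixes Y :: "'y set"
  assumes Y: "finite Y" and \<sigma>: "\<sigma> = 1 \<or> \<sigma> = - 1" and \<tau>: "- 1 \<le> \<tau>" and \<theta>: "0 \<le> \<theta>"
  shows "(\<Sum>g\<in>{g\<in>PiE Y (\<lambda>_. \<Omega>). bad \<sigma> \<tau> Y g}. weight Y g)
    \<le> r * (keep (\<theta> * \<tau>) + move (\<theta> * \<tau>) * exp (\<theta> * \<sigma>)) ^ card Y"
proof -
  let ?P = "PiE Y (\<lambda>_. \<Omega>)" and ?\<rho> = "keep (\<theta> * \<tau>) + move (\<theta> * \<tau>) * exp (\<theta> * \<sigma>)"
  let ?B = "{g\<in>?P. bad \<sigma> \<tau> Y g}"
  define c where "c = real (card Y) + 2"
  define N where "N = (\<lambda>g. real (card (hits Y g)))"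
  have fin: "finite ?P" using Y finite_outcomes by (intro finite_PiE)
  have psd: "psd (shifted c \<sigma> Y g)" if "g \<in> ?P" for g
    unfolding psd_def using self_adjoint_shifted shifted_ge[OF Y that \<sigma>, of 0 c] by (auto simp: c_def)
  \<comment> \<open>Since \<tau> is at least -1 and there are at most \<open>card Y\<close> hits,
    the base of the powers below is nonnegative.\<close>
  have N: "0 \<le> c + \<tau> * N g" for g :: "'y \<Rightarrow> 'o"
  proof -
    have "card (hits Y g) \<le> card Y" unfolding hits_def using Y by (intro card_mono) auto
    moreover have "- N g \<le> \<tau> * N g" using \<tau> mult_right_mono[of "-1" \<tau> "N g"] by (simp add: N_def)
    ultimately show ?thesis by (simp add: c_def N_def)
  qed
  \<comment> \<open>A bad direction \<open>w\<close> makes the quadratic form large; its powers are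
    dominated by moments, and these by the trace.\<close>
  have tr: "(c + \<tau> * N g) ^ p \<le> frame_trace (shifted c \<sigma> Y g ^^ p)" if g: "g \<in> ?B" for g p
  proof -
    obtain w where w: "ip w w = 1" "\<tau> * N g \<le> \<sigma> * ip w (sample_op Y g w)"
      using g by (auto simp: bad_def N_def)
    have "(c + \<tau> * N g) ^ p \<le> ip w (shifted c \<sigma> Y g w) ^ p"
      using N[of g] w by (intro power_mono) (auto simp: shifted_def)
    also have "\<dots> \<le> ip w ((shifted c \<sigma> Y g ^^ p) w)" using g psd by (intro moment_power w) auto
    also have "\<dots> \<le> frame_trace (shifted c \<sigma> Y g ^^ p)" using g psd by (intro psd_le_trace psd_funpow w) auto
    finally show ?thesis .
  qed
  have nn: "0 \<le> frame_trace (shifted c \<sigma> Y g ^^ p)" if "g \<in> ?P" for g p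
    using psd_funpow[OF psd[OF that], of p] by (auto simp: frame_trace_def psd_def intro!: sum_nonneg)
  \<comment> \<open>Working with partial sums of the exponential series keeps the argument at powers
    of operators; no operator exponential occurs.\<close>
  have partial: "(\<Sum>p<P. \<theta> ^ p / fact p * (\<Sum>g\<in>?B. weight Y g * exp (- (\<theta> * \<tau>) * N g) * (c + \<tau> * N g) ^ p))
      \<le> r * exp (\<theta> * c) * ?\<rho> ^ card Y" for P
  proof -
    have "(\<Sum>p<P. \<theta> ^ p / fact p * (\<Sum>g\<in>?B. weight Y g * exp (- (\<theta> * \<tau>) * N g) * (c + \<tau> * N g) ^ p))
      \<le> (\<Sum>p<P. \<theta> ^ p / fact p * moment_bound (\<theta> * \<tau>) \<sigma> (card Y) c p)"
    proof (intro sum_mono mult_left_mono)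
      fix p
      have "(\<Sum>g\<in>?B. weight Y g * exp (- (\<theta> * \<tau>) * N g) * (c + \<tau> * N g) ^ p)
          \<le> (\<Sum>g\<in>?B. weight Y g * exp (- (\<theta> * \<tau>) * N g) * frame_trace (shifted c \<sigma> Y g ^^ p))"
        using tr weight_nonneg by (intro sum_mono mult_left_mono mult_nonneg_nonneg) auto
      also have "\<dots> \<le> (\<Sum>g\<in>?P. weight Y g * exp (- (\<theta> * \<tau>) * N g) * frame_trace (shifted c \<sigma> Y g ^^ p))"
        using nn weight_nonneg by (intro sum_mono2 fin mult_nonneg_nonneg) auto
      also have "\<dots> \<le> moment_bound (\<theta> * \<tau>) \<sigma> (card Y) c p"
        unfolding N_def by (intro expected_trace_le Y \<sigma>) (simp add: c_def)
      finally show "(\<Sum>g\<in>?B. weight Y g * exp (- (\<theta> * \<tau>) * N g) * (c + \<tau> * N g) ^ p)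
          \<le> moment_bound (\<theta> * \<tau>) \<sigma> (card Y) c p" .
    qed (use \<theta> in auto)
    also have "\<dots> \<le> r * exp (\<theta> * c) * ?\<rho> ^ card Y"
    proof -
      \<comment> \<open>The base drops by at most 1 per trial, so it stays nonnegative when it
        starts at \<open>k\<close> or above.\<close>
      have "0 \<le> moment_bound (\<theta> * \<tau>) \<sigma> k b p" if "real k \<le> b" for k b p
        using that
      proof (induction k arbitrary: b)
        case (Suc k)
        then have "real k \<le> b" "real k \<le> b + \<sigma>" using \<sigma> by auto
        then show ?case using Suc.IH keep_nonneg move_nonneg by simp
      qed (use r_ge_1 in simp)
      then have "0 \<le> moment_bound (\<theta> * \<tau>) \<sigma> (card Y) c p" for p by (simp add: c_def)
      then have "(\<Sum>p<P. \<theta> ^ p / fact p * moment_bound (\<theta> * \<tau>) \<sigma> (card Y) c p)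
          \<le> (\<Sum>p. \<theta> ^ p / fact p * moment_bound (\<theta> * \<tau>) \<sigma> (card Y) c p)"
        using \<theta> by (intro sum_le_suminf sums_summable[OF moment_bound_sums]) auto
      then show ?thesis by (simp only: sums_unique[OF moment_bound_sums])
    qed
    finally show ?thesis .
  qed
  have "(\<lambda>p. \<Sum>g\<in>?B. weight Y g * exp (- (\<theta> * \<tau>) * N g) * ((\<theta> * (c + \<tau> * N g)) ^ p /\<^sub>R fact p))
      sums (\<Sum>g\<in>?B. weight Y g * exp (- (\<theta> * \<tau>) * N g) * exp (\<theta> * (c + \<tau> * N g)))"
    by (intro sums_sum sums_mult exp_converges)
  also have "(\<lambda>p. \<Sum>g\<in>?B. weight Y g * exp (- (\<theta> * \<tau>) * N g) * ((\<theta> * (c + \<tau> * N g)) ^ p /\<^sub>R fact p))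
      = (\<lambda>p. \<theta> ^ p / fact p * (\<Sum>g\<in>?B. weight Y g * exp (- (\<theta> * \<tau>) * N g) * (c + \<tau> * N g) ^ p))"
    unfolding sum_distrib_left by (intro ext sum.cong) (simp_all add: power_mult_distrib divide_inverse ac_simps)
  also have "(\<Sum>g\<in>?B. weight Y g * exp (- (\<theta> * \<tau>) * N g) * exp (\<theta> * (c + \<tau> * N g)))
      = exp (\<theta> * c) * (\<Sum>g\<in>?B. weight Y g)"
  proof -
    \<comment> \<open>The random number of hits cancels: this fixes the damping rate as
      \<open>\<theta> * \<tau>\<close>.\<close>
    have "exp (- (\<theta> * \<tau>) * N g) * exp (\<theta> * (c + \<tau> * N g)) = exp (\<theta> * c)" for g :: "'y \<Rightarrow> 'o"
      unfolding mult_exp_exp by (simp add: algebra_simps)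
    then show ?thesis by (simp only: mult.assoc) (simp add: sum_distrib_left mult.commute)
  qed
  finally have "exp (\<theta> * c) * (\<Sum>g\<in>?B. weight Y g) \<le> r * exp (\<theta> * c) * ?\<rho> ^ card Y"
    unfolding sums_def by (rule LIMSEQ_le_const2) (use partial in blast)
  then have "exp (\<theta> * c) * (\<Sum>g\<in>?B. weight Y g) \<le> exp (\<theta> * c) * (r * ?\<rho> ^ card Y)"
    by (simp add: ac_simps)
  then show ?thesis by simp
qed

text \<open>With \<open>exp (\<theta> * \<sigma>) \<le> 1 + \<theta> * \<sigma> + \<theta>^2\<close>
  the exponent of a hit is \<open>(\<theta>^2 - \<theta> * \<epsilon>) / r\<close>, which is
  smallest at \<open>\<theta> = \<epsilon> / 2\<close>, with value
  \<open>- \<epsilon>^2 / (4 * r)\<close>. The remaining 3/4 of 3/16 comes from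
  \<open>exp (- x) \<le> 1 - 3 / 4 * x\<close> for \<open>x \<le> 1 / 4\<close>.\<close>

lemma tail_exp_le:
  assumes Y: "finite Y" and \<sigma>: "\<sigma> = 1 \<or> \<sigma> = - 1" and \<epsilon>: "0 < \<epsilon>" "\<epsilon> < 1"
  shows "(\<Sum>g\<in>{g\<in>PiE Y (\<lambda>_. \<Omega>). bad \<sigma> ((\<sigma> + \<epsilon>) / r) Y g}. weight Y g)
    \<le> r * exp (- (3 / 16) * q * \<epsilon>\<^sup>2 / r * card Y)"
proof -
  let ?\<theta> = "\<epsilon> / 2" and ?\<tau> = "(\<sigma> + \<epsilon>) / r"
  let ?\<rho> = "keep (?\<theta> * ?\<tau>) + move (?\<theta> * ?\<tau>) * exp (?\<theta> * \<sigma>)"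
  have exp_neg: "exp (- t) \<le> 1 - t + t\<^sup>2" if "0 \<le> t" for t :: real
  proof -
    \<comment> \<open>The product is \<open>1 + t^3\<close>.\<close>
    have "1 \<le> (1 - t + t\<^sup>2) * (1 + t)" using that by (simp add: algebra_simps power2_eq_square)
    also have "\<dots> \<le> (1 - t + t\<^sup>2) * exp t"
    proof (rule mult_left_mono)
      have "0 \<le> (t - 1 / 2)\<^sup>2 + 3 / 4" by simp
      then show "0 \<le> 1 - t + t\<^sup>2" by (simp add: power2_eq_square algebra_simps)
    qed simp
    finally have "1 * exp (- t) \<le> (1 - t + t\<^sup>2) * exp t * exp (- t)" by (intro mult_right_mono) auto
    then show ?thesis by (simp add: mult_exp_exp mult.assoc)
  qed
  have e: "exp (?\<theta> * \<sigma>) \<le> 1 + ?\<theta> * \<sigma> + ?\<theta>\<^sup>2"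
    using \<sigma> exp_bound[of ?\<theta>] exp_neg[of ?\<theta>] \<epsilon> by auto
  define x where "x = \<epsilon>\<^sup>2 / (4 * r)"
  have x: "0 \<le> x" "x \<le> 1 / 4"
  proof -
    have "\<epsilon>\<^sup>2 \<le> 1" using \<epsilon> by (simp add: power_le_one)
    then show "x \<le> 1 / 4" "0 \<le> x" using r_ge_1 by (auto simp: x_def field_simps)
  qed
  have "?\<rho> = 1 - q + q * (exp (- (?\<theta> * ?\<tau>)) * (1 + (exp (?\<theta> * \<sigma>) - 1) / r))"
    by (simp add: keep_def move_def algebra_simps diff_divide_distrib)
  also have "\<dots> \<le> 1 - q + q * (exp (- (?\<theta> * ?\<tau>)) * exp ((?\<theta> * \<sigma> + ?\<theta>\<^sup>2) / r))"
  proof (intro add_left_mono mult_left_mono q_bounds)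
    have "1 + (exp (?\<theta> * \<sigma>) - 1) / r \<le> 1 + (?\<theta> * \<sigma> + ?\<theta>\<^sup>2) / r"
      using e r_ge_1 by (intro add_left_mono divide_right_mono) auto
    also have "\<dots> \<le> exp ((?\<theta> * \<sigma> + ?\<theta>\<^sup>2) / r)" by (rule exp_ge_add_one_self)
    finally show "1 + (exp (?\<theta> * \<sigma>) - 1) / r \<le> exp ((?\<theta> * \<sigma> + ?\<theta>\<^sup>2) / r)" .
  qed simp
  also have "exp (- (?\<theta> * ?\<tau>)) * exp ((?\<theta> * \<sigma> + ?\<theta>\<^sup>2) / r) = exp (- x)"
    unfolding mult_exp_exp using r_ge_1 by (simp add: x_def field_simps power2_eq_square)
  also have "1 - q + q * exp (- x) \<le> 1 - q + q * (1 - 3 / 4 * x)"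
  proof (intro add_left_mono mult_left_mono q_bounds)
    have "x * x \<le> 1 / 4 * x" using x by (intro mult_right_mono)
    then show "exp (- x) \<le> 1 - 3 / 4 * x" using exp_neg[OF x(1)] by (simp add: power2_eq_square)
  qed
  also have "\<dots> = 1 + (- (3 / 4) * q * x)" by (simp add: algebra_simps)
  also have "\<dots> \<le> exp (- (3 / 4) * q * x)" by (rule exp_ge_add_one_self)
  finally have \<rho>: "?\<rho> \<le> exp (- (3 / 4) * q * x)" .
  have "0 \<le> ?\<rho>" using keep_nonneg move_nonneg by simp
  have "- 1 \<le> ?\<tau>" using \<sigma> \<epsilon> r_ge_1 by (auto simp: field_simps)
  then have "(\<Sum>g\<in>{g\<in>PiE Y (\<lambda>_. \<Omega>). bad \<sigma> ?\<tau> Y g}. weight Y g) \<le> r * ?\<rho> ^ card Y"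
    using \<epsilon> by (intro tail_le Y \<sigma>) auto
  also have "\<dots> \<le> r * exp (- (3 / 4) * q * x) ^ card Y"
    using \<rho> \<open>0 \<le> ?\<rho>\<close> r_ge_1 by (intro mult_left_mono power_mono) auto
  also have "exp (- (3 / 4) * q * x) ^ card Y = exp (- (3 / 16) * q * \<epsilon>\<^sup>2 / r * card Y)"
    unfolding exp_of_nat_mult[symmetric] by (simp add: x_def)
  finally show ?thesis .
qed

end

section \<open>Pseudoinverses and sensitivities\<close>

definition gram_op :: "(real^'d) list \<Rightarrow> real^'d \<Rightarrow> real^'d" where
  "gram_op A x = (\<Sum>y\<leftarrow>A. (y \<bullet> x) *\<^sub>R y)"

text \<open>These conditions determine the Moore-Penrose inverse of the Gram operator: symmetry and
  range force \<open>H\<close> to vanish on the orthogonal complement of the row span.\<close>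

definition is_pinv :: "(real^'d) list \<Rightarrow> real^'d^'d \<Rightarrow> bool" where
  "is_pinv A H \<longleftrightarrow> (\<forall>x y. (H *v x) \<bullet> y = x \<bullet> (H *v y)) \<and> (\<forall>x. H *v x \<in> span (set A))
     \<and> (\<forall>x\<in>span (set A). H *v (gram_op A x) = x)"

lemma gram_op_simps [simp]:
  "gram_op A (x + y) = gram_op A x + gram_op A y"
  "gram_op A (x - y) = gram_op A x - gram_op A y"
  "gram_op A (c *\<^sub>R x) = c *\<^sub>R gram_op A x"
  "gram_op A 0 = 0"
  by (induction A) (auto simp: gram_op_def algebra_simps)

lemma gram_op_snoc: "gram_op (A @ [x]) y = gram_op A y + (x \<bullet> y) *\<^sub>R x"
  by (simp add: gram_op_def)

lemma inner_gram_op: "z \<bullet> gram_op A x = (\<Sum>y\<leftarrow>A. (y \<bullet> z) * (y \<bullet> x))"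
  by (induction A) (auto simp: gram_op_def algebra_simps inner_commute)

lemma inner_gram_op_commute: "z \<bullet> gram_op A x = gram_op A z \<bullet> x"
  by (simp add: inner_gram_op inner_commute[of "gram_op A z"] mult.commute)

lemma inner_gram_op_self: "x \<bullet> gram_op A x = (\<Sum>y\<leftarrow>A. (y \<bullet> x)\<^sup>2)"
  by (simp add: inner_gram_op power2_eq_square)

lemma inner_gram_op_nonneg: "0 \<le> x \<bullet> gram_op A x"
  unfolding inner_gram_op_self by (intro sum_list_nonneg) auto

lemma gram_op_span: "gram_op A x \<in> span (set A)"
proof -
  have "set B \<subseteq> set A \<Longrightarrow> gram_op B x \<in> span (set A)" for B
    by (induction B) (auto simp: gram_op_def intro: span_add span_scale span_base span_zero)
  then show ?thesis by simp
qed

lemma is_pinvD: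
  assumes "is_pinv A H"
  shows "(H *v x) \<bullet> y = x \<bullet> (H *v y)" "H *v x \<in> span (set A)"
    "x \<in> span (set A) \<Longrightarrow> H *v (gram_op A x) = x"
  using assms by (auto simp: is_pinv_def)

text \<open>The residual \<open>?z\<close> lies in the row span; moving both operators across the
  inner product shows that it is orthogonal to itself.\<close>

lemma gram_pinv:
  assumes H: "is_pinv A H" and x: "x \<in> span (set A)"
  shows "gram_op A (H *v x) = x"
proof -
  let ?z = "gram_op A (H *v x) - x"
  have z: "?z \<in> span (set A)" by (intro span_diff gram_op_span x)
  have "?z \<bullet> gram_op A (H *v x) = gram_op A ?z \<bullet> (H *v x)" by (rule inner_gram_op_commute)
  also have "\<dots> = (H *v gram_op A ?z) \<bullet> x" by (rule is_pinvD(1)[OF H, symmetric])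
  also have "\<dots> = ?z \<bullet> x" by (simp only: is_pinvD(3)[OF H z])
  finally have "?z \<bullet> gram_op A (H *v x) = ?z \<bullet> x" .
  then have "?z \<bullet> ?z = 0" by (simp add: inner_diff_right)
  then show ?thesis by simp
qed

lemma gram_op_eq_0:
  assumes "\<And>y. y \<in> span (set A) \<Longrightarrow> c \<bullet> y = 0"
  shows "gram_op A c = 0"
proof -
  have "gram_op A c \<bullet> gram_op A c = 0"
    using assms[OF gram_op_span, of "gram_op A c"] by (simp only: inner_gram_op_commute[symmetric])
  then show ?thesis by simp
qed

text \<open>\<open>H\<close> after the Gram operator is the orthogonal projection onto the row span,
  so the residual is the new direction that \<open>x\<close> brings.\<close>

lemma pinv_residual_orthogonal:
  assumes H: "is_pinv A H" and y: "y \<in> span (set A)"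
  shows "(x - H *v gram_op A x) \<bullet> y = 0"
proof -
  have "(H *v gram_op A x) \<bullet> y = x \<bullet> gram_op A (H *v y)"
    using is_pinvD(1)[OF H] by (simp add: inner_gram_op_commute)
  then show ?thesis by (simp add: gram_pinv[OF H y] inner_diff_left)
qed

lemma pinv_residual_eq_0_iff:
  assumes H: "is_pinv A H"
  shows "x - H *v gram_op A x = 0 \<longleftrightarrow> x \<in> span (set A)"
  using is_pinvD(2,3)[OF H] by (metis eq_iff_diff_eq_0)

lemma pinv_form:
  assumes H: "is_pinv A H" and x: "x \<in> span (set A)"
  shows "x \<bullet> (H *v x) = (H *v x) \<bullet> gram_op A (H *v x)"
  unfolding gram_pinv[OF H x] by (rule inner_commute)

text \<open>The new Gram term contributes \<open>(x \<bullet> y) *\<^sub>R ?g\<close>. The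
  correction removes exactly this, because \<open>?g \<bullet> x = t - 1\<close> makes its numerator
  \<open>t\<close> times \<open>x \<bullet> y\<close>.\<close>

lemma is_pinv_snoc_in_span:
  assumes H: "is_pinv A H" and x: "x \<in> span (set A)"
    and H': "\<And>z. H' *v z = H *v z - (((H *v x) \<bullet> z) / (1 + x \<bullet> (H *v x))) *\<^sub>R (H *v x)"
  shows "is_pinv (A @ [x]) H'"
proof -
  let ?g = "H *v x"
  define t where "t = 1 + x \<bullet> ?g"
  have t: "t \<noteq> 0" using pinv_form[OF H x] inner_gram_op_nonneg[of ?g A] by (simp add: t_def)
  have span: "span (set (A @ [x])) = span (set A)" using x by (simp add: span_redundant)
  have sym: "(H' *v z) \<bullet> y = z \<bullet> (H' *v y)" for z y
    using is_pinvD(1)[OF H, of z y] by (simp add: H' inner_diff_left inner_diff_right inner_commute)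
  have ran: "H' *v z \<in> span (set A)" for z
    unfolding H' by (intro span_diff span_scale is_pinvD(2)[OF H])
  have inv: "H' *v gram_op (A @ [x]) y = y" if y: "y \<in> span (set A)" for y
  proof -
    have 1: "?g \<bullet> gram_op A y = x \<bullet> y"
      using is_pinvD(1,3)[OF H] y by simp
    have 2: "?g \<bullet> x = t - 1" by (simp add: t_def inner_commute)
    have "H' *v gram_op (A @ [x]) y = (H *v gram_op A y + (x \<bullet> y) *\<^sub>R ?g)
        - ((x \<bullet> y + (x \<bullet> y) * (t - 1)) / t) *\<^sub>R ?g"
      using H'[of "gram_op (A @ [x]) y", folded t_def]
      by (simp add: gram_op_snoc matrix_vector_right_distrib matrix_vector_mult_scaleR inner_add_right 1 2)
    also have "(x \<bullet> y + (x \<bullet> y) * (t - 1)) / t = x \<bullet> y" using t by (simp add: field_simps)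
    finally show ?thesis using is_pinvD(3)[OF H y] by simp
  qed
  show ?thesis unfolding is_pinv_def span using sym ran inv by blast
qed

text \<open>The vector \<open>k\<close> represents the functional that vanishes on the old rows and
  is 1 at \<open>x\<close>. The last coefficient is such that \<open>H'\<close> maps
  \<open>x\<close> to \<open>k\<close>; for old \<open>y\<close> this cancels the error
  \<open>- (x \<bullet> y) *\<^sub>R k\<close>.\<close>

lemma is_pinv_snoc_new:
  assumes H: "is_pinv A H" and c: "c = x - H *v gram_op A x" "c \<noteq> 0"
    and k: "k = (1 / (c \<bullet> c)) *\<^sub>R c"
    and H': "\<And>z. H' *v z = H *v z - ((H *v x) \<bullet> z) *\<^sub>R k - (k \<bullet> z) *\<^sub>R (H *v x)
        + ((1 + x \<bullet> (H *v x)) * (k \<bullet> z)) *\<^sub>R k"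
  shows "is_pinv (A @ [x]) H'"
    and "y \<in> span (set A) \<Longrightarrow> k \<bullet> y = 0" and "k \<bullet> x = 1" and "H' *v x = k"
proof -
  let ?g = "H *v x"
  define t where "t = 1 + x \<bullet> ?g"
  have corth: "c \<bullet> y = 0" if "y \<in> span (set A)" for y
    using pinv_residual_orthogonal[OF H that, of x] c(1) by simp
  show korth: "k \<bullet> y = 0" if "y \<in> span (set A)" for y
    using corth[OF that] by (simp add: k)
  have x: "x = H *v gram_op A x + c" using c(1) by simp
  have cx: "c \<bullet> x = c \<bullet> c"
    by (subst x) (simp add: inner_add_right corth[OF is_pinvD(2)[OF H]])
  then show kx: "k \<bullet> x = 1" using c(2) by (simp add: k)
  have span_mono: "y \<in> span (set (A @ [x]))" if "y \<in> span (set A)" for y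
    using that span_mono[of "set A" "set (A @ [x])"] by auto
  have c_span: "c \<in> span (set (A @ [x]))"
    unfolding c(1) by (intro span_diff span_mono is_pinvD(2)[OF H] span_base) auto
  have sym: "(H' *v z) \<bullet> y = z \<bullet> (H' *v y)" for z y
    using is_pinvD(1)[OF H, of z y] by (simp add: H' inner_diff_left inner_diff_right
        inner_add_left inner_add_right inner_commute)
  have ran: "H' *v z \<in> span (set (A @ [x]))" for z
    unfolding H' k by (intro span_diff span_add span_scale c_span span_mono is_pinvD(2)[OF H])
  show H'x: "H' *v x = k"
    unfolding H' t_def[symmetric] kx by (simp add: t_def inner_commute algebra_simps)
  have inv1: "H' *v gram_op (A @ [x]) y = y" if y: "y \<in> span (set A)" for y
  proof -
    have "?g \<bullet> gram_op A y = x \<bullet> y" using is_pinvD(1,3)[OF H] y by simp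
    then have "H' *v gram_op A y = y - (x \<bullet> y) *\<^sub>R k"
      unfolding H' by (simp add: korth[OF gram_op_span] is_pinvD(3)[OF H y])
    then show ?thesis by (simp add: gram_op_snoc matrix_vector_right_distrib H'x matrix_vector_mult_scaleR)
  qed
  have "gram_op A c = 0" by (rule gram_op_eq_0) (rule corth)
  then have inv2: "H' *v gram_op (A @ [x]) c = c"
    using cx c(2) by (simp add: gram_op_snoc matrix_vector_mult_scaleR H'x inner_commute[of x] k)
  have inv: "H' *v gram_op (A @ [x]) z = z" if z: "z \<in> span (set (A @ [x]))" for z
  proof -
    \<comment> \<open>The enlarged span is the old one plus the line of \<open>c\<close>;
      \<open>inv1\<close> and \<open>inv2\<close> treat the two parts.\<close>
    obtain b where b: "z - b *\<^sub>R x \<in> span (set A)"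
      using z span_breakdown_eq[of z x "set A"] by auto
    define y where "y = (z - b *\<^sub>R x) + b *\<^sub>R (H *v gram_op A x)"
    have y: "y \<in> span (set A)"
      unfolding y_def by (intro span_add b span_scale is_pinvD(2)[OF H])
    have z: "z = y + b *\<^sub>R c" by (simp add: y_def c(1) algebra_simps)
    show ?thesis unfolding z by (simp add: matrix_vector_right_distrib matrix_vector_mult_scaleR inv1[OF y] inv2)
  qed
  show "is_pinv (A @ [x]) H'" unfolding is_pinv_def using sym ran inv by blast
qed

lemma is_pinv_Nil: "is_pinv [] 0"
  by (simp add: is_pinv_def)

section \<open>Hyperplanes by their normals, and sensitivities as quadratic forms\<close>

lemma linear_hyperplaneE:
  fixes S :: "(real^'d) set"
  assumes "S \<in> linear_hyperplanes"
  obtains v where "v \<noteq> 0" "S = {y. v \<bullet> y = 0}"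
proof -
  have S: "subspace S" "dim S + 1 = CARD('d)" using assms by (auto simp: linear_hyperplanes_def)
  then have "dim S < DIM(real^'d)" by simp
  then obtain v where v: "v \<noteq> 0" "span S \<subseteq> {y. v \<bullet> y = 0}" using lowdim_subset_hyperplane by blast
  have "dim {y. v \<bullet> y = 0} \<le> dim S" using dim_hyperplane[OF v(1)] S(2) by simp
  then have "S = {y. v \<bullet> y = 0}"
    using v(2) span_superset by (intro subspace_dim_equal S(1) subspace_hyperplane) blast+
  then show ?thesis using v(1) that by blast
qed

lemma linear_hyperplaneI:
  fixes v :: "real^'d"
  assumes "v \<noteq> 0"
  shows "{y. v \<bullet> y = 0} \<in> linear_hyperplanes"
  using assms dim_hyperplane[OF assms] by (simp add: linear_hyperplanes_def subspace_hyperplane)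

lemma sqdist_hyperplane:
  fixes v :: "real^'d"
  assumes v: "v \<noteq> 0"
  shows "sqdist x {y. v \<bullet> y = 0} = (v \<bullet> x)\<^sup>2 / (v \<bullet> v)"
proof (rule antisym)
  have vv: "v \<bullet> v > 0" using v by simp
  define s where "s = x - ((v \<bullet> x) / (v \<bullet> v)) *\<^sub>R v"
  have "s \<in> {y. v \<bullet> y = 0}" using v by (simp add: s_def inner_diff_right)
  moreover have "(norm (x - s))\<^sup>2 = (v \<bullet> x)\<^sup>2 / (v \<bullet> v)"
    using v by (simp add: s_def power_mult_distrib power_divide dot_square_norm power2_eq_square)
  ultimately show "sqdist x {y. v \<bullet> y = 0} \<le> (v \<bullet> x)\<^sup>2 / (v \<bullet> v)"
    unfolding sqdist_def by (intro cINF_lower2[where x = s]) (auto intro!: bdd_belowI[of _ 0])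
  show "(v \<bullet> x)\<^sup>2 / (v \<bullet> v) \<le> sqdist x {y. v \<bullet> y = 0}"
    unfolding sqdist_def
  proof (rule cINF_greatest)
    show "{y. v \<bullet> y = 0} \<noteq> {}" by (auto intro: exI[of _ 0])
    fix s assume "s \<in> {y. v \<bullet> y = 0}"
    then have "(v \<bullet> x)\<^sup>2 = (v \<bullet> (x - s))\<^sup>2" by (simp add: inner_diff_right)
    also have "\<dots> \<le> (v \<bullet> v) * ((x - s) \<bullet> (x - s))" by (rule Cauchy_Schwarz_ineq)
    finally show "(v \<bullet> x)\<^sup>2 / (v \<bullet> v) \<le> (norm (x - s))\<^sup>2"
      using vv by (simp add: dot_square_norm field_simps)
  qed
qed

lemma total_sqdist_hyperplane:
  fixes v :: "real^'d"
  assumes v: "v \<noteq> 0"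
  shows "total_sqdist A {y. v \<bullet> y = 0} = (v \<bullet> gram_op A v) / (v \<bullet> v)"
proof -
  have "total_sqdist A {y. v \<bullet> y = 0} = (\<Sum>y\<leftarrow>A. (v \<bullet> y)\<^sup>2) / (v \<bullet> v)"
    unfolding total_sqdist_def
    by (induction A) (auto simp: sqdist_hyperplane[OF v] add_divide_distrib)
  then show ?thesis by (simp add: inner_gram_op_self inner_commute)
qed

text \<open>For a normal \<open>v\<close> the quotient is
  \<open>(v \<bullet> x)^2 / (v \<bullet> gram_op A v)\<close>, and \<open>v \<bullet> x\<close> is
  the Gram product of \<open>v\<close> with \<open>?g\<close>. Cauchy-Schwarz bounds it, with
  equality at \<open>v = ?g\<close>; the inserted 0 covers
  \<open>x \<bullet> ?g = 0\<close>.\<close>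

lemma sensitivity_eq:
  assumes H: "is_pinv A H" and x: "x \<in> span (set A)"
  shows "sensitivity A x = x \<bullet> (H *v x)"
proof -
  let ?g = "H *v x" and ?Q = "{sqdist x S / total_sqdist A S | S.
                      S \<in> linear_hyperplanes \<and> total_sqdist A S > 0}"
  have nn: "0 \<le> x \<bullet> ?g" using pinv_form[OF H x] inner_gram_op_nonneg by simp
  have upper: "s \<le> x \<bullet> ?g" if s: "s \<in> ?Q" for s
  proof -
    obtain S where S: "S \<in> linear_hyperplanes" "total_sqdist A S > 0" "s = sqdist x S / total_sqdist A S"
      using s by blast
    obtain v where v: "v \<noteq> 0" "S = {y. v \<bullet> y = 0}" using S(1) by (rule linear_hyperplaneE)
    have pos: "0 < v \<bullet> gram_op A v" "0 < v \<bullet> v"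
      using S(2) v inner_ge_zero[of v] by (auto simp: total_sqdist_hyperplane zero_less_divide_iff)
    have s: "s = (v \<bullet> x)\<^sup>2 / (v \<bullet> gram_op A v)"
      using v S(3) by (simp add: total_sqdist_hyperplane sqdist_hyperplane)
    have "(v \<bullet> x)\<^sup>2 = (\<Sum>y\<leftarrow>A. (y \<bullet> v) * (y \<bullet> ?g))\<^sup>2"
      using inner_gram_op[of v A ?g] by (simp add: gram_pinv[OF H x])
    also have "\<dots> \<le> (\<Sum>y\<leftarrow>A. (y \<bullet> v)\<^sup>2) * (\<Sum>y\<leftarrow>A. (y \<bullet> ?g)\<^sup>2)"
      unfolding sum_list_sum_nth by (simp add: Cauchy_Schwarz_ineq_sum)
    also have "\<dots> = (v \<bullet> gram_op A v) * (x \<bullet> ?g)"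
      by (simp add: inner_gram_op_self[symmetric] pinv_form[OF H x])
    finally show ?thesis using pos by (simp add: s field_simps)
  qed
  have "x \<bullet> ?g \<in> insert 0 ?Q"
  proof (cases "x = 0")
    case True
    then show ?thesis by simp
  next
    case False
    have g: "?g \<noteq> 0" using gram_pinv[OF H x] False by auto
    then have gg: "0 < ?g \<bullet> ?g" by simp
    show ?thesis
    proof (cases "x \<bullet> ?g = 0")
      case False
      then have pos: "0 < x \<bullet> ?g" using nn by simp
      have tot: "total_sqdist A {y. ?g \<bullet> y = 0} = (x \<bullet> ?g) / (?g \<bullet> ?g)"
        using total_sqdist_hyperplane[OF g] pinv_form[OF H x] by simp
      have "x \<bullet> ?g = sqdist x {y. ?g \<bullet> y = 0} / total_sqdist A {y. ?g \<bullet> y = 0}"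
        unfolding sqdist_hyperplane[OF g] tot using g pos by (simp add: power2_eq_square inner_commute[of ?g x])
      moreover have "0 < total_sqdist A {y. ?g \<bullet> y = 0}" using tot pos gg by simp
      ultimately show ?thesis using linear_hyperplaneI[OF g] by blast
    qed simp
  qed
  then show ?thesis
    unfolding sensitivity_def using upper nn by (intro cSup_eq_maximum) auto
qed

lemma matrix_add_outer:
  "result (add_outer c x y H) *v z = H *v z + (c * (y \<bullet> z)) *\<^sub>R x"
  by (simp add: vec_eq_iff add_outer_def each_coord_def axpy_def scalar_def bind_costed_def
      matrix_vector_mul_component inner_add_left)

lemma row_rank_snoc:
  "row_rank (A @ [x]) = (if x \<in> span (set A) then row_rank A else row_rank A + 1)"
  by (simp add: row_rank_def dim_insert)

lemma sensitivity_snoc_in_span: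
  assumes H: "is_pinv A H" and x: "x \<in> span (set A)"
  shows "y \<in> span (set A) \<Longrightarrow>
      sensitivity (A @ [x]) y = sensitivity A y - (y \<bullet> (H *v x))\<^sup>2 / (1 + x \<bullet> (H *v x))"
    and "sensitivity (A @ [x]) x = (x \<bullet> (H *v x)) / (1 + x \<bullet> (H *v x))"
proof -
  define K where "K = result (add_outer (- 1 / (1 + x \<bullet> (H *v x))) (H *v x) (H *v x) H)"
  have Kz: "K *v z = H *v z - (((H *v x) \<bullet> z) / (1 + x \<bullet> (H *v x))) *\<^sub>R (H *v x)" for z
    by (simp add: K_def matrix_add_outer)
  have K: "is_pinv (A @ [x]) K" by (rule is_pinv_snoc_in_span[OF H x Kz])
  have span: "span (set (A @ [x])) = span (set A)" using x by (simp add: span_redundant)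
  show *: "sensitivity (A @ [x]) y = sensitivity A y - (y \<bullet> (H *v x))\<^sup>2 / (1 + x \<bullet> (H *v x))"
    if "y \<in> span (set A)" for y
    using that sensitivity_eq[OF K, unfolded span] sensitivity_eq[OF H]
    by (simp add: Kz inner_diff_right power2_eq_square inner_commute)
  have "0 \<le> x \<bullet> (H *v x)" using pinv_form[OF H x] inner_gram_op_nonneg by simp
  then show "sensitivity (A @ [x]) x = (x \<bullet> (H *v x)) / (1 + x \<bullet> (H *v x))"
    using *[OF x] sensitivity_eq[OF H x] by (simp add: field_simps power2_eq_square)
qed

text \<open>The two updates of the algorithm also build the inverse, and they preserve the sum. A
  dependent row takes \<open>(t - 1) / t\<close> from the earlier terms and contributes just that;
  an independent row leaves them unchanged and contributes 1.\<close>

lemma exists_pinv_rank: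
  fixes A :: "(real^'d) list"
  shows "\<exists>H. is_pinv A H \<and> (\<Sum>x\<leftarrow>A. x \<bullet> (H *v x)) = row_rank A"
proof (induction A rule: rev_induct)
  case Nil
  show ?case using is_pinv_Nil by (auto simp: row_rank_def)
next
  case (snoc x A)
  then obtain H where H: "is_pinv A H" and rank: "(\<Sum>x\<leftarrow>A. x \<bullet> (H *v x)) = row_rank A" by blast
  show ?case
  proof (cases "x \<in> span (set A)")
    case True
    let ?g = "H *v x"
    define t where "t = 1 + x \<bullet> ?g"
    have t: "t > 0" using pinv_form[OF H True] inner_gram_op_nonneg[of ?g A] by (simp add: t_def)
    define K where "K = result (add_outer (- 1 / t) ?g ?g H)"
    have Kz: "K *v z = H *v z - ((?g \<bullet> z) / t) *\<^sub>R ?g" for z by (simp add: K_def matrix_add_outer)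
    have K: "is_pinv (A @ [x]) K" by (rule is_pinv_snoc_in_span[OF H True]) (simp add: Kz t_def)
    have "(\<Sum>y\<leftarrow>A. y \<bullet> (K *v y)) = (\<Sum>y\<leftarrow>A. y \<bullet> (H *v y)) - (\<Sum>y\<leftarrow>A. (y \<bullet> ?g)\<^sup>2) / t"
      by (simp add: Kz inner_diff_right power2_eq_square inner_commute sum_list_subtractf
          divide_inverse mult.assoc mult.commute[of _ "inverse t"] mult.left_commute[of _ "inverse t"] sum_list_const_mult)
    also have "(\<Sum>y\<leftarrow>A. (y \<bullet> ?g)\<^sup>2) = t - 1"
      by (simp add: inner_gram_op_self[symmetric] pinv_form[OF H True, symmetric] t_def)
    finally have "(\<Sum>y\<leftarrow>A @ [x]. y \<bullet> (K *v y)) = row_rank A - (t - 1) / t + ((t - 1) - (t - 1)\<^sup>2 / t)"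
      using rank by (simp add: Kz inner_diff_right t_def inner_commute[of ?g x] power2_eq_square)
    also have "\<dots> = row_rank A" using t by (simp add: field_simps power2_eq_square)
    finally show ?thesis using K True by (auto simp: row_rank_snoc)
  next
    case False
    let ?g = "H *v x"
    define c where "c = x - H *v gram_op A x"
    have c: "c \<noteq> 0" using False pinv_residual_eq_0_iff[OF H, of x] by (simp add: c_def)
    define k where "k = (1 / (c \<bullet> c)) *\<^sub>R c"
    define K where "K = result (add_outer (1 + x \<bullet> ?g) k k (result (add_outer (- 1) ?g k (result (add_outer (- 1) k ?g H)))))"
    have Kz: "K *v z = H *v z - ((H *v x) \<bullet> z) *\<^sub>R k - (k \<bullet> z) *\<^sub>R (H *v x)
        + ((1 + x \<bullet> (H *v x)) * (k \<bullet> z)) *\<^sub>R k" for z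
      by (simp add: K_def matrix_add_outer)
    note new = is_pinv_snoc_new[OF H c_def c k_def Kz]
    have "y \<bullet> (K *v y) = y \<bullet> (H *v y)" if "y \<in> set A" for y
      using new(2)[OF span_base[OF that]] by (simp add: Kz inner_diff_right inner_commute)
    then have "(\<Sum>y\<leftarrow>A. y \<bullet> (K *v y)) = row_rank A" using rank by (simp cong: map_cong)
    moreover have "x \<bullet> (K *v x) = 1"
      using new(3) by (simp add: new(4) inner_commute)
    ultimately show ?thesis using new(1) False by (auto simp: row_rank_snoc)
  qed
qed

lemma sensitivity_snoc_new:
  assumes x: "x \<notin> span (set A)"
  shows "y \<in> span (set A) \<Longrightarrow> sensitivity (A @ [x]) y = sensitivity A y"
    and "sensitivity (A @ [x]) x = 1"
proof -
  obtain H where H: "is_pinv A H" using exists_pinv_rank[of A] by blast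
  let ?g = "H *v x"
  define c where "c = x - H *v gram_op A x"
  have c: "c \<noteq> 0" using x pinv_residual_eq_0_iff[OF H, of x] by (simp add: c_def)
  define k where "k = (1 / (c \<bullet> c)) *\<^sub>R c"
  define K where "K = result (add_outer (1 + x \<bullet> ?g) k k (result (add_outer (- 1) ?g k (result (add_outer (- 1) k ?g H)))))"
  have Kz: "K *v z = H *v z - ((H *v x) \<bullet> z) *\<^sub>R k - (k \<bullet> z) *\<^sub>R (H *v x)
      + ((1 + x \<bullet> (H *v x)) * (k \<bullet> z)) *\<^sub>R k" for z
    by (simp add: K_def matrix_add_outer)
  note new = is_pinv_snoc_new[OF H c_def c k_def Kz]
  show "sensitivity (A @ [x]) y = sensitivity A y" if y: "y \<in> span (set A)"
  proof -
    have "y \<in> span (set (A @ [x]))" using y span_mono[of "set A" "set (A @ [x])"] by auto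
    then show ?thesis
      using sensitivity_eq[OF new(1)] sensitivity_eq[OF H y] new(2)[OF y]
      by (simp add: Kz inner_diff_right inner_commute)
  qed
  have "x \<in> span (set (A @ [x]))" by (rule span_base) simp
  then show "sensitivity (A @ [x]) x = 1"
    using sensitivity_eq[OF new(1), of x] new(3) by (simp add: new(4) inner_commute)
qed

lemma sum_sensitivity: "(\<Sum>x\<leftarrow>A. sensitivity A x) = row_rank A"
proof -
  obtain H where H: "is_pinv A H" and rank: "(\<Sum>x\<leftarrow>A. x \<bullet> (H *v x)) = row_rank A"
    using exists_pinv_rank[of A] by blast
  have "(\<Sum>x\<leftarrow>A. sensitivity A x) = (\<Sum>x\<leftarrow>A. x \<bullet> (H *v x))"
    by (simp add: sensitivity_eq[OF H] span_base cong: map_cong)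
  then show ?thesis using rank by simp
qed

lemma sensitivity_nonneg:
  assumes "x \<in> set A"
  shows "0 \<le> sensitivity A x"
proof -
  obtain H where H: "is_pinv A H" using exists_pinv_rank[of A] by blast
  show ?thesis
    using sensitivity_eq[OF H span_base[OF assms]] pinv_form[OF H span_base[OF assms]]
      inner_gram_op_nonneg by simp
qed

lemma sensitivity_snoc_le:
  assumes "y \<in> set A"
  shows "sensitivity (A @ [x]) y \<le> sensitivity A y"
proof -
  obtain H where H: "is_pinv A H" using exists_pinv_rank[of A] by blast
  note y = span_base[OF assms]
  show ?thesis
  proof (cases "x \<in> span (set A)")
    case True
    have "0 \<le> x \<bullet> (H *v x)" using pinv_form[OF H True] inner_gram_op_nonneg by simp
    then show ?thesis using sensitivity_snoc_in_span(1)[OF H True y] by simp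
  qed (simp add: sensitivity_snoc_new(1)[OF _ y])
qed

section \<open>The run of the algorithm\<close>

lemma costed_simps [simp]:
  "result (ret x) = x" "cost (ret x) = 0"
  "result (bind_costed p f) = result (f (result p))"
  "cost (bind_costed p f) = cost p + cost (f (result p))"
  "result (scalar k x) = x" "cost (scalar k x) = k"
  by (auto simp: ret_def bind_costed_def scalar_def)

lemma vector_costed_simps [simp]:
  "result (dot x y) = x \<bullet> y" "cost (dot x y) = 1"
  "result (scale c x) = c *\<^sub>R x" "cost (scale c x) = 1"
  "result (axpy c x y) = c *\<^sub>R x + y" "cost (axpy c x y) = 2"
  "result (is_zero x) = (x = 0)" "cost (is_zero x) = 1"
  by (auto simp: dot_def scale_def axpy_def is_zero_def)

lemma each_in_simps [simp]:
  "result (each_in Y h) = (\<lambda>y\<in>Y. result (h y))"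
  "cost (each_in Y h) = (\<Sum>y\<in>Y. cost (h y))"
  by (auto simp: each_in_def)

lemma map_costed_simps:
  "result (map_costed h xs) = map (\<lambda>x. result (h x)) xs"
  "cost (map_costed h xs) = (\<Sum>x\<leftarrow>xs. cost (h x))"
  by (induction xs) auto

lemma filter_costed_simps:
  "result (filter_costed h xs) = filter (\<lambda>x. result (h x)) xs"
  "cost (filter_costed h xs) = (\<Sum>x\<leftarrow>xs. cost (h x))"
  by (induction xs) auto

lemma mat_vec_simps [simp]:
  fixes H :: "real^'d^'d"
  shows "result (mat_vec H x) = H *v x" "cost (mat_vec H x) = CARD('d)"
  by (auto simp: mat_vec_def each_coord_def vec_eq_iff matrix_vector_mul_component)

lemma cost_add_outer [simp]: "cost (add_outer c x y (H :: real^'d^'d)) = 3 * CARD('d)"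
  by (simp add: add_outer_def each_coord_def)

section \<open>Thresholds and membership in the samples\<close>

lemma rows_upto_Suc: "rows_upto a (Suc n) = rows_upto a n @ [a (Suc n)]"
  by (simp add: rows_upto_def)

lemma set_rows_upto: "set (rows_upto a n) = a ` {1..n}"
  by (auto simp: rows_upto_def)

lemma sum_list_rows_upto: "(\<Sum>x\<leftarrow>rows_upto a n. h x) = (\<Sum>i\<in>{1..n}. h (a i))"
  by (simp add: rows_upto_def interv_sum_list_conv_sum_set_nat o_def atLeastLessThanSuc_atLeastAtMost
      del: upt_Suc)

definition keep_prob :: "(nat \<Rightarrow> real^'d) \<Rightarrow> nat \<Rightarrow> nat \<Rightarrow> real" where
  "keep_prob a n i = sensitivity (rows_upto a n) (a i)
     / (sensitivity (rows_upto a n) (a i) + row_rank (rows_upto a n))"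

lemma row_rank_mono: "row_rank (rows_upto a n) \<le> row_rank (rows_upto a (Suc n))"
  by (simp add: rows_upto_Suc row_rank_snoc)

lemma keep_prob_Suc_le:
  assumes "i \<in> {1..n}"
  shows "keep_prob a (Suc n) i \<le> keep_prob a n i"
proof -
  have mem: "a i \<in> set (rows_upto a n)" "a i \<in> set (rows_upto a (Suc n))"
    using assms by (auto simp: set_rows_upto)
  let ?s = "sensitivity (rows_upto a n) (a i)" and ?s' = "sensitivity (rows_upto a (Suc n)) (a i)"
  let ?r = "real (row_rank (rows_upto a n))" and ?r' = "real (row_rank (rows_upto a (Suc n)))"
  have s: "0 \<le> ?s'" "?s' \<le> ?s" "0 \<le> ?r" "?r \<le> ?r'"
    using sensitivity_nonneg[OF mem(2)] sensitivity_snoc_le[OF mem(1)] row_rank_mono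
    by (auto simp: rows_upto_Suc)
  show ?thesis
  \<comment> \<open>A vanishing new sensitivity gives the quotient 0, even for \<open>0 / 0\<close>;
    otherwise both denominators are positive.\<close>
  proof (cases "?s' = 0")
    case True
    then show ?thesis using s by (auto simp: keep_prob_def)
  next
    case False
    then have pos: "0 < ?s' + ?r'" "0 < ?s + ?r" using s by auto
    have "?s' * ?r \<le> ?s * ?r'" using s by (intro mult_mono) auto
    then show ?thesis unfolding keep_prob_def using pos by (simp add: field_simps)
  qed
qed

lemma keep_prob_bounds:
  assumes "i \<in> {1..n}"
  shows "0 \<le> keep_prob a n i" "keep_prob a n i \<le> 1"
proof -
  have s: "0 \<le> sensitivity (rows_upto a n) (a i)"
    using assms by (intro sensitivity_nonneg) (auto simp: set_rows_upto)
  then show "0 \<le> keep_prob a n i" "keep_prob a n i \<le> 1"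
    by (auto simp: keep_prob_def divide_le_eq)
qed

text \<open>Each term is at most \<open>?s i / ?r\<close>, and these sum to 1. This controls the
  expected size of a single set.\<close>

lemma sum_keep_prob_le: "(\<Sum>i\<in>{1..n}. keep_prob a n i) \<le> 1"
proof -
  let ?s = "\<lambda>i. sensitivity (rows_upto a n) (a i)" and ?r = "real (row_rank (rows_upto a n))"
  have s: "0 \<le> ?s i" if "i \<in> {1..n}" for i
    using that by (intro sensitivity_nonneg) (auto simp: set_rows_upto)
  have sum: "(\<Sum>i\<in>{1..n}. ?s i) = ?r"
    using sum_sensitivity[of "rows_upto a n"] by (simp add: sum_list_rows_upto)
  show ?thesis
  proof (cases "?r = 0")
    case True
    then have "?s i = 0" if "i \<in> {1..n}" for i
      using that s sum sum_nonneg_eq_0_iff[of "{1..n}" ?s] by auto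
    then show ?thesis by (simp add: keep_prob_def)
  next
    case False
    have "(\<Sum>i\<in>{1..n}. keep_prob a n i) \<le> (\<Sum>i\<in>{1..n}. ?s i / ?r)"
      unfolding keep_prob_def using s False by (intro sum_mono divide_left_mono mult_pos_pos add_nonneg_pos) auto
    also have "\<dots> = 1" using sum False by (simp flip: sum_divide_distrib)
    finally show ?thesis .
  qed
qed

lemma sampled_eq: "sampled a u n y = {i\<in>{1..n}. u (y, i) \<le> keep_prob a n i}"
proof (induction n)
  case (Suc n)
  have "sampled a u (Suc n) y = {i \<in> insert (Suc n) (sampled a u n y). u (y, i) \<le> keep_prob a (Suc n) i}"
    by (simp add: Let_def keep_prob_def not_less)
  also have "\<dots> = {i\<in>{1..Suc n}. u (y, i) \<le> keep_prob a (Suc n) i}"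
    unfolding Suc using keep_prob_Suc_le[of _ n a] by (fastforce intro: order_trans)
  finally show ?case .
qed simp

lemma sampled_subset: "sampled a u n y \<subseteq> {1..n}"
  by (auto simp: sampled_eq)

text \<open>Newest row first, the order in which \<open>arrive\<close> builds the bags.\<close>

definition sampled_list :: "(nat \<Rightarrow> real^'d) \<Rightarrow> (nat \<times> nat \<Rightarrow> real) \<Rightarrow> nat \<Rightarrow> nat \<Rightarrow> nat list" where
  "sampled_list a u n y = filter (\<lambda>i. i \<in> sampled a u n y) (rev [1..<Suc n])"

lemma set_sampled_list: "set (sampled_list a u n y) = sampled a u n y"
  using sampled_subset[of a u n y] by (auto simp: sampled_list_def)

lemma sampled_list_subset: "set (sampled_list a u n y) \<subseteq> {1..n}"
  by (simp only: set_sampled_list sampled_subset)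

lemma length_sampled_list: "length (sampled_list a u n y) = card (sampled a u n y)"
  using distinct_card[of "sampled_list a u n y"] by (simp add: set_sampled_list) (simp add: sampled_list_def)

lemma sampled_list_Suc:
  "sampled_list a u (Suc n) y = filter (\<lambda>i. u (y, i) \<le> keep_prob a (Suc n) i) (Suc n # sampled_list a u n y)"
proof -
  have *: "i \<in> sampled a u (Suc n) y \<longleftrightarrow>
      i \<in> insert (Suc n) (sampled a u n y) \<and> u (y, i) \<le> keep_prob a (Suc n) i" for i
    by (simp add: Let_def keep_prob_def not_less)
  have "filter (\<lambda>i. i \<in> sampled a u (Suc n) y) (rev [1..<Suc n])
      = filter (\<lambda>i. i \<in> sampled a u n y \<and> u (y, i) \<le> keep_prob a (Suc n) i) (rev [1..<Suc n])"
    unfolding * by (intro filter_cong) auto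
  then show ?thesis unfolding sampled_list_def using *[of "Suc n"] by (simp add: conj_commute)
qed

definition item_at :: "(nat \<Rightarrow> real^'d) \<Rightarrow> (nat \<times> nat \<Rightarrow> real) \<Rightarrow> nat \<Rightarrow> nat \<Rightarrow> nat \<Rightarrow> 'd item" where
  "item_at a u n y i = Item (a i) (u (y, i)) (sensitivity (rows_upto a n) (a i))"

text \<open>The lists \<open>L\<close> are a parameter, so that the same invariant describes the
  state between arrival and deletion, when the bags hold more than the sample.\<close>

definition tracks :: "nat \<Rightarrow> (nat \<Rightarrow> real^'d) \<Rightarrow> (nat \<times> nat \<Rightarrow> real) \<Rightarrow> nat \<Rightarrow> (nat \<Rightarrow> nat list) \<Rightarrow> 'd state \<Rightarrow> bool" where
  "tracks m a u n L st \<longleftrightarrow> (\<forall>x. gram st *v x = gram_op (rows_upto a n) x)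
     \<and> is_pinv (rows_upto a n) (pinv st) \<and> rk st = row_rank (rows_upto a n)
     \<and> (\<forall>y\<in>{1..8 * m}. bag st y = map (item_at a u n y) (L y))"

text \<open>Either case spends \<open>6 * CARD('d) + 5\<close> on the three matrix products, the
  Gram update and the test for zero. A dependent row adds one outer product and 4 operations per
  stored row; an independent one adds three outer products and leaves the stored sensitivities
  alone.\<close>

lemma tracks_arrive:
  fixes a :: "nat \<Rightarrow> real^'d"
  assumes st: "tracks m a u n L st" and L: "\<And>y. set (L y) \<subseteq> {1..n}"
  shows "tracks m a u (Suc n) (\<lambda>y. Suc n # L y) (result (arrive m (\<lambda>y. u (y, Suc n)) (a (Suc n)) st))"
    and "cost (arrive m (\<lambda>y. u (y, Suc n)) (a (Suc n)) st) =
      (if a (Suc n) \<in> span (set (rows_upto a n))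
       then 9 * CARD('d) + 8 + 16 * m + 4 * (\<Sum>y\<in>{1..8 * m}. length (L y))
       else 15 * CARD('d) + 9 + 16 * m)"
proof -
  let ?A = "rows_upto a n" and ?x = "a (Suc n)"
  have G: "\<And>z. gram st *v z = gram_op ?A z" and H: "is_pinv ?A (pinv st)"
    and rk: "rk st = row_rank ?A" and bag: "\<And>y. y \<in> {1..8 * m} \<Longrightarrow> bag st y = map (item_at a u n y) (L y)"
    using st by (auto simp: tracks_def)
  let ?g = "pinv st *v ?x" and ?c = "?x - pinv st *v gram_op ?A ?x"
  let ?t = "1 + ?x \<bullet> ?g"
  let ?st' = "result (arrive m (\<lambda>y. u (y, Suc n)) ?x st)"
  have zero: "?c = 0 \<longleftrightarrow> ?x \<in> span (set ?A)" by (rule pinv_residual_eq_0_iff[OF H])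
  have mem: "a i \<in> span (set ?A)" if "i \<in> set (L y)" for i y
    using that L[of y] by (intro span_base) (auto simp: set_rows_upto)
  have gram': "gram_op ?A z + (?x \<bullet> z) *\<^sub>R ?x = gram_op (rows_upto a (Suc n)) z" for z
    by (simp add: rows_upto_Suc gram_op_snoc)
  show "tracks m a u (Suc n) (\<lambda>y. Suc n # L y) ?st'"
  proof (cases "?x \<in> span (set ?A)")
    case True
    have st': "?st' = \<lparr>gram = result (add_outer 1 ?x ?x (gram st)),
        pinv = result (add_outer (- 1 / ?t) ?g ?g (pinv st)), rk = rk st,
        bag = (\<lambda>y\<in>{1..8 * m}. Item ?x (u (y, Suc n)) ((?x \<bullet> ?g) / ?t)
          # map (\<lambda>it. Item (row it) (rnd it) (sens it - (row it \<bullet> ?g)\<^sup>2 / ?t)) (bag st y))\<rparr>"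
      using True zero by (simp add: arrive_def G map_costed_simps)
    have "is_pinv (rows_upto a (Suc n)) (pinv ?st')"
      unfolding rows_upto_Suc by (rule is_pinv_snoc_in_span[OF H True]) (simp add: st' matrix_add_outer)
    moreover have "gram ?st' *v z = gram_op (rows_upto a (Suc n)) z" for z
      by (simp add: st' matrix_add_outer G gram')
    moreover have "rk ?st' = row_rank (rows_upto a (Suc n))"
      using True by (simp add: st' rk rows_upto_Suc row_rank_snoc)
    moreover have "bag ?st' y = map (item_at a u (Suc n) y) (Suc n # L y)" if "y \<in> {1..8 * m}" for y
      using that bag[OF that] mem sensitivity_snoc_in_span[OF H True]
      by (auto simp: st' item_at_def rows_upto_Suc)
    ultimately show ?thesis unfolding tracks_def by blast
  next
    case False
    define k where "k = (1 / (?c \<bullet> ?c)) *\<^sub>R ?c"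
    have st': "?st' = \<lparr>gram = result (add_outer 1 ?x ?x (gram st)),
        pinv = result (add_outer ?t k k (result (add_outer (- 1) ?g k (result (add_outer (- 1) k ?g (pinv st)))))),
        rk = rk st + 1, bag = (\<lambda>y\<in>{1..8 * m}. Item ?x (u (y, Suc n)) 1 # bag st y)\<rparr>"
      using False zero by (simp add: arrive_def G k_def)
    have "is_pinv (rows_upto a (Suc n)) (pinv ?st')"
      unfolding rows_upto_Suc
    proof (rule is_pinv_snoc_new(1)[OF H refl _ k_def])
      show "?c \<noteq> 0" using False zero by simp
    qed (simp add: st' matrix_add_outer)
    moreover have "gram ?st' *v z = gram_op (rows_upto a (Suc n)) z" for z
      by (simp add: st' matrix_add_outer G gram')
    moreover have "rk ?st' = row_rank (rows_upto a (Suc n))"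
      using False by (simp add: st' rk rows_upto_Suc row_rank_snoc)
    moreover have "bag ?st' y = map (item_at a u (Suc n) y) (Suc n # L y)" if "y \<in> {1..8 * m}" for y
      using that bag[OF that] mem sensitivity_snoc_new[OF False]
      by (auto simp: st' item_at_def rows_upto_Suc)
    ultimately show ?thesis unfolding tracks_def by blast
  qed
  show "cost (arrive m (\<lambda>y. u (y, Suc n)) ?x st) = (if ?x \<in> span (set ?A)
       then 9 * CARD('d) + 8 + 16 * m + 4 * (\<Sum>y\<in>{1..8 * m}. length (L y))
       else 15 * CARD('d) + 9 + 16 * m)"
  proof (cases "?x \<in> span (set ?A)")
    case True
    then show ?thesis
      using zero by (simp add: arrive_def G map_costed_simps sum_list_triv bag sum_Suc sum_distrib_left mult.commute)
  next
    case False
    then show ?thesis using zero by (simp add: arrive_def G)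
  qed
qed

lemma tracks_prune:
  fixes a :: "nat \<Rightarrow> real^'d"
  assumes st: "tracks m a u n L st"
  shows "tracks m a u n (\<lambda>y. filter (\<lambda>i. u (y, i) \<le> keep_prob a n i) (L y)) (result (prune m st))"
    and "cost (prune m st) = 3 * (\<Sum>y\<in>{1..8 * m}. length (L y))"
  using st by (auto simp: tracks_def prune_def filter_costed_simps sum_list_triv sum_distrib_left
      item_at_def keep_prob_def filter_map o_def not_less mult.commute)

lemma tracks_update:
  fixes a :: "nat \<Rightarrow> real^'d"
  assumes st: "tracks m a u n (sampled_list a u n) st"
  shows "tracks m a u (Suc n) (sampled_list a u (Suc n))
      (fst (result (update m (\<lambda>y. u (y, Suc n)) (a (Suc n)) st)))"
proof -
  have "tracks m a u (Suc n) (\<lambda>y. Suc n # sampled_list a u n y)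
      (result (arrive m (\<lambda>y. u (y, Suc n)) (a (Suc n)) st))"
    by (intro tracks_arrive(1) st sampled_list_subset)
  from tracks_prune(1)[OF this] show ?thesis by (simp add: update_def sampled_list_Suc[abs_def])
qed

lemma tracks_run: "tracks m a u n (sampled_list a u n) (run m a u n)"
proof (induction n)
  case 0
  show ?case
    using is_pinv_Nil by (auto simp: tracks_def init_state_def rows_upto_def gram_op_def row_rank_def sampled_list_def)
next
  case (Suc n)
  then show ?case using tracks_update by simp
qed

text \<open>Indexes the output by the sets and not by the rows, since several sets may report the
  same row.\<close>

lemma weighted_sample_eq:
  "weighted_sample m a u n = image_mset (\<lambda>y. (a (the_elem (sampled a u n y)),
      real (row_rank (rows_upto a n)) / (real (card (singles m a u n))
        * sensitivity (rows_upto a n) (a (the_elem (sampled a u n y)))))) (mset_set (singles m a u n))"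
proof -
  define q where "q = (\<lambda>y. a (the_elem (sampled a u n y)))"
  have fin: "finite (singles m a u n)" by (simp add: singles_def)
  have one: "image_mset a (mset_set (sampled a u n y)) = {#q y#}" if "y \<in> singles m a u n" for y
    using that by (auto simp: singles_def q_def card_1_singleton_iff)
  have "sample m a u n = (\<Sum>y\<in>singles m a u n. {#q y#})"
    unfolding sample_def by (rule sum.cong) (auto simp: one)
  also have "\<dots> = image_mset q (mset_set (singles m a u n))"
    using fin by (induction "singles m a u n" rule: finite_induct) (simp_all add: sum_unfold_sum_mset image_mset.compositionality)
  finally have sample: "sample m a u n = image_mset q (mset_set (singles m a u n))" .
  then have size: "size (sample m a u n) = card (singles m a u n)" by simp
  show ?thesis
    unfolding weighted_sample_def Let_def size
    by (simp add: sample image_mset.compositionality o_def q_def)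
qed

lemma report_sampled:
  fixes a :: "nat \<Rightarrow> real^'d"
  assumes st: "tracks m a u n (sampled_list a u n) st"
  shows "result (report m st) = weighted_sample m a u n"
    and "cost (report m st) = 16 * m + 2 * card (singles m a u n)"
    and "size (weighted_sample m a u n) = card (singles m a u n)"
proof -
  let ?A = "rows_upto a n"
  have rk: "rk st = row_rank ?A"
    and bag: "\<And>y. y \<in> {1..8 * m} \<Longrightarrow> bag st y = map (item_at a u n y) (sampled_list a u n y)"
    using st by (auto simp: tracks_def)
  have flag: "{y\<in>{1..8 * m}. (\<lambda>y\<in>{1..8 * m}. length (bag st y) = 1) y} = singles m a u n"
    by (auto simp: singles_def bag length_sampled_list)
  have fin: "finite (singles m a u n)" by (simp add: singles_def)
  define q where "q = (\<lambda>y. a (the_elem (sampled a u n y)))"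
  have one: "sampled_list a u n y = [the_elem (sampled a u n y)]" if y: "y \<in> singles m a u n" for y
  proof -
    obtain i where i: "sampled a u n y = {i}" using y by (auto simp: singles_def card_1_singleton_iff)
    moreover have "length (sampled_list a u n y) = 1" using i by (simp add: length_sampled_list)
    then obtain j where "sampled_list a u n y = [j]" by (metis One_nat_def length_0_conv length_Suc_conv)
    ultimately show ?thesis using set_sampled_list[of a u n y] by simp
  qed
  have W: "weighted_sample m a u n = image_mset (\<lambda>y. (q y, real (row_rank ?A)
      / (real (card (singles m a u n)) * sensitivity ?A (q y)))) (mset_set (singles m a u n))"
    unfolding q_def by (rule weighted_sample_eq)
  then show "size (weighted_sample m a u n) = card (singles m a u n)" by simp
  have "result (report m st) = image_mset (\<lambda>y\<in>singles m a u n. result (let it = hd (bag st y) in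
      scalar 2 (row it, real (rk st) / (real (card (singles m a u n)) * sens it)))) (mset_set (singles m a u n))"
    using flag by (simp add: report_def)
  also have "\<dots> = weighted_sample m a u n"
    unfolding W
  proof (intro image_mset_cong)
    fix y assume "y \<in># mset_set (singles m a u n)"
    then have y: "y \<in> singles m a u n" using fin by simp
    then have "bag st y = [item_at a u n y (the_elem (sampled a u n y))]"
      using bag[of y] y one[OF y] by (simp add: singles_def)
    then show "(\<lambda>y\<in>singles m a u n. result (let it = hd (bag st y) in
      scalar 2 (row it, real (rk st) / (real (card (singles m a u n)) * sens it)))) y
      = (q y, real (row_rank ?A) / (real (card (singles m a u n)) * sensitivity ?A (q y)))"
      using y by (simp add: Let_def item_at_def rk q_def)
  qed
  finally show "result (report m st) = weighted_sample m a u n" .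
  show "cost (report m st) = 16 * m + 2 * card (singles m a u n)"
    using flag by (simp add: report_def Let_def)
qed

definition stored :: "nat \<Rightarrow> (nat \<Rightarrow> real^'d) \<Rightarrow> (nat \<times> nat \<Rightarrow> real) \<Rightarrow> nat \<Rightarrow> nat" where
  "stored m a u n = (\<Sum>y\<in>{1..8 * m}. card (sampled a u n y))"

lemma output_at_Suc: "output_at m a u (Suc n) = weighted_sample m a u (Suc n)"
proof -
  have "tracks m a u (Suc n) (\<lambda>y. Suc n # sampled_list a u n y)
      (result (arrive m (\<lambda>y. u (y, Suc n)) (a (Suc n)) (run m a u n)))"
    by (intro tracks_arrive(1) tracks_run sampled_list_subset)
  from report_sampled(1)[OF tracks_prune(1)[OF this, folded sampled_list_Suc]]
  show ?thesis by (simp add: output_at_def update_def)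
qed

text \<open>Of \<open>56 * m\<close>, the arrival contributes 16, the tests of the new row in
  \<open>8 * m\<close> sets 24, and the report 16. A stored row costs 3 for its test, and 4 more if
  its sensitivity is recomputed.\<close>

lemma time_at_Suc:
  fixes a :: "nat \<Rightarrow> real^'d"
  shows "time_at m a u (Suc n) = 2 * card (singles m a u (Suc n)) +
    (if a (Suc n) \<in> span (set (rows_upto a n)) then 9 * CARD('d) + 8 + 56 * m + 7 * stored m a u n
     else 15 * CARD('d) + 9 + 56 * m + 3 * stored m a u n)"
proof -
  note arr = tracks_arrive[OF tracks_run[of m a u n] sampled_list_subset]
  note pr = tracks_prune[OF arr(1), folded sampled_list_Suc]
  note rep = report_sampled(2)[OF pr(1)]
  have "time_at m a u (Suc n) = cost (arrive m (\<lambda>y. u (y, Suc n)) (a (Suc n)) (run m a u n))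
      + 3 * (\<Sum>y\<in>{1..8 * m}. length (Suc n # sampled_list a u n y)) + (16 * m + 2 * card (singles m a u (Suc n)))"
    using pr(2) rep by (simp add: time_at_def update_def)
  then show ?thesis
    unfolding arr(2) by (simp add: length_sampled_list stored_def sum.distrib Suc_eq_plus1 del: One_nat_def)
qed

lemma space_at_Suc:
  fixes a :: "nat \<Rightarrow> real^'d"
  shows "space_at m a u (Suc n) = 3 * stored m a u n + 24 * m + 4 * CARD('d) + 2 * card (singles m a u (Suc n)) + 10"
proof -
  note arr = tracks_arrive[OF tracks_run[of m a u n] sampled_list_subset]
  let ?st = "result (arrive m (\<lambda>y. u (y, Suc n)) (a (Suc n)) (run m a u n))"
  have "(\<Sum>y\<in>{1..8 * m}. 3 * length (bag ?st y)) = (\<Sum>y\<in>{1..8 * m}. 3 * card (sampled a u n y) + 3)"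
    using arr(1) by (intro sum.cong) (auto simp: tracks_def length_sampled_list)
  also have "\<dots> = 3 * stored m a u n + 24 * m"
    by (simp add: stored_def sum.distrib sum_distrib_left)
  finally show ?thesis
    using report_sampled(3)[OF tracks_run] by (simp add: space_at_def Let_def output_at_Suc)
qed

section \<open>The distribution of the samples\<close>

abbreviation uniform_draw :: "real measure" where
  "uniform_draw \<equiv> uniform_measure lborel {0..<1}"

lemma uniform_draw_le:
  assumes "0 \<le> p" "p \<le> 1"
  shows "measure uniform_draw {..p} = p"
proof -
  \<comment> \<open>At \<open>p = 1\<close> the half-open range of the draws is the whole
    intersection.\<close>
  have "{0..<1} \<inter> {..p} = (if p < 1 then {0..p} else {0..<1})" using assms by auto
  then show ?thesis using assms by (subst measure_uniform_measure) auto
qed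

lemma uniform_draw_gt:
  assumes "0 \<le> p" "p \<le> 1"
  shows "measure uniform_draw {p<..} = 1 - p"
proof -
  have "{0..<1} \<inter> {p<..} = {p<..<1}" using assms by auto
  then show ?thesis using assms by (subst measure_uniform_measure) auto
qed

lemma prob_space_uniform_draw: "prob_space uniform_draw"
  by (rule prob_space_uniform_measure) auto

interpretation draws_space: product_prob_space "\<lambda>_ :: nat \<times> nat. uniform_draw" UNIV
  by (intro product_prob_spaceI prob_space_uniform_draw)

lemma prob_space_draws: "prob_space draws"
  unfolding draws_def by (intro prob_space_PiM prob_space_uniform_draw)

lemma measure_draws_Collect:
  assumes "finite J" "\<And>j. j \<in> J \<Longrightarrow> B j \<in> sets borel"
  shows "{u\<in>space draws. \<forall>j\<in>J. u j \<in> B j} \<in> sets draws"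
    and "measure draws {u\<in>space draws. \<forall>j\<in>J. u j \<in> B j} = (\<Prod>j\<in>J. measure uniform_draw (B j))"
proof -
  have B: "B j \<in> sets uniform_draw" if "j \<in> J" for j using assms(2)[OF that] by simp
  have emb: "{u\<in>space draws. \<forall>j\<in>J. u j \<in> B j}
      = prod_emb UNIV (\<lambda>_. uniform_draw) J (Pi\<^sub>E J B)"
    unfolding prod_emb_def draws_def by (auto simp: space_PiM Pi_iff)
  show "{u\<in>space draws. \<forall>j\<in>J. u j \<in> B j} \<in> sets draws"
    unfolding emb unfolding draws_def using assms(1) B by (intro sets_PiM_I) auto
  show "measure draws {u\<in>space draws. \<forall>j\<in>J. u j \<in> B j} = (\<Prod>j\<in>J. measure uniform_draw (B j))"
    unfolding emb unfolding draws_def by (rule draws_space.measure_PiM_emb) (use assms(1) B in auto)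
qed

text \<open>Restriction to the index range leaves finitely many values, so events about the samples
  are finite unions of atoms, and their probabilities are finite sums.\<close>

definition samples :: "nat \<Rightarrow> (nat \<Rightarrow> real^'d) \<Rightarrow> nat \<Rightarrow> (nat \<times> nat \<Rightarrow> real) \<Rightarrow> nat \<Rightarrow> nat set" where
  "samples m a n u = (\<lambda>y\<in>{1..8 * m}. sampled a u n y)"

definition subset_prob :: "(nat \<Rightarrow> real^'d) \<Rightarrow> nat \<Rightarrow> nat set \<Rightarrow> real" where
  "subset_prob a n S = (\<Prod>i\<in>{1..n}. if i \<in> S then keep_prob a n i else 1 - keep_prob a n i)"

abbreviation outcomes :: "nat \<Rightarrow> nat \<Rightarrow> (nat \<Rightarrow> nat set) set" where
  "outcomes m n \<equiv> PiE {1..8 * m} (\<lambda>_. Pow {1..n})"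

lemma finite_outcome_space: "finite (outcomes m n)"
  by (intro finite_PiE) auto

lemma samples_outcome: "samples m a n u \<in> outcomes m n"
  unfolding samples_def restrict_PiE_iff using sampled_subset by blast

lemma subset_prob_nonneg: "0 \<le> subset_prob a n S"
  unfolding subset_prob_def using keep_prob_bounds[of _ n a] by (intro prod_nonneg) auto

lemma sum_Pow_prod:
  fixes \<alpha> \<beta> :: "'a \<Rightarrow> real"
  assumes "finite A"
  shows "(\<Sum>S\<in>Pow A. \<Prod>i\<in>A. if i \<in> S then \<alpha> i else \<beta> i) = (\<Prod>i\<in>A. \<alpha> i + \<beta> i)"
proof -
  have "(\<Prod>i\<in>A. if i \<in> S then \<alpha> i else \<beta> i) = prod \<alpha> S * prod \<beta> (A - S)" if "S \<subseteq> A" for S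
  proof -
    have "A \<inter> {i. i \<in> S} = S" "A \<inter> - {i. i \<in> S} = A - S" using that by auto
    then show ?thesis using prod.If_cases[OF assms, of "\<lambda>i. i \<in> S" \<alpha> \<beta>] by simp
  qed
  then show ?thesis unfolding prod_add[OF assms] by (intro sum.cong) auto
qed

lemma sum_subset_prob: "(\<Sum>S\<in>Pow {1..n}. subset_prob a n S) = 1"
  unfolding subset_prob_def by (subst sum_Pow_prod) auto

lemma samples_atom:
  assumes g: "g \<in> outcomes m n"
  shows "{u\<in>space draws. samples m a n u = g} \<in> sets draws"
    and "measure draws {u\<in>space draws. samples m a n u = g} = (\<Prod>y\<in>{1..8 * m}. subset_prob a n (g y))"
proof -
  \<comment> \<open>Each atom is a box: every draw is compared with its own threshold, so
    independence makes the measure a product.\<close>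
  define B where "B = (\<lambda>(y, i). if i \<in> g y then {..keep_prob a n i} else {keep_prob a n i<..})"
  let ?J = "{1..8 * m} \<times> {1..n}"
  have gsub: "g y \<subseteq> {1..n}" if "y \<in> {1..8 * m}" for y using g that by (auto dest: PiE_mem)
  have iff: "samples m a n u = g \<longleftrightarrow> (\<forall>j\<in>?J. u j \<in> B j)" for u
  proof -
    have "samples m a n u = g \<longleftrightarrow> (\<forall>y\<in>{1..8 * m}. sampled a u n y = g y)"
      unfolding samples_def using g by (auto simp: fun_eq_iff PiE_iff extensional_def restrict_def)
    also have "\<dots> \<longleftrightarrow> (\<forall>y\<in>{1..8 * m}. \<forall>i\<in>{1..n}. u (y, i) \<in> B (y, i))"
    proof (intro ball_cong refl)
      fix y assume "y \<in> {1..8 * m}"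
      then have "sampled a u n y = g y \<longleftrightarrow> (\<forall>i\<in>{1..n}. u (y, i) \<le> keep_prob a n i \<longleftrightarrow> i \<in> g y)"
        using gsub[of y] unfolding sampled_eq by blast
      then show "sampled a u n y = g y \<longleftrightarrow> (\<forall>i\<in>{1..n}. u (y, i) \<in> B (y, i))"
        by (auto simp: B_def not_le[symmetric])
    qed
    finally show ?thesis by auto
  qed
  have B: "B j \<in> sets borel" for j by (auto simp: B_def split: prod.split)
  note C = measure_draws_Collect[of ?J B, OF _ B]
  show "{u\<in>space draws. samples m a n u = g} \<in> sets draws" unfolding iff using C(1) by simp
  have "measure draws {u\<in>space draws. samples m a n u = g} = (\<Prod>j\<in>?J. measure uniform_draw (B j))"
    unfolding iff using C(2) by simp
  also have "\<dots> = (\<Prod>y\<in>{1..8 * m}. \<Prod>i\<in>{1..n}. measure uniform_draw (B (y, i)))"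
    by (simp add: prod.cartesian_product)
  also have "\<dots> = (\<Prod>y\<in>{1..8 * m}. subset_prob a n (g y))"
    unfolding subset_prob_def B_def
    by (intro prod.cong refl) (simp add: uniform_draw_le uniform_draw_gt keep_prob_bounds del: measure_uniform_measure)
  finally show "measure draws {u\<in>space draws. samples m a n u = g} = (\<Prod>y\<in>{1..8 * m}. subset_prob a n (g y))" .
qed

lemma samples_event:
  shows "{u\<in>space draws. P (samples m a n u)} \<in> sets draws"
    and "measure draws {u\<in>space draws. P (samples m a n u)}
      = (\<Sum>g\<in>{g\<in>outcomes m n. P g}. \<Prod>y\<in>{1..8 * m}. subset_prob a n (g y))"
proof -
  interpret prob_space draws by (rule prob_space_draws)
  let ?S = "{g\<in>outcomes m n. P g}"
  have eq: "{u\<in>space draws. P (samples m a n u)} = (\<Union>g\<in>?S. {u\<in>space draws. samples m a n u = g})"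
    using samples_outcome[of m a n] by auto
  have fin: "finite ?S" using finite_outcome_space by simp
  show "{u\<in>space draws. P (samples m a n u)} \<in> sets draws"
    unfolding eq using fin samples_atom(1) by (intro sets.finite_UN) auto
  have "measure draws (\<Union>g\<in>?S. {u\<in>space draws. samples m a n u = g})
      = (\<Sum>g\<in>?S. measure draws {u\<in>space draws. samples m a n u = g})"
    using fin samples_atom(1)
    by (intro finite_measure_finite_Union) (auto simp: disjoint_family_on_def)
  then show "measure draws {u\<in>space draws. P (samples m a n u)}
      = (\<Sum>g\<in>{g\<in>outcomes m n. P g}. \<Prod>y\<in>{1..8 * m}. subset_prob a n (g y))"
    unfolding eq by (simp add: samples_atom(2))
qed

text \<open>The cost of an update involves the sets before the arrival and those after the
  deletions; this makes such joint events measurable.\<close>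

lemma samples_event2: "{u\<in>space draws. P (samples m a n u) (samples m a k u)} \<in> sets draws"
proof -
  have "{u\<in>space draws. P (samples m a n u) (samples m a k u)}
    = (\<Union>g\<in>outcomes m n. {u\<in>space draws. samples m a n u = g} \<inter> {u\<in>space draws. P g (samples m a k u)})"
    using samples_outcome[of m a n] by auto
  also have "\<dots> \<in> sets draws"
    using finite_outcome_space samples_atom(1) samples_event(1) by (intro sets.finite_UN sets.Int) auto
  finally show ?thesis .
qed

lemma stored_samples: "stored m a u n = (\<Sum>y\<in>{1..8 * m}. card (samples m a n u y))"
  by (simp add: stored_def samples_def)

lemma singles_samples: "singles m a u n = {y\<in>{1..8 * m}. card (samples m a n u y) = 1}"
  by (auto simp: singles_def samples_def)

text \<open>Linearity of expectation over the pairs \<open>(y, i)\<close>; each set contributes at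
  most 1 by \<open>sum_keep_prob_le\<close>.\<close>

lemma expected_stored_le: "(\<integral>\<^sup>+u. ennreal (real (stored m a u n)) \<partial>draws) \<le> ennreal (8 * m)"
proof -
  interpret prob_space draws by (rule prob_space_draws)
  define E where "E = (\<lambda>(y, i). {u\<in>space draws. \<forall>j\<in>{(y, i)}. u j \<in> {..keep_prob a n i}})"
  let ?J = "{1..8 * m} \<times> {1..n}"
  have E: "E j \<in> sets draws" for j
    using measure_draws_Collect(1)[of "{j}" "\<lambda>_. {..keep_prob a n (snd j)}"] by (simp add: E_def split_beta)
  have pr: "emeasure draws (E (y, i)) = ennreal (keep_prob a n i)" if "i \<in> {1..n}" for y i
    using measure_draws_Collect(2)[of "{(y, i)}" "\<lambda>_. {..keep_prob a n i}"] that
    by (simp add: E_def emeasure_eq_measure uniform_draw_le keep_prob_bounds del: measure_uniform_measure)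
  have "ennreal (real (stored m a u n)) = (\<Sum>j\<in>?J. indicator (E j) u)" if u: "u \<in> space draws" for u
  proof -
    have "card (sampled a u n y) = (\<Sum>i\<in>{1..n}. if u (y, i) \<le> keep_prob a n i then 1 else 0)" for y
      unfolding sampled_eq by (subst sum.If_cases) (auto intro: arg_cong[of _ _ card])
    then have "stored m a u n = (\<Sum>j\<in>?J. if u j \<le> keep_prob a n (snd j) then 1 else 0)"
      unfolding stored_def by (simp add: sum.cartesian_product split_beta)
    then have "ennreal (real (stored m a u n)) = (\<Sum>j\<in>?J. of_nat (if u j \<le> keep_prob a n (snd j) then 1 else 0))"
      unfolding ennreal_of_nat_eq_real_of_nat[symmetric] by (simp only: of_nat_sum)
    also have "\<dots> = (\<Sum>j\<in>?J. indicator (E j) u)"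
      using u by (intro sum.cong) (auto simp: E_def)
    finally show ?thesis .
  qed
  then have "(\<integral>\<^sup>+u. ennreal (real (stored m a u n)) \<partial>draws) = (\<integral>\<^sup>+u. (\<Sum>j\<in>?J. indicator (E j) u) \<partial>draws)"
    by (intro nn_integral_cong) auto
  also have "\<dots> = (\<Sum>j\<in>?J. emeasure draws (E j))"
    using E by (subst nn_integral_sum) auto
  also have "\<dots> = (\<Sum>y\<in>{1..8 * m}. \<Sum>i\<in>{1..n}. emeasure draws (E (y, i)))"
    by (simp add: sum.cartesian_product)
  also have "\<dots> = (\<Sum>y\<in>{1..8 * m}. \<Sum>i\<in>{1..n}. ennreal (keep_prob a n i))"
    by (intro sum.cong refl) (rule pr)
  also have "\<dots> = of_nat (8 * m) * ennreal (\<Sum>i\<in>{1..n}. keep_prob a n i)"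
    by (subst sum_ennreal) (auto simp: keep_prob_bounds)
  also have "\<dots> \<le> of_nat (8 * m) * ennreal 1"
    by (intro mult_left_mono ennreal_leI sum_keep_prob_le) auto
  also have "\<dots> = ennreal (8 * m)" by (simp add: ennreal_of_nat_eq_real_of_nat)
  finally show ?thesis .
qed

text \<open>Chernoff bound with parameter 1. From
  \<open>p * e + 1 - p \<le> 1 + 2 * p \<le> exp (2 * p)\<close> each set has exponential moment at
  most \<open>exp 2\<close>, so \<open>8 * m\<close> sets give 16, and 16 - 100 = -84.\<close>

lemma stored_tail: "measure draws {u\<in>space draws. 100 * m < stored m a u n} \<le> exp (- (84 * real m))"
proof -
  let ?Y = "{1..8 * m}" and ?p = "keep_prob a n"
  let ?w = "\<lambda>g. \<Prod>y\<in>?Y. subset_prob a n (g y)"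
  define T where "T = (\<lambda>g :: nat \<Rightarrow> nat set. \<Sum>y\<in>?Y. card (g y))"
  have w: "0 \<le> ?w g" for g by (intro prod_nonneg) (simp add: subset_prob_nonneg)
  have "measure draws {u\<in>space draws. 100 * m < stored m a u n} = (\<Sum>g\<in>{g\<in>outcomes m n. 100 * m < T g}. ?w g)"
    unfolding stored_samples T_def by (rule samples_event(2))
  also have "\<dots> \<le> (\<Sum>g\<in>{g\<in>outcomes m n. 100 * m < T g}. ?w g * exp (real (T g) - 100 * real m))"
  proof (rule sum_mono)
    fix g assume "g \<in> {g\<in>outcomes m n. 100 * m < T g}"
    then have "real (100 * m) \<le> real (T g)" by (intro of_nat_mono) auto
    then have "1 \<le> exp (real (T g) - 100 * real m)" by simp
    from mult_left_mono[OF this w[of g]]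
    show "?w g \<le> ?w g * exp (real (T g) - 100 * real m)" by (simp only: mult_1_right)
  qed
  also have "\<dots> \<le> (\<Sum>g\<in>outcomes m n. ?w g * exp (real (T g) - 100 * real m))"
  proof (rule sum_mono2[OF finite_outcome_space])
    show "0 \<le> ?w g * exp (real (T g) - 100 * real m)" for g by (rule mult_nonneg_nonneg[OF w]) simp
  qed auto
  also have "\<dots> = exp (- (100 * real m)) * (\<Sum>g\<in>outcomes m n. \<Prod>y\<in>?Y. subset_prob a n (g y) * exp (card (g y)))"
    unfolding sum_distrib_left T_def
    by (intro sum.cong refl) (simp add: exp_diff exp_minus exp_sum prod.distrib field_simps)
  also have "(\<Sum>g\<in>outcomes m n. \<Prod>y\<in>?Y. subset_prob a n (g y) * exp (card (g y)))
      = (\<Prod>y\<in>?Y. \<Sum>S\<in>Pow {1..n}. subset_prob a n S * exp (card S))"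
    by (rule prod_sum_PiE[symmetric]) auto
  also have "(\<Sum>S\<in>Pow {1..n}. subset_prob a n S * exp (card S)) = (\<Prod>i\<in>{1..n}. ?p i * exp 1 + (1 - ?p i))"
  proof -
    have "subset_prob a n S * exp (card S)
        = (\<Prod>i\<in>{1..n}. if i \<in> S then ?p i * exp 1 else 1 - ?p i)" if "S \<in> Pow {1..n}" for S
    proof -
      have "exp (real (card S)) = (\<Prod>i\<in>{1..n}. if i \<in> S then exp 1 else 1)"
        using that exp_of_nat_mult[of "card S" "1::real"] by (simp add: prod.If_cases Int_absorb1)
      then show ?thesis
        unfolding subset_prob_def by (simp add: prod.distrib[symmetric]) (intro prod.cong, auto)
    qed
    then have "(\<Sum>S\<in>Pow {1..n}. subset_prob a n S * exp (card S))
        = (\<Sum>S\<in>Pow {1..n}. \<Prod>i\<in>{1..n}. if i \<in> S then ?p i * exp 1 else 1 - ?p i)"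
      by (rule sum.cong[OF refl])
    then show ?thesis by (simp only: sum_Pow_prod[OF finite_atLeastAtMost])
  qed
  finally have bound: "measure draws {u\<in>space draws. 100 * m < stored m a u n}
    \<le> exp (- (100 * real m)) * (\<Prod>y\<in>?Y. \<Prod>i\<in>{1..n}. ?p i * exp 1 + (1 - ?p i))" .
  have "(\<Prod>y\<in>?Y. \<Prod>i\<in>{1..n}. ?p i * exp 1 + (1 - ?p i)) \<le> exp 2 ^ (8 * m)"
  proof -
    have p: "0 \<le> ?p i" "?p i \<le> 1" if "i \<in> {1..n}" for i using keep_prob_bounds[OF that] by auto
    have "(\<Prod>i\<in>{1..n}. ?p i * exp 1 + (1 - ?p i)) \<le> (\<Prod>i\<in>{1..n}. exp (2 * ?p i))"
    proof (intro prod_mono conjI)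
      fix i assume i: "i \<in> {1..n}"
      have "?p i * exp 1 + (1 - ?p i) \<le> ?p i * 3 + (1 - ?p i)"
        using p[OF i] exp_le by (intro add_right_mono mult_left_mono) auto
      also have "\<dots> \<le> exp (2 * ?p i)" using exp_ge_add_one_self[of "2 * ?p i"] by (simp add: add.commute)
      finally show "?p i * exp 1 + (1 - ?p i) \<le> exp (2 * ?p i)" .
      show "0 \<le> ?p i * exp 1 + (1 - ?p i)" using p[OF i] by simp
    qed
    also have "\<dots> = exp (2 * (\<Sum>i\<in>{1..n}. ?p i))" by (simp add: exp_sum sum_distrib_left)
    also have "\<dots> \<le> exp 2" using sum_keep_prob_le[of a n] by simp
    finally have "(\<Prod>i\<in>{1..n}. ?p i * exp 1 + (1 - ?p i)) \<le> exp 2" .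
    moreover have "0 \<le> (\<Prod>i\<in>{1..n}. ?p i * exp 1 + (1 - ?p i))" using p by (intro prod_nonneg) auto
    ultimately show ?thesis by (simp add: power_mono)
  qed
  then have "exp (- (100 * real m)) * (\<Prod>y\<in>?Y. \<Prod>i\<in>{1..n}. ?p i * exp 1 + (1 - ?p i))
      \<le> exp (- (100 * real m)) * exp 2 ^ (8 * m)"
    by (rule mult_left_mono) simp
  also have "exp (- (100 * real m)) * exp 2 ^ (8 * m) = exp (- (84 * real m))"
    unfolding exp_of_nat_mult[symmetric] mult_exp_exp by simp
  finally show ?thesis using bound by (rule order_trans[rotated])
qed

section \<open>The coreset property\<close>

locale sampled_rows =
  fixes a :: "nat \<Rightarrow> real^'d" and n :: nat and H :: "real^'d^'d"
  assumes pinv: "is_pinv (rows_upto a n) H" and rank_ge_1: "1 \<le> row_rank (rows_upto a n)"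
begin

abbreviation form :: "real^'d \<Rightarrow> real^'d \<Rightarrow> real" where
  "form x y \<equiv> x \<bullet> gram_op (rows_upto a n) y"

abbreviation dual :: "nat \<Rightarrow> real^'d" where
  "dual i \<equiv> H *v a i"

abbreviation sens_of :: "nat \<Rightarrow> real" where
  "sens_of i \<equiv> sensitivity (rows_upto a n) (a i)"

abbreviation rank :: real where
  "rank \<equiv> real (row_rank (rows_upto a n))"

text \<open>Positive sensitivity allows \<open>direction\<close> to be normalised; the singletons
  left out have probability 0.\<close>

definition hit :: "nat set \<Rightarrow> bool" where
  "hit S \<longleftrightarrow> (\<exists>i\<in>{1..n}. S = {i} \<and> 0 < sens_of i)"

definition direction :: "nat set \<Rightarrow> real^'d" where
  "direction S = (1 / sqrt (sens_of (the_elem S))) *\<^sub>R dual (the_elem S)"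

text \<open>The probability that a given set is empty. It equals the probability of a hit, since
  singleton probabilities are its multiples by \<open>sens_of i / rank\<close>, which sum to
  1.\<close>

definition empty_prob :: real where
  "empty_prob = (\<Prod>i\<in>{1..n}. 1 - keep_prob a n i)"

lemma row_in_span: "i \<in> {1..n} \<Longrightarrow> a i \<in> span (set (rows_upto a n))"
  by (rule span_base) (auto simp: set_rows_upto)

lemma sens_of_nonneg: "i \<in> {1..n} \<Longrightarrow> 0 \<le> sens_of i"
  by (rule sensitivity_nonneg) (auto simp: set_rows_upto)

lemma form_dual: "i \<in> {1..n} \<Longrightarrow> form (dual i) x = a i \<bullet> x"
  by (simp only: inner_gram_op_commute gram_pinv[OF pinv row_in_span])

lemma form_dual_dual: "i \<in> {1..n} \<Longrightarrow> form (dual i) (dual i) = sens_of i"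
  by (simp only: form_dual sensitivity_eq[OF pinv row_in_span])

lemma sum_sens_of: "(\<Sum>i\<in>{1..n}. sens_of i) = rank"
  using sum_sensitivity[of "rows_upto a n"] by (simp add: sum_list_rows_upto)

lemma form_rows: "form x y = (\<Sum>i\<in>{1..n}. (a i \<bullet> x) * (a i \<bullet> y))"
  by (simp only: inner_gram_op sum_list_rows_upto)

text \<open>The Gram product of \<open>dual i\<close> with \<open>x\<close> is
  \<open>a i \<bullet> x\<close>, so Parseval's identity is the expansion of the Gram form over the
  rows.\<close>

lemma parseval_frame_dual: "parseval_frame form {1..n} dual"
proof (rule parseval_frame.intro)
  show "linear (form x)" for x by (rule linearI) (simp_all add: inner_add_right)
  show "form x y = form y x" for x y by (simp only: form_rows mult.commute)
  show "form x y = (\<Sum>i\<in>{1..n}. form (dual i) x * form (dual i) y)" for x y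
    unfolding form_rows[of x y] by (intro sum.cong refl) (simp only: form_dual)
qed simp

lemma one_minus_keep_prob:
  assumes "i \<in> {1..n}"
  shows "1 - keep_prob a n i = rank / (sens_of i + rank)" "0 < 1 - keep_prob a n i"
proof -
  have "0 < sens_of i + rank" using sens_of_nonneg[OF assms] rank_ge_1 by simp
  then show "1 - keep_prob a n i = rank / (sens_of i + rank)" by (simp add: keep_prob_def field_simps)
  then show "0 < 1 - keep_prob a n i" using \<open>0 < sens_of i + rank\<close> rank_ge_1 by simp
qed

lemma singleton_prob:
  assumes i: "i \<in> {1..n}"
  shows "subset_prob a n {i} = empty_prob * sens_of i / rank"
proof -
  have "subset_prob a n {i} = keep_prob a n i * (\<Prod>j\<in>{1..n} - {i}. 1 - keep_prob a n j)"
    unfolding subset_prob_def by (subst prod.remove[OF _ i]) (auto intro: prod.cong)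
  also have "keep_prob a n i = sens_of i / rank * (1 - keep_prob a n i)"
    using one_minus_keep_prob[OF i] rank_ge_1 by (simp add: keep_prob_def)
  finally show ?thesis
    unfolding empty_prob_def using prod.remove[OF _ i, of "\<lambda>j. 1 - keep_prob a n j"]
    by (simp add: mult.assoc)
qed

lemma empty_prob_ge: "1 / 3 \<le> empty_prob"
proof -
  have "1 / 3 \<le> exp (- 1 :: real)" using exp_le by (simp add: exp_minus field_simps)
  also have "exp (- 1) = exp (- ((\<Sum>i\<in>{1..n}. sens_of i) / rank))"
    unfolding sum_sens_of using rank_ge_1 by simp
  also have "\<dots> = (\<Prod>i\<in>{1..n}. exp (- (sens_of i / rank)))"
    by (simp add: exp_sum sum_divide_distrib flip: sum_negf)
  also have "\<dots> \<le> (\<Prod>i\<in>{1..n}. 1 - keep_prob a n i)"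
  proof (intro prod_mono conjI)
    fix i assume i: "i \<in> {1..n}"
    have pos: "0 < 1 + sens_of i / rank" using sens_of_nonneg[OF i] rank_ge_1 by (simp add: add_pos_nonneg)
    have "inverse (exp (sens_of i / rank)) \<le> inverse (1 + sens_of i / rank)"
      using pos by (intro le_imp_inverse_le) auto
    also have "\<dots> = 1 - keep_prob a n i"
      unfolding one_minus_keep_prob(1)[OF i] using rank_ge_1 pos by (simp add: field_simps)
    finally show "exp (- (sens_of i / rank)) \<le> 1 - keep_prob a n i" by (simp add: exp_minus)
  qed simp
  finally show ?thesis by (simp add: empty_prob_def)
qed

sublocale frame_sampling form "{1..n}" dual "Pow {1..n}" "subset_prob a n" hit direction rank empty_prob
proof -
  interpret F: parseval_frame form "{1..n}" dual by (rule parseval_frame_dual)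
  show "frame_sampling form {1..n} dual (Pow {1..n}) (subset_prob a n) hit direction rank empty_prob"
  proof
    show "finite (Pow {1..n})" by simp
    show "0 \<le> subset_prob a n S" for S by (rule subset_prob_nonneg)
    show "(\<Sum>S\<in>Pow {1..n}. subset_prob a n S) = 1" by (rule sum_subset_prob)
    show "form (direction S) (direction S) = 1" if "hit S" for S
    proof -
      obtain i where i: "i \<in> {1..n}" "S = {i}" "0 < sens_of i" using \<open>hit S\<close> by (auto simp: hit_def)
      then show ?thesis
        unfolding direction_def F.ip_simps using form_dual_dual[OF i(1)]
        by (simp add: field_simps)
    qed
    show "(\<Sum>i\<in>{1..n}. form (dual i) (dual i)) = rank"
      unfolding sum_sens_of[symmetric] by (intro sum.cong refl form_dual_dual)
    show "1 \<le> rank" using rank_ge_1 by simp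
    fix Q
    assume Q: "F.self_adjoint Q"
    let ?I = "{i\<in>{1..n}. 0 < sens_of i}"
    have hits: "{S\<in>Pow {1..n}. hit S} = (\<lambda>i. {i}) ` ?I" by (auto simp: hit_def)
    have "(\<Sum>S\<in>{S\<in>Pow {1..n}. hit S}. subset_prob a n S * form (direction S) (Q (direction S)))
        = (\<Sum>i\<in>?I. subset_prob a n {i} * form (direction {i}) (Q (direction {i})))"
      unfolding hits by (subst sum.reindex) (auto simp: o_def)
    also have "\<dots> = (\<Sum>i\<in>?I. empty_prob / rank * form (dual i) (Q (dual i)))"
    proof (intro sum.cong refl)
      fix i assume i: "i \<in> ?I"
      have "form (direction {i}) (Q (direction {i})) = form (dual i) (Q (dual i)) / sens_of i"
        unfolding direction_def linear_scale[OF F.self_adjoint_linear[OF Q]] F.ip_simps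
        using i by (simp add: real_sqrt_mult_self field_simps)
      then show "subset_prob a n {i} * form (direction {i}) (Q (direction {i}))
          = empty_prob / rank * form (dual i) (Q (dual i))"
        using i singleton_prob[of i] by simp
    qed
    \<comment> \<open>Rows of sensitivity 0 can be restored: their duals are null vectors of the
      form, and Cauchy-Schwarz makes their terms vanish.\<close>
    also have "\<dots> = (\<Sum>i\<in>{1..n}. empty_prob / rank * form (dual i) (Q (dual i)))"
    proof (intro sum.mono_neutral_left ballI)
      fix i assume i: "i \<in> {1..n} - ?I"
      then have "sens_of i = 0" using sens_of_nonneg[of i] by auto
      then have "(form (dual i) (Q (dual i)))\<^sup>2 \<le> 0"
        using F.cauchy_schwarz[of "dual i" "Q (dual i)"] form_dual_dual[of i] i by simp
      then show "empty_prob / rank * form (dual i) (Q (dual i)) = 0" by simp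
    qed auto
    also have "\<dots> = empty_prob / rank * F.frame_trace Q"
      by (simp only: F.frame_trace_def sum_distrib_left)
    finally show "(\<Sum>S\<in>{S\<in>Pow {1..n}. hit S}. subset_prob a n S * form (direction S) (Q (direction S)))
        = empty_prob / rank * F.frame_trace Q" .
  qed
qed

text \<open>For a hyperplane with normal \<open>x\<close> both totals are quadratic forms over
  \<open>x \<bullet> x\<close>, and the weights turn the sample total into \<open>rank / N\<close>
  times the form of \<open>sample_op\<close>. Scaling \<open>x\<close> to a unit vector of the Gram
  form makes \<open>bad\<close> applicable.\<close>

lemma coreset_if_not_bad:
  assumes pos: "\<And>y i. y \<in> {1..8 * m} \<Longrightarrow> i \<in> sampled a u n y \<Longrightarrow> 0 < sens_of i"
    and upper: "\<not> bad 1 ((1 + \<epsilon>) / rank) {1..8 * m} (samples m a n u)"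
    and lower: "\<not> bad (- 1) ((- 1 + \<epsilon>) / rank) {1..8 * m} (samples m a n u)"
  shows "is_coreset \<epsilon> (rows_upto a n) (weighted_sample m a u n)"
proof -
  let ?Y = "{1..8 * m}" and ?g = "samples m a n u"
  define idx where "idx = (\<lambda>y. the_elem (sampled a u n y))"
  define N where "N = real (card (singles m a u n))"
  have r: "0 < rank" using rank_ge_1 by simp
  have idx: "sampled a u n y = {idx y}" "idx y \<in> {1..n}" "0 < sens_of (idx y)" if y: "y \<in> singles m a u n" for y
  proof -
    obtain i where i: "sampled a u n y = {i}" using y by (auto simp: singles_def card_1_singleton_iff)
    then show "sampled a u n y = {idx y}" by (simp add: idx_def)
    then show "idx y \<in> {1..n}" using sampled_subset[of a u n y] by auto
    show "0 < sens_of (idx y)"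
      using pos[of y "idx y"] y i by (auto simp: singles_def idx_def)
  qed
  have hits: "hits ?Y ?g = singles m a u n"
  proof -
    have "hit (?g y) \<longleftrightarrow> card (?g y) = 1" if y: "y \<in> ?Y" for y
    proof -
      have g: "?g y = sampled a u n y" using y by (simp add: samples_def)
      show ?thesis
        unfolding g hit_def
      proof
        assume "card (sampled a u n y) = 1"
        then obtain i where "sampled a u n y = {i}" by (rule card_1_singletonE)
        then show "\<exists>i\<in>{1..n}. sampled a u n y = {i} \<and> 0 < sens_of i"
          using pos[OF y, of i] sampled_subset[of a u n y] by auto
      qed auto
    qed
    then show ?thesis unfolding hits_def singles_samples by blast
  qed
  have gy: "?g y = {idx y}" if "y \<in> singles m a u n" for y
    using idx(1)[OF that] that by (simp add: singles_def samples_def)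
  have dir: "(form (direction (?g y)) x)\<^sup>2 = (a (idx y) \<bullet> x)\<^sup>2 / sens_of (idx y)"
    if y: "y \<in> singles m a u n" for x y
  proof -
    have "form (direction (?g y)) x = 1 / sqrt (sens_of (idx y)) * (a (idx y) \<bullet> x)"
      unfolding gy[OF y] direction_def ip_simps the_elem_eq form_dual[OF idx(2)[OF y]] ..
    then show ?thesis using idx(3)[OF y] by (simp add: power_mult_distrib power_divide)
  qed
  have M: "form x (sample_op ?Y ?g x) = (\<Sum>y\<in>singles m a u n. (a (idx y) \<bullet> x)\<^sup>2 / sens_of (idx y))" for x
    unfolding sample_op_form hits by (intro sum.cong refl dir)
  have W: "weighted_sample m a u n = image_mset (\<lambda>y. (a (idx y), rank / (N * sens_of (idx y)))) (mset_set (singles m a u n))"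
    unfolding weighted_sample_eq N_def idx_def ..
  have fin: "finite (singles m a u n)" by (simp add: singles_def)
  have "q \<in> set (rows_upto a n) \<and> 0 < w" if qw: "(q, w) \<in># weighted_sample m a u n" for q w
  proof -
    obtain y where y: "y \<in> singles m a u n" "q = a (idx y)" "w = rank / (N * sens_of (idx y))"
      using qw fin unfolding W by auto
    then have "0 < N" unfolding N_def using fin by (auto simp: card_gt_0_iff)
    then show ?thesis using y idx r by (auto simp: set_rows_upto)
  qed
  moreover have "\<bar>total_sqdist (rows_upto a n) S - (\<Sum>(q, w)\<in>#weighted_sample m a u n. w * sqdist q S)\<bar>
      \<le> \<epsilon> * total_sqdist (rows_upto a n) S" if "S \<in> linear_hyperplanes" for S
  proof -
    obtain x where x: "x \<noteq> 0" "S = {z. x \<bullet> z = 0}" using \<open>S \<in> linear_hyperplanes\<close> by (rule linear_hyperplaneE)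
    have xx: "0 < x \<bullet> x" using x by simp
    let ?f = "form x x"
    have "(\<Sum>(q, w)\<in>#weighted_sample m a u n. w * sqdist q S)
        = (\<Sum>y\<in>singles m a u n. rank / (N * sens_of (idx y)) * sqdist (a (idx y)) S)"
      unfolding W sum_unfold_sum_mset by (simp add: image_mset.compositionality o_def)
    also have "\<dots> = rank / N * form x (sample_op ?Y ?g x) / (x \<bullet> x)"
      unfolding M x(2) sqdist_hyperplane[OF x(1)] sum_distrib_left sum_divide_distrib
      by (intro sum.cong refl) (simp add: inner_commute)
    finally have est: "(\<Sum>(q, w)\<in>#weighted_sample m a u n. w * sqdist q S)
        = rank / N * form x (sample_op ?Y ?g x) / (x \<bullet> x)" .
    have tot: "total_sqdist (rows_upto a n) S = ?f / (x \<bullet> x)"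
      unfolding x(2) by (rule total_sqdist_hyperplane[OF x(1)])
    \<comment> \<open>If \<open>?f\<close> is 0, then \<open>x\<close> is orthogonal to all rows and
      cannot be scaled, but both totals are 0.\<close>
    have "\<bar>?f - rank / N * form x (sample_op ?Y ?g x)\<bar> \<le> \<epsilon> * ?f"
    proof (cases "?f = 0")
      case True
      have "a i \<bullet> x = 0" if i: "i \<in> {1..n}" for i
      proof -
        have "(\<Sum>i\<in>{1..n}. (a i \<bullet> x)\<^sup>2) = 0" using True form_rows[of x x] by (simp add: power2_eq_square)
        then have "(a i \<bullet> x)\<^sup>2 = 0" using i by (subst (asm) sum_nonneg_eq_0_iff) auto
        then show ?thesis by simp
      qed
      then have "form x (sample_op ?Y ?g x) = 0" unfolding M using idx(2) by (intro sum.neutral) auto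
      then show ?thesis using True by simp
    next
      case False
      then have f: "0 < ?f" using ip_nonneg[of x] by simp
      define w where "w = (1 / sqrt ?f) *\<^sub>R x"
      have w: "form w w = 1" unfolding w_def ip_simps using f by (simp add: field_simps real_sqrt_mult_self)
      have Mw: "form w (sample_op ?Y ?g w) = form x (sample_op ?Y ?g x) / ?f"
      proof -
        have "(a i \<bullet> w)\<^sup>2 = (a i \<bullet> x)\<^sup>2 / ?f" for i
          using f by (simp add: w_def power_mult_distrib power_divide)
        then show ?thesis unfolding M by (simp add: sum_divide_distrib mult.commute)
      qed
      have 1: "form w (sample_op ?Y ?g w) < (1 + \<epsilon>) / rank * N"
        using upper w unfolding bad_def hits N_def by (auto simp: not_le)
      have 2: "(1 - \<epsilon>) / rank * N < form w (sample_op ?Y ?g w)"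
        using lower w unfolding bad_def hits N_def by (auto simp: not_le divide_inverse algebra_simps)
      \<comment> \<open>Without hits the two strict bounds would contradict each other.\<close>
      have N: "0 < N" using 1 2 r by (cases "N = 0") (auto simp: N_def)
      define z where "z = form x (sample_op ?Y ?g x)"
      have "z < (1 + \<epsilon>) / rank * N * ?f" "(1 - \<epsilon>) / rank * N * ?f < z"
        using 1 2 f unfolding Mw z_def[symmetric] by (simp_all only: pos_divide_less_eq pos_less_divide_eq)
      then have "rank / N * z < (1 + \<epsilon>) * ?f" "(1 - \<epsilon>) * ?f < rank / N * z"
        using r N by (simp_all add: field_simps)
      then show ?thesis unfolding z_def[symmetric] by (simp add: abs_le_iff algebra_simps)
    qed
    then have "\<bar>?f - rank / N * form x (sample_op ?Y ?g x)\<bar> / (x \<bullet> x) \<le> \<epsilon> * ?f / (x \<bullet> x)"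
      using xx by (intro divide_right_mono) auto
    moreover have "\<bar>?f / (x \<bullet> x) - rank / N * form x (sample_op ?Y ?g x) / (x \<bullet> x)\<bar>
        = \<bar>?f - rank / N * form x (sample_op ?Y ?g x)\<bar> / (x \<bullet> x)"
      using xx by (simp only: abs_divide diff_divide_distrib[symmetric] abs_of_pos)
    ultimately show ?thesis unfolding est tot by simp
  qed
  ultimately show ?thesis unfolding coreset_for_def by blast
qed

text \<open>The factors 3/16 from the tail, 8 from the number of sets and 1/3 from
  \<open>empty_prob_ge\<close> multiply to 1/2.\<close>

lemma bad_prob_le:
  assumes \<sigma>: "\<sigma> = 1 \<or> \<sigma> = - 1" and \<epsilon>: "0 < \<epsilon>" "\<epsilon> < 1"
  shows "measure draws {u\<in>space draws. bad \<sigma> ((\<sigma> + \<epsilon>) / rank) {1..8 * m} (samples m a n u)}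
    \<le> rank * exp (- (\<epsilon>\<^sup>2 * m / (2 * rank)))"
proof -
  have "measure draws {u\<in>space draws. bad \<sigma> ((\<sigma> + \<epsilon>) / rank) {1..8 * m} (samples m a n u)}
     = (\<Sum>g\<in>{g\<in>outcomes m n. bad \<sigma> ((\<sigma> + \<epsilon>) / rank) {1..8 * m} g}. weight {1..8 * m} g)"
    unfolding weight_def by (rule samples_event(2))
  also have "\<dots> \<le> rank * exp (- (3 / 16) * empty_prob * \<epsilon>\<^sup>2 / rank * card {1..8 * m})"
    by (intro tail_exp_le \<sigma> \<epsilon>) simp
  also have "\<dots> \<le> rank * exp (- (\<epsilon>\<^sup>2 * m / (2 * rank)))"
  proof -
    define X where "X = \<epsilon>\<^sup>2 * m / rank"
    have "1 / 3 * X \<le> empty_prob * X"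
      by (intro mult_right_mono empty_prob_ge) (simp add: X_def)
    then have "- (3 / 2 * (empty_prob * X)) \<le> - (X / 2)" by simp
    moreover have "- (3 / 16) * empty_prob * \<epsilon>\<^sup>2 / rank * card {1..8 * m} = - (3 / 2 * (empty_prob * X))"
      and "\<epsilon>\<^sup>2 * m / (2 * rank) = X / 2"
      by (simp_all add: X_def)
    ultimately show ?thesis by (intro mult_left_mono) (simp_all only: exp_le_cancel_iff of_nat_0_le_iff)
  qed
  finally show ?thesis .
qed

end

text \<open>A row of sensitivity 0 is kept if its random number is exactly 0. It then has a junk weight
  (division by zero), and the output is no coreset.\<close>

definition null_sampled :: "(nat \<Rightarrow> real^'d) \<Rightarrow> nat \<Rightarrow> nat \<Rightarrow> (nat \<Rightarrow> nat set) \<Rightarrow> bool" where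
  "null_sampled a n m g \<longleftrightarrow> (\<exists>y\<in>{1..8 * m}. \<exists>i\<in>g y. sensitivity (rows_upto a n) (a i) = 0)"

lemma null_sampled_prob: "measure draws {u\<in>space draws. null_sampled a n m (samples m a n u)} = 0"
proof -
  have "(\<Prod>y\<in>{1..8 * m}. subset_prob a n (g y)) = 0" if g: "g \<in> outcomes m n" "null_sampled a n m g" for g
  proof -
    obtain y i where yi: "y \<in> {1..8 * m}" "i \<in> g y" "sensitivity (rows_upto a n) (a i) = 0"
      using g(2) by (auto simp: null_sampled_def)
    then have "i \<in> {1..n}" using PiE_mem[OF g(1) yi(1)] by blast
    moreover have "keep_prob a n i = 0" using yi by (simp add: keep_prob_def)
    ultimately have "subset_prob a n (g y) = 0"
      unfolding subset_prob_def using yi by (intro prod_zero bexI[of _ i]) auto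
    then show ?thesis using yi by (intro prod_zero bexI[of _ y]) auto
  qed
  then show ?thesis unfolding samples_event(2) by (intro sum.neutral) auto
qed

text \<open>All rows are 0 here, so any sampled row would be a null sample; the output is empty and
  all distances are 0.\<close>

lemma coreset_if_zero_rank:
  assumes "row_rank (rows_upto a n) = 0" "\<not> null_sampled a n m (samples m a n u)"
  shows "is_coreset \<epsilon> (rows_upto a n) (weighted_sample m a u n)"
proof -
  have zero: "x = 0" if "x \<in> set (rows_upto a n)" for x
    using assms(1) that by (auto simp: row_rank_def dim_eq_0)
  have "sampled a u n y = {}" if y: "y \<in> {1..8 * m}" for y
  proof (rule ccontr)
    assume "sampled a u n y \<noteq> {}"
    then obtain i where i: "i \<in> sampled a u n y" by blast
    then have "a i \<in> set (rows_upto a n)" using sampled_subset[of a u n y] unfolding set_rows_upto by blast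
    then have "sensitivity (rows_upto a n) (a i) = 0" using zero sensitivity_zero by metis
    then have "null_sampled a n m (samples m a n u)"
      unfolding null_sampled_def using i y by (intro bexI[of _ y] bexI[of _ i]) (auto simp: samples_def)
    then show False using assms(2) by simp
  qed
  then have "singles m a u n = {}" by (auto simp: singles_def)
  then have W: "weighted_sample m a u n = {#}" by (simp add: weighted_sample_eq)
  have "total_sqdist (rows_upto a n) S = 0" if "S \<in> linear_hyperplanes" for S
  proof -
    have "sqdist 0 S = 0" using that by (intro sqdist_self) (auto simp: linear_hyperplanes_def subspace_0)
    then have "(\<Sum>x\<leftarrow>rows_upto a n. sqdist x S) = (\<Sum>x\<leftarrow>rows_upto a n. 0)"
      using zero by (intro arg_cong[of _ _ sum_list] map_cong) auto
    then show ?thesis by (simp add: total_sqdist_def)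
  qed
  then show ?thesis by (simp add: coreset_for_def W)
qed

text \<open>The output as a function of the finite-valued samples, the form to which
  \<open>samples_event\<close> applies.\<close>

definition weighted_samples :: "nat \<Rightarrow> (nat \<Rightarrow> real^'d) \<Rightarrow> nat \<Rightarrow> (nat \<Rightarrow> nat set) \<Rightarrow> ((real^'d) \<times> real) multiset" where
  "weighted_samples m a n g = (let Y = {y\<in>{1..8 * m}. card (g y) = 1} in
    image_mset (\<lambda>y. (a (the_elem (g y)), real (row_rank (rows_upto a n))
      / (real (card Y) * sensitivity (rows_upto a n) (a (the_elem (g y)))))) (mset_set Y))"

lemma weighted_sample_samples: "weighted_sample m a u n = weighted_samples m a n (samples m a n u)"
proof -
  have "samples m a n u y = sampled a u n y" if "y \<in> {y\<in>{1..8 * m}. card (samples m a n u y) = 1}" for y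
    using that by (simp add: samples_def)
  then show ?thesis
    unfolding weighted_sample_eq weighted_samples_def Let_def singles_samples
    by (intro image_mset_cong) simp
qed

lemma coreset_failure_prob:
  fixes a :: "nat \<Rightarrow> real^'d"
  assumes \<epsilon>: "0 < \<epsilon>" "\<epsilon> < 1"
  shows "measure draws {u\<in>space draws. \<not> is_coreset \<epsilon> (rows_upto a n) (weighted_sample m a u n)}
    \<le> 2 * CARD('d) * exp (- (\<epsilon>\<^sup>2 * m / (2 * CARD('d))))"
proof -
  interpret prob_space draws by (rule prob_space_draws)
  let ?F = "{u\<in>space draws. \<not> is_coreset \<epsilon> (rows_upto a n) (weighted_sample m a u n)}"
  let ?N = "{u\<in>space draws. null_sampled a n m (samples m a n u)}"
  show ?thesis
  proof (cases "row_rank (rows_upto a n) = 0")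
    case True
    have "?F \<subseteq> ?N" using coreset_if_zero_rank[OF True] by blast
    then have "measure draws ?F \<le> measure draws ?N"
      by (intro finite_measure_mono samples_event(1))
    then have "measure draws ?F \<le> 0" by (simp only: null_sampled_prob)
    then show ?thesis by (rule order_trans) simp
  next
    case False
    obtain H where "is_pinv (rows_upto a n) H" using exists_pinv_rank[of "rows_upto a n"] by blast
    then interpret R: sampled_rows a n H using False by unfold_locales auto
    let ?B = "\<lambda>\<sigma>. {u\<in>space draws. R.bad \<sigma> ((\<sigma> + \<epsilon>) / R.rank) {1..8 * m} (samples m a n u)}"
    have "?F \<subseteq> ?N \<union> (?B 1 \<union> ?B (- 1))"
    proof
      fix u assume u: "u \<in> ?F"
      show "u \<in> ?N \<union> (?B 1 \<union> ?B (- 1))"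
      proof (rule ccontr)
        assume neg: "u \<notin> ?N \<union> (?B 1 \<union> ?B (- 1))"
        have "0 < R.sens_of i" if yi: "y \<in> {1..8 * m}" "i \<in> sampled a u n y" for y i
        proof -
          have "i \<in> {1..n}" using yi(2) sampled_subset by blast
          moreover have "R.sens_of i \<noteq> 0" using neg u yi by (auto simp: null_sampled_def samples_def)
          ultimately show ?thesis using R.sens_of_nonneg[of i] by simp
        qed
        then have "is_coreset \<epsilon> (rows_upto a n) (weighted_sample m a u n)"
          using neg u by (intro R.coreset_if_not_bad) auto
        then show False using u by simp
      qed
    qed
    then have "measure draws ?F \<le> measure draws (?N \<union> (?B 1 \<union> ?B (- 1)))"
      by (intro finite_measure_mono sets.Un samples_event(1))
    also have "\<dots> \<le> measure draws ?N + measure draws (?B 1 \<union> ?B (- 1))"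
      by (intro measure_Un_le sets.Un samples_event(1))
    also have "\<dots> \<le> measure draws ?N + (measure draws (?B 1) + measure draws (?B (- 1)))"
      by (intro add_left_mono measure_Un_le samples_event(1))
    also have "\<dots> \<le> 0 + (R.rank * exp (- (\<epsilon>\<^sup>2 * m / (2 * R.rank))) + R.rank * exp (- (\<epsilon>\<^sup>2 * m / (2 * R.rank))))"
      by (intro add_mono R.bad_prob_le \<epsilon>) (auto simp: null_sampled_prob)
    also have "\<dots> = 2 * (R.rank * exp (- (\<epsilon>\<^sup>2 * m / (2 * R.rank))))" by simp
    \<comment> \<open>The bound increases with the rank, which is at most the dimension.\<close>
    also have "\<dots> \<le> 2 * (CARD('d) * exp (- (\<epsilon>\<^sup>2 * m / (2 * CARD('d)))))"
    proof (intro mult_left_mono mult_mono)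
      have "row_rank (rows_upto a n) \<le> CARD('d)"
        unfolding row_rank_def using dim_subset_UNIV[of "set (rows_upto a n)"] by simp
      then show r: "R.rank \<le> real CARD('d)" by simp
      have "\<epsilon>\<^sup>2 * m / (2 * real CARD('d)) \<le> \<epsilon>\<^sup>2 * m / (2 * R.rank)"
        using r False by (intro divide_left_mono) auto
      then show "exp (- (\<epsilon>\<^sup>2 * m / (2 * R.rank))) \<le> exp (- (\<epsilon>\<^sup>2 * m / (2 * CARD('d))))" by simp
    qed auto
    finally show ?thesis by (simp add: mult.assoc)
  qed
qed

section \<open>Failure probability, time and space\<close>

text \<open>Absorbs the squared logarithm of the sample size into a second factor \<open>d\<close>
  of the time bound. The proof applies \<open>ln s \<le> s / e\<close> to the square root.\<close>

lemma log2_square_le: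
  fixes x :: real
  assumes "1 \<le> x"
  shows "(log 2 x)\<^sup>2 \<le> 2 * x"
proof -
  define s where "s = sqrt x"
  have s: "1 \<le> s" "x = s * s" using assms by (auto simp: s_def)
  have e: "5 / 2 \<le> exp (1 :: real)" using exp_lower_Taylor_quadratic[of 1] by simp
  have "ln (s / exp 1) \<le> s / exp 1 - 1" using s by (intro ln_le_minus_one) auto
  then have "ln s \<le> s / exp 1" using s by (simp add: ln_div)
  also have "\<dots> \<le> s / (5 / 2)" using s e by (intro divide_left_mono) auto
  finally have "ln x \<le> 4 / 5 * s" using s by (simp add: ln_mult)
  \<comment> \<open>The factor 4/3 works because 8/9 exceeds 4/5, while its square 16/9 is below
    2.\<close>
  moreover have "2 / 3 * (4 / 3 * s) \<le> ln 2 * (4 / 3 * s)"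
    using s ln2_ge_two_thirds by (intro mult_right_mono) auto
  ultimately have "ln x \<le> ln 2 * (4 / 3 * s)" using s(1) by linarith
  then have "log 2 x \<le> 4 / 3 * s" by (simp add: log_def field_simps)
  moreover have "0 \<le> log 2 x" using assms by simp
  ultimately have "(log 2 x)\<^sup>2 \<le> (4 / 3 * s)\<^sup>2" by (intro power_mono)
  also have "\<dots> = 16 / 9 * x" using s by (simp add: power2_eq_square)
  also have "\<dots> \<le> 2 * x" using assms by simp
  finally show ?thesis .
qed

context
  fixes d m :: nat and \<epsilon> \<delta> :: real
  assumes d: "1 \<le> d" and \<epsilon>: "0 < \<epsilon>" "\<epsilon> < 1" and \<delta>: "0 < \<delta>" "\<delta> < 1"
    and m: "m = sample_size d \<epsilon> \<delta>"
begin

section \<open>Numerical consequences of the sample size\<close>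

lemma eps_square: "0 < \<epsilon>\<^sup>2" "\<epsilon>\<^sup>2 \<le> 1"
  using \<epsilon> by (auto simp: power_le_one)

lemma dim_over_eps_ge: "real d \<le> real d / \<epsilon>\<^sup>2"
  using eps_square d by (simp add: field_simps)

lemma ln_two_over_delta: "ln (2 / \<delta>) = ln 2 + ln (1 / \<delta>)" "0 \<le> ln (1 / \<delta>)"
  using \<delta> by (auto simp: ln_div)

lemma sample_size_bounds:
  shows "3 * (real d / \<epsilon>\<^sup>2) * ((log 2 (real d))\<^sup>2 + ln (2 / \<delta>)) \<le> real m"
    and "real m \<le> 3 * (real d / \<epsilon>\<^sup>2) * ((log 2 (real d))\<^sup>2 + ln (2 / \<delta>)) + 1"
proof -
  let ?x = "3 * (real d / \<epsilon>\<^sup>2) * ((log 2 (real d))\<^sup>2 + ln (2 / \<delta>))"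
  have "0 \<le> ?x" using \<delta> by (intro mult_nonneg_nonneg add_nonneg_nonneg) auto
  then have "real m = of_int \<lceil>?x\<rceil>" unfolding m sample_size_def times_divide_eq_right[symmetric] by simp
  then show "?x \<le> real m" "real m \<le> ?x + 1" by linarith+
qed

text \<open>The squared logarithm pays for the dimension factor of the matrix bound:
  \<open>ln d \<le> log 2 d \<le> (log 2 d)^2\<close> once \<open>d\<close> is at least 2.\<close>

lemma dim_exp_le: "real d * exp (- (3 / 2 * (log 2 (real d))\<^sup>2)) \<le> 1"
proof (cases "d = 1")
  case False
  define x where "x = log 2 (real d)"
  have d2: "2 \<le> real d" using d False by simp
  then have x: "1 \<le> x" by (simp add: x_def)
  have "ln (real d) = ln 2 * x" using d2 by (simp add: x_def log_def)
  also have "\<dots> \<le> 1 * x" using x ln_2_less_1 by (intro mult_right_mono) auto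
  finally have "ln (real d) \<le> x * 1" by simp
  also have "x * 1 \<le> x * x" using x by (intro mult_left_mono) auto
  finally have "ln (real d) \<le> x * x" .
  moreover have "0 \<le> x * x" by simp
  ultimately have "ln (real d) \<le> 3 / 2 * x\<^sup>2" unfolding power2_eq_square by linarith
  then have "exp (ln (real d)) * exp (- (3 / 2 * x\<^sup>2)) \<le> 1" unfolding mult_exp_exp by simp
  then show ?thesis using d2 by (simp add: x_def)
qed simp

text \<open>Three quarters of \<delta> go to the coreset property and one quarter to excessive
  storage. With \<open>exp (- l) = \<delta> / 2\<close>, the coreset part is at most \<delta> times
  \<open>exp (- l / 2)\<close>, which is below 3/4, and the storage part is at most the cube of
  \<open>\<delta> / 2\<close>.\<close>

lemma failure_prob_le:
  "2 * real d * exp (- (\<epsilon>\<^sup>2 * m / (2 * real d))) + exp (- (84 * real m)) \<le> \<delta>"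
proof -
  let ?L = "(log 2 (real d))\<^sup>2"
  define l where "l = ln (2 / \<delta>)"
  have exp_l: "exp (- l) = \<delta> / 2" using \<delta> by (simp add: l_def exp_minus)
  have l: "0 \<le> l" using \<delta> by (simp add: l_def)
  note size = sample_size_bounds(1)[folded l_def]
  have "3 / 2 * (?L + l) = (3 * (real d / \<epsilon>\<^sup>2) * (?L + l)) * (\<epsilon>\<^sup>2 / (2 * real d))"
    using d eps_square by simp
  also have "\<dots> \<le> real m * (\<epsilon>\<^sup>2 / (2 * real d))"
    by (intro mult_right_mono size) auto
  finally have "exp (- (\<epsilon>\<^sup>2 * m / (2 * real d))) \<le> exp (- (3 / 2 * (?L + l)))" by (simp add: mult.commute)
  then have "2 * real d * exp (- (\<epsilon>\<^sup>2 * m / (2 * real d))) \<le> 2 * real d * exp (- (3 / 2 * (?L + l)))"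
    by (intro mult_left_mono) auto
  also have "\<dots> = 2 * (real d * exp (- (3 / 2 * ?L))) * (exp (- l) * exp (- (l / 2)))"
  proof -
    have "exp (- (3 / 2 * (?L + l))) = exp (- (3 / 2 * ?L)) * (exp (- l) * exp (- (l / 2)))"
      unfolding mult_exp_exp by (simp add: algebra_simps)
    then show ?thesis by simp
  qed
  also have "\<dots> \<le> 2 * 1 * (\<delta> / 2 * (3 / 4))"
  proof (intro mult_mono)
    show "real d * exp (- (3 / 2 * ?L)) \<le> 1" by (rule dim_exp_le)
    show "exp (- l) \<le> \<delta> / 2" using exp_l by simp
    have "(exp (- (l / 2)))\<^sup>2 = exp (- l)" unfolding power2_eq_square mult_exp_exp by simp
    also have "\<dots> \<le> (3 / 4)\<^sup>2" using \<delta> by (simp add: exp_l power2_eq_square)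
    finally show "exp (- (l / 2)) \<le> 3 / 4" by (rule power2_le_imp_le) simp
  qed (use \<delta> in auto)
  finally have 1: "2 * real d * exp (- (\<epsilon>\<^sup>2 * m / (2 * real d))) \<le> 3 / 4 * \<delta>" by simp
  have "3 * 1 * l \<le> 3 * (real d / \<epsilon>\<^sup>2) * (?L + l)"
    using l d dim_over_eps_ge by (intro mult_mono) auto
  then have "3 * l \<le> 84 * real m" using size by simp
  then have "exp (- (84 * real m)) \<le> exp (- l) * (exp (- l) * exp (- l))"
    unfolding mult_exp_exp by simp
  also have "\<dots> \<le> \<delta> / 2 * (1 / 2 * 1)" unfolding exp_l using \<delta> by (intro mult_left_mono mult_mono) auto
  finally show ?thesis using 1 by simp
qed

text \<open>Here 772 is 72 + 7 * 100, the cost at the storage threshold \<open>100 * m\<close>. The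
  logarithmic bracket is at most \<open>3 * q\<close>, hence
  \<open>m \<le> 9 * X + 1\<close>.\<close>

lemma time_le:
  "772 * real m + 15 * real d + 9 \<le> 10000 * ((1 + ln (1 / \<delta>)) / \<epsilon>\<^sup>2) * (real d)\<^sup>2"
proof -
  let ?l = "ln (1 / \<delta>)" and ?P = "real d / \<epsilon>\<^sup>2"
  note l = ln_two_over_delta
  have d1: "1 \<le> real d" using d by simp
  then have P: "real d \<le> ?P" "1 \<le> ?P" using dim_over_eps_ge by auto
  define q where "q = real d * (1 + ?l)"
  have "real d * 1 \<le> q" "1 * (1 + ?l) \<le> q"
    unfolding q_def using l d1 by (auto intro!: mult_left_mono mult_right_mono)
  then have dl: "real d \<le> q" "1 + ?l \<le> q" by simp_all
  define X where "X = ?P * q"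
  have "(log 2 (real d))\<^sup>2 + ln (2 / \<delta>) \<le> 2 * real d + 1 + ?l"
    using log2_square_le[OF d1] ln_2_less_1 unfolding l(1) by linarith
  also have "\<dots> \<le> 3 * q" using dl by linarith
  finally have "3 * ?P * ((log 2 (real d))\<^sup>2 + ln (2 / \<delta>)) \<le> 3 * ?P * (3 * q)"
    using P by (intro mult_left_mono) auto
  moreover have "3 * ?P * (3 * q) = 9 * X" by (simp add: X_def)
  ultimately have m: "real m \<le> 9 * X + 1" using sample_size_bounds(2) by linarith
  have "1 * real d \<le> X" unfolding X_def using P dl d1 by (intro mult_mono) auto
  then have "772 * real m + 15 * real d + 9 \<le> 10000 * X" using m d1 by linarith
  then show ?thesis by (simp add: X_def q_def power2_eq_square ac_simps)
qed

text \<open>Here 340 is 40 + 3 * 100. For \<open>d = 1\<close> the right side tends to 0 as \<delta>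
  tends to 1, while the left side exceeds 10; the assumption keeps the bracket at least 2/3.\<close>

lemma space_le:
  assumes "2 \<le> d \<or> \<delta> \<le> 1 / 2"
  shows "340 * real m + 4 * real d + 10
    \<le> 10000 * (real d / \<epsilon>\<^sup>2 * ((log 2 (real d))\<^sup>2 + ln (1 / \<delta>)))"
proof -
  let ?l = "ln (1 / \<delta>)" and ?P = "real d / \<epsilon>\<^sup>2" and ?L = "(log 2 (real d))\<^sup>2"
  note l = ln_two_over_delta
  have d1: "1 \<le> real d" using d by simp
  then have P: "real d \<le> ?P" "1 \<le> ?P" using dim_over_eps_ge by auto
  have Ll: "2 / 3 \<le> ?L + ?l"
    using assms
  proof
    assume "2 \<le> d"
    then have "1 \<le> log 2 (real d)" by simp
    then have "1\<^sup>2 \<le> ?L" by (intro power_mono) auto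
    then show ?thesis using l(2) by simp
  next
    assume "\<delta> \<le> 1 / 2"
    then have "ln 2 \<le> ?l" using \<delta> by (subst ln_le_cancel_iff) (auto simp: field_simps)
    moreover have "0 \<le> ?L" by simp
    ultimately show ?thesis using ln2_ge_two_thirds by linarith
  qed
  define Z where "Z = ?P * (?L + ?l)"
  have dZ: "real d * (2 / 3) \<le> Z" unfolding Z_def using P Ll d1 by (intro mult_mono) auto
  \<comment> \<open>The extra \<open>ln 2\<close> is below 1, which is at most 3/2 of the bracket;
    this gives 5/2.\<close>
  have "3 * ?P * (?L + ln (2 / \<delta>)) \<le> 3 * ?P * (5 / 2 * (?L + ?l))"
    using P Ll ln_2_less_1 unfolding l(1) by (intro mult_left_mono) auto
  moreover have "3 * ?P * (5 / 2 * (?L + ?l)) = 15 / 2 * Z"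
    unfolding Z_def by (simp only: mult_ac)
  ultimately have "real m \<le> 15 / 2 * Z + 1" using sample_size_bounds(2) by linarith
  then have "340 * real m + 4 * real d + 10 \<le> 10000 * Z" using dZ d1 by linarith
  then show ?thesis by (simp add: Z_def)
qed

end

section \<open>Cost of an update in terms of the stored rows\<close>

lemma card_singles_le: "card (singles m a u n) \<le> 8 * m"
proof -
  have "singles m a u n \<subseteq> {1..8 * m}" by (auto simp: singles_def)
  then have "card (singles m a u n) \<le> card {1..8 * m}" by (intro card_mono) auto
  then show ?thesis by simp
qed

lemma time_at_le:
  fixes a :: "nat \<Rightarrow> real^'d"
  shows "real (time_at m a u (Suc k)) \<le> 72 * real m + 15 * real CARD('d) + 9 + 7 * real (stored m a u k)"
proof -
  have "1 \<le> CARD('d)" by (simp add: Suc_leI)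
  then have "time_at m a u (Suc k) \<le> 72 * m + 15 * CARD('d) + 9 + 7 * stored m a u k"
    using card_singles_le[of m a u "Suc k"] unfolding time_at_Suc by auto
  then have "real (time_at m a u (Suc k)) \<le> real (72 * m + 15 * CARD('d) + 9 + 7 * stored m a u k)"
    by (rule of_nat_mono)
  then show ?thesis by simp
qed

lemma space_at_le:
  fixes a :: "nat \<Rightarrow> real^'d"
  shows "real (space_at m a u (Suc k)) \<le> 40 * real m + 4 * real CARD('d) + 10 + 3 * real (stored m a u k)"
proof -
  have "space_at m a u (Suc k) \<le> 40 * m + 4 * CARD('d) + 10 + 3 * stored m a u k"
    using card_singles_le[of m a u "Suc k"] unfolding space_at_Suc by auto
  then have "real (space_at m a u (Suc k)) \<le> real (40 * m + 4 * CARD('d) + 10 + 3 * stored m a u k)"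
    by (rule of_nat_mono)
  then show ?thesis by simp
qed

text \<open>Time and space are dominated by affine functions of the number of stored rows, so its
  expectation bounds theirs.\<close>

lemma expected_affine_stored_le:
  assumes f: "\<And>u. f u \<le> b + c * real (stored m a u k)" and nn: "0 \<le> b" "0 \<le> c" and B: "b + c * (8 * real m) \<le> B"
  shows "(\<integral>\<^sup>+u. ennreal (f u) \<partial>draws) \<le> ennreal B"
proof -
  interpret prob_space draws by (rule prob_space_draws)
  have meas: "(\<lambda>u. ennreal (real (stored m a u k))) \<in> borel_measurable draws"
  proof -
    have "(\<lambda>u. stored m a u k) \<in> measurable draws (count_space UNIV)"
      unfolding measurable_count_space_eq2_countable stored_samples
    proof (intro conjI ballI)
      fix t
      have "(\<lambda>u. \<Sum>y = 1..8 * m. card (samples m a k u y)) -` {t} \<inter> space draws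
          = {u\<in>space draws. (\<Sum>y = 1..8 * m. card (samples m a k u y)) = t}" by auto
      also have "\<dots> \<in> sets draws" by (rule samples_event(1))
      finally show "(\<lambda>u. \<Sum>y = 1..8 * m. card (samples m a k u y)) -` {t} \<inter> space draws \<in> sets draws" .
    qed auto
    then show ?thesis by (rule measurable_compose) simp
  qed
  have "(\<integral>\<^sup>+u. ennreal (f u) \<partial>draws) \<le> (\<integral>\<^sup>+u. ennreal b + ennreal c * ennreal (real (stored m a u k)) \<partial>draws)"
  proof (intro nn_integral_mono)
    fix u
    have "ennreal (f u) \<le> ennreal (b + c * real (stored m a u k))" by (intro ennreal_leI f)
    also have "\<dots> = ennreal b + ennreal c * ennreal (real (stored m a u k))"
      using nn by (simp add: ennreal_plus ennreal_mult)
    finally show "ennreal (f u) \<le> \<dots>" .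
  qed
  also have "\<dots> = ennreal b + ennreal c * (\<integral>\<^sup>+u. ennreal (real (stored m a u k)) \<partial>draws)"
    using meas by (simp add: nn_integral_add nn_integral_cmult emeasure_space_1)
  also have "\<dots> \<le> ennreal b + ennreal c * ennreal (8 * m)"
    by (intro add_left_mono mult_left_mono expected_stored_le) auto
  also have "\<dots> = ennreal (b + c * (8 * real m))"
    using nn by (simp add: ennreal_plus ennreal_mult)
  also have "\<dots> \<le> ennreal B" by (intro ennreal_leI B)
  finally show ?thesis .
qed

text \<open>If all draws are 0, every row is kept, so no cost bound independent of \<open>n\<close>
  holds surely. The bounds therefore hold together with the coreset property in one event of
  probability at least \<open>1 - \<delta>\<close>, and also in expectation. The time is quadratic
  in the dimension for fixed \<epsilon> and \<delta>.\<close>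

theorem mainTheorem1:
  fixes a :: "nat \<Rightarrow> real^'d" and \<epsilon> \<delta> space_bound time_bound :: real and n m :: nat
  assumes eps: "0 < \<epsilon>" "\<epsilon> < 1"
    and delta: "0 < \<delta>" "\<delta> < 1"
    and n: "n \<ge> 1"
    and m: "m = sample_size CARD('d) \<epsilon> \<delta>"
    and space_bound:
      "space_bound = 10000 * (real CARD('d) / \<epsilon>\<^sup>2 * ((log 2 (real CARD('d)))\<^sup>2 + ln (1 / \<delta>)))"
    and time_bound:
      "time_bound = 10000 * ((1 + ln (1 / \<delta>)) / \<epsilon>\<^sup>2) * (real CARD('d))\<^sup>2"
  shows "(\<forall>u. output_at m a u n = weighted_sample m a u n) \<and>
     \<P>(u in draws. is_coreset \<epsilon> (rows_upto a n) (weighted_sample m a u n)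
        \<and> (CARD('d) \<ge> 2 \<or> \<delta> \<le> 1 / 2 \<longrightarrow> real (space_at m a u n) \<le> space_bound)
        \<and> real (time_at m a u n) \<le> time_bound) \<ge> 1 - \<delta> \<and>
     (CARD('d) \<ge> 2 \<or> \<delta> \<le> 1 / 2 \<longrightarrow>
        (\<integral>\<^sup>+u. ennreal (real (space_at m a u n)) \<partial>draws) \<le> ennreal space_bound) \<and>
     (\<integral>\<^sup>+u. ennreal (real (time_at m a u n)) \<partial>draws) \<le> ennreal time_bound"
proof -
  interpret prob_space draws by (rule prob_space_draws)
  obtain k where k: "n = Suc k" using n by (cases n) auto
  have d: "1 \<le> CARD('d)" by (simp add: Suc_leI)
  note time = time_le[OF d eps delta m, folded time_bound]
  note space = space_le[OF d eps delta m, folded space_bound]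
  let ?good = "\<lambda>u. is_coreset \<epsilon> (rows_upto a n) (weighted_sample m a u n)
        \<and> (CARD('d) \<ge> 2 \<or> \<delta> \<le> 1 / 2 \<longrightarrow> real (space_at m a u n) \<le> space_bound)
        \<and> real (time_at m a u n) \<le> time_bound"
  let ?fail = "{u\<in>space draws. \<not> is_coreset \<epsilon> (rows_upto a n) (weighted_sample m a u n)}"
  \<comment> \<open>The index is \<open>k\<close> because the costs of update \<open>Suc k\<close>
    depend on the rows stored after update \<open>k\<close>.\<close>
  let ?large = "{u\<in>space draws. 100 * m < stored m a u k}"
  have good: "{u\<in>space draws. ?good u} \<in> sets draws"
    unfolding k time_at_Suc space_at_Suc weighted_sample_samples stored_samples singles_samples
    by (rule samples_event2)
  have fail: "?fail \<in> sets draws" unfolding weighted_sample_samples by (rule samples_event(1))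
  have large: "?large \<in> sets draws" unfolding stored_samples by (rule samples_event(1))
  have "{u\<in>space draws. \<not> ?good u} \<subseteq> ?fail \<union> ?large"
  proof
    fix u assume u: "u \<in> {u\<in>space draws. \<not> ?good u}"
    show "u \<in> ?fail \<union> ?large"
    proof (cases "stored m a u k \<le> 100 * m")
      case True
      then have "real (stored m a u k) \<le> real (100 * m)" by (rule of_nat_mono)
      then have "real (time_at m a u n) \<le> 772 * real m + 15 * real CARD('d) + 9"
        and "real (space_at m a u n) \<le> 340 * real m + 4 * real CARD('d) + 10"
        using time_at_le[of m a u k] space_at_le[of m a u k] unfolding k by simp_all
      then have "real (time_at m a u n) \<le> time_bound"
        and "CARD('d) \<ge> 2 \<or> \<delta> \<le> 1 / 2 \<longrightarrow> real (space_at m a u n) \<le> space_bound"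
        using time space by (meson order_trans)+
      then show ?thesis using u by blast
    next
      case False
      then show ?thesis using u by simp
    qed
  qed
  then have "prob {u\<in>space draws. \<not> ?good u} \<le> prob (?fail \<union> ?large)"
    by (intro finite_measure_mono sets.Un fail large)
  also have "\<dots> \<le> prob ?fail + prob ?large" by (intro measure_Un_le fail large)
  also have "\<dots> \<le> 2 * CARD('d) * exp (- (\<epsilon>\<^sup>2 * m / (2 * CARD('d)))) + exp (- (84 * real m))"
    by (intro add_mono coreset_failure_prob eps stored_tail)
  also have "\<dots> \<le> \<delta>" using failure_prob_le[OF d eps delta m] by simp
  finally have "prob {u\<in>space draws. \<not> ?good u} \<le> \<delta>" .
  then have prob: "\<P>(u in draws. ?good u) \<ge> 1 - \<delta>"
    using prob_neg[OF good] by simp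
  have "\<forall>u. output_at m a u n = weighted_sample m a u n" unfolding k using output_at_Suc by blast
  moreover have "CARD('d) \<ge> 2 \<or> \<delta> \<le> 1 / 2 \<longrightarrow>
      (\<integral>\<^sup>+u. ennreal (real (space_at m a u n)) \<partial>draws) \<le> ennreal space_bound"
  proof
    assume "CARD('d) \<ge> 2 \<or> \<delta> \<le> 1 / 2"
    \<comment> \<open>The expected number of stored rows is at most \<open>8 * m\<close>, below the
      threshold \<open>100 * m\<close> built into \<open>space\<close>.\<close>
    then have "(40 * real m + 4 * real CARD('d) + 10) + 3 * (8 * real m) \<le> space_bound"
      using space by simp
    then show "(\<integral>\<^sup>+u. ennreal (real (space_at m a u n)) \<partial>draws) \<le> ennreal space_bound"
      unfolding k by (rule expected_affine_stored_le[OF space_at_le, rotated 2]) auto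
  qed
  moreover have "(\<integral>\<^sup>+u. ennreal (real (time_at m a u n)) \<partial>draws) \<le> ennreal time_bound"
  proof -
    have "(72 * real m + 15 * real CARD('d) + 9) + 7 * (8 * real m) \<le> time_bound" using time by simp
    then show ?thesis
      unfolding k by (rule expected_affine_stored_le[OF time_at_le, rotated 2]) auto
  qed
  ultimately show ?thesis using prob by blast
qed

end
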